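(* Let $\Gamma$ be a countable discrete sofic group with sofic approximation $\sigma_i\colon\Gamma\to S_{d_i}$, and let $f\in M_n(\mathbb{Z}(\Gamma))\cap GL_n(L(\Gamma))$. Then for every $k\in\mathbb{N}$, every $k$-tuple of points in $X_f$ is a $(\sigma_i)_i$-$\mathrm{IE}$-$k$-tuple for the action $\Gamma\curvearrowright X_f$.
   Context: For $n\in\mathbb{N}$, $u_n$ is the uniform probability measure on $\{1,\dots,n\}$ and $S_n$ is the symmetric group. A sofic approximation of a countable discrete group $\Gamma$ is a sequence of functions (not assumed to be homomorphisms) $\sigma_i\colon\Gamma\to S_{d_i}$ such that $u_{d_i}(\{j:\sigma_i(gh)(j)=\sigma_i(g)\sigma_i(h)(j)\})\to 1$ for all $g,h\in\Gamma$ and $u_{d_i}(\{j:\sigma_i(g)(j)\ne j\})\to 1$ for all $g\in\Gamma\setminus\{e\}$. $\Gamma$ is sofic if it has a sofic approximation. $\mathbb{Z}(\Gamma)\subseteq\mathbb{C}(\Gamma)$ are the integral and complex group rings; $\lambda$ is the left regular representation on $\ell^2(\Gamma)$, $(\lambda(g)\xi)(h)=\xi(g^{-1}h)$, extended linearly to $\mathbb{C}(\Gamma)$; $L(\Gamma)$ is the weak operator closure of $\lambda(\mathbb{C}(\Gamma))$ in $B(\ell^2(\Gamma))$, and $\mathbb{C}(\Gamma)$ is identified with $\lambda(\mathbb{C}(\Gamma))$. $GL_n(L(\Gamma))$ is the group of invertible elements of $M_n(L(\Gamma))$. For $f\in M_n(\mathbb{Z}(\Gamma))$ let $r(f)$ be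 right multiplication by $f$ on row vectors, $(r(f)\xi)(m)=\sum_{l=1}^n\xi(l)f_{lm}$, and let $X_f$ be the Pontryagin dual (continuous homomorphisms into $\mathbb{T}=\mathbb{R}/\mathbb{Z}$, topology of pointwise convergence) of $\mathbb{Z}(\Gamma)^{\oplus n}/r(f)\mathbb{Z}(\Gamma)^{\oplus n}$. $\Gamma$ acts on $X_f$ by $(g\theta)(a)=\theta(g^{-1}a)$. Let $\Gamma\curvearrowright X$ by homeomorphisms with $X$ compact metrizable. A continuous pseudometric $\rho$ on $X$ is dynamically generating if for all $x\ne y$ there is $g\in\Gamma$ with $\rho(gx,gy)>0$. For $\phi,\psi\in X^{d}$ put $\rho_{2,d}(\phi,\psi)^2=\frac1d\sum_{j=1}^d\rho(\phi(j),\psi(j))^2$. For finite $F\subseteq\Gamma$, $\delta>0$, $\mathrm{Map}(\rho,F,\delta,\sigma_i)$ is the set of $\phi\in X^{d_i}$ with $\max_{g\in F}\rho_{2,d_i}(\phi\circ\sigma_i(g),g\phi)<\delta$, where $(g\phi)(j)=g\phi(j)$. Independence tuples (Kerr–Li): fix a continuous dynamically generating pseudometric $\rho$ (the notion does not depend on it). For a tuple $U=(U_1,\dots,U_k)$ of subsets of $X$, a set $J\subseteq\{1,\dots,d_i\}$ is a $(\rho,F,\delta,\sigma_i)$-independence set for $U$ if for every $c\colon J\to\{1,\dots,k\}$ there is $\phi\in\mathrm{Map}(\rho,F,\delta,\sigma_i)$ with $\phi(j)\in U_{c(j)}$ for all $j\in J$. The tuple $(x_1,\dots,x_k)\in X^k$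 is a $(\sigma_i)_i$-$\mathrm{IE}$-$k$-tuple if for all neighborhoods $U_l$ of $x_l$ ($1\le l\le k$) there is $r>0$ such that for every finite $F\subseteq\Gamma$ and $\delta>0$ there are infinitely many $i$ for which $(U_1,\dots,U_k)$ has a $(\rho,F,\delta,\sigma_i)$-independence set of cardinality at least $r d_i$. *)

theory Defs
  imports
    "HOL-Analysis.Analysis"
    "HOL-Library.Poly_Mapping"
    "HOL-Combinatorics.Permutations"
    "HOL-Algebra.Coset"
begin

text \<open>
  Throughout, \<open>\<Gamma>\<close> is a type \<open>'g :: {group_add, countable}\<close>. The class \<open>group_add\<close> does not assume
  commutativity: \<open>g + h\<close> is the product \<open>gh\<close>, \<open>- g\<close> is the inverse, and \<open>0\<close> is the identity \<open>e\<close>.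
  With this convention \<open>'g \<Rightarrow>\<^sub>0 int\<close> and \<open>'g \<Rightarrow>\<^sub>0 complex\<close>, with the convolution product of
  \<^theory>\<open>HOL-Library.Poly_Mapping\<close>, are the integral and complex group rings of \<open>\<Gamma>\<close>.
\<close>

section \<open>Sofic approximations\<close>

definition sofic_approximation ::
    "(nat \<Rightarrow> nat) \<Rightarrow> (nat \<Rightarrow> 'g::group_add \<Rightarrow> nat \<Rightarrow> nat) \<Rightarrow> bool" where
  "sofic_approximation d \<sigma> \<longleftrightarrow>
    (\<forall>i. 0 < d i) \<and>
    (\<forall>i g. \<sigma> i g permutes {1..d i}) \<and>
    (\<forall>g h. (\<lambda>i. measure (uniform_count_measure {1..d i})
              {j \<in> {1..d i}. \<sigma> i (g + h) j = \<sigma> i g (\<sigma> i h j)}) \<longlonglongrightarrow> 1) \<and>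
    (\<forall>g. g \<noteq> 0 \<longrightarrow> (\<lambda>i. measure (uniform_count_measure {1..d i})
              {j \<in> {1..d i}. \<sigma> i g j \<noteq> j}) \<longlonglongrightarrow> 1)"


section \<open>The Hilbert space \<open>\<ell>\<^sup>2(\<Gamma>)\<close>\<close>

typedef 'a ell2 = "{\<xi> :: 'a \<Rightarrow> complex. (\<lambda>x. (cmod (\<xi> x))\<^sup>2) summable_on UNIV}"
  morphisms ell2_apply Abs_ell2
  by (rule exI[of _ "\<lambda>_. 0"]) simp

setup_lifting type_definition_ell2

lemma ell2_add_summable:
  fixes \<xi> \<eta> :: "'a \<Rightarrow> complex"
  assumes "(\<lambda>x. (cmod (\<xi> x))\<^sup>2) summable_on UNIV" "(\<lambda>x. (cmod (\<eta> x))\<^sup>2) summable_on UNIV"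
  shows "(\<lambda>x. (cmod (\<xi> x + \<eta> x))\<^sup>2) summable_on UNIV"
proof (rule summable_on_comparison_test)
  show "(\<lambda>x. 2 * (cmod (\<xi> x))\<^sup>2 + 2 * (cmod (\<eta> x))\<^sup>2) summable_on UNIV"
    using assms by (intro summable_on_add summable_on_cmult_right)
  show "(cmod (\<xi> x + \<eta> x))\<^sup>2 \<le> 2 * (cmod (\<xi> x))\<^sup>2 + 2 * (cmod (\<eta> x))\<^sup>2" for x
  proof -
    have "(cmod (\<xi> x + \<eta> x))\<^sup>2 \<le> (cmod (\<xi> x) + cmod (\<eta> x))\<^sup>2"
      by (intro power_mono norm_triangle_ineq) simp
    also have "\<dots> \<le> 2 * (cmod (\<xi> x))\<^sup>2 + 2 * (cmod (\<eta> x))\<^sup>2"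
      using sum_squares_bound[of "cmod (\<xi> x)" "cmod (\<eta> x)"] by (simp add: power2_sum)
    finally show ?thesis .
  qed
qed simp

lemma ell2_scale_summable:
  fixes \<xi> :: "'a \<Rightarrow> complex"
  assumes "(\<lambda>x. (cmod (\<xi> x))\<^sup>2) summable_on UNIV"
  shows "(\<lambda>x. (cmod (c * \<xi> x))\<^sup>2) summable_on UNIV"
  using summable_on_cmult_right[OF assms, of "(cmod c)\<^sup>2"]
  by (simp add: norm_mult power_mult_distrib)

lemma ell2_inner_summable:
  "(\<lambda>x. ell2_apply \<xi> x \<bullet> ell2_apply \<eta> x) summable_on UNIV"
proof -
  have "(\<lambda>x. norm (ell2_apply \<xi> x \<bullet> ell2_apply \<eta> x)) summable_on UNIV"
  proof (rule summable_on_comparison_test)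
    show "(\<lambda>x. (cmod (ell2_apply \<xi> x))\<^sup>2 + (cmod (ell2_apply \<eta> x))\<^sup>2) summable_on UNIV"
      using ell2_apply[of \<xi>] ell2_apply[of \<eta>] by (intro summable_on_add) auto
    show "norm (ell2_apply \<xi> x \<bullet> ell2_apply \<eta> x)
        \<le> (cmod (ell2_apply \<xi> x))\<^sup>2 + (cmod (ell2_apply \<eta> x))\<^sup>2" for x
    proof -
      have "norm (ell2_apply \<xi> x \<bullet> ell2_apply \<eta> x) \<le> cmod (ell2_apply \<xi> x) * cmod (ell2_apply \<eta> x)"
        using Cauchy_Schwarz_ineq2 by simp
      also have "\<dots> \<le> (cmod (ell2_apply \<xi> x))\<^sup>2 + (cmod (ell2_apply \<eta> x))\<^sup>2"
      proof -
        have "2 * (cmod (ell2_apply \<xi> x) * cmod (ell2_apply \<eta> x))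
            \<le> (cmod (ell2_apply \<xi> x))\<^sup>2 + (cmod (ell2_apply \<eta> x))\<^sup>2"
          using sum_squares_bound[of "cmod (ell2_apply \<xi> x)" "cmod (ell2_apply \<eta> x)"] by simp
        moreover have "0 \<le> cmod (ell2_apply \<xi> x) * cmod (ell2_apply \<eta> x)" by simp
        ultimately show ?thesis by linarith
      qed
      finally show ?thesis .
    qed
  qed simp
  then show ?thesis by (rule abs_summable_summable)
qed

instantiation ell2 :: (type) real_inner
begin

lift_definition zero_ell2 :: "'a ell2" is "\<lambda>_. 0" by simp

lift_definition plus_ell2 :: "'a ell2 \<Rightarrow> 'a ell2 \<Rightarrow> 'a ell2" is "\<lambda>\<xi> \<eta> x. \<xi> x + \<eta> x"
  by (rule ell2_add_summable)

lift_definition uminus_ell2 :: "'a ell2 \<Rightarrow> 'a ell2" is "\<lambda>\<xi> x. - \<xi> x" by simp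

lift_definition minus_ell2 :: "'a ell2 \<Rightarrow> 'a ell2 \<Rightarrow> 'a ell2" is "\<lambda>\<xi> \<eta> x. \<xi> x - \<eta> x"
  subgoal for \<xi> \<eta> using ell2_add_summable[of \<xi> "\<lambda>x. - \<eta> x"] by simp
  done

lift_definition scaleR_ell2 :: "real \<Rightarrow> 'a ell2 \<Rightarrow> 'a ell2" is "\<lambda>r \<xi> x. r *\<^sub>R \<xi> x"
  unfolding scaleR_conv_of_real by (rule ell2_scale_summable)

text \<open>The real part of the Hilbert space inner product; the complex one is \<open>ell2_cinner\<close> below.\<close>

definition inner_ell2 :: "'a ell2 \<Rightarrow> 'a ell2 \<Rightarrow> real" where
  "inner_ell2 \<xi> \<eta> = (\<Sum>\<^sub>\<infinity>x. ell2_apply \<xi> x \<bullet> ell2_apply \<eta> x)"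

definition norm_ell2 :: "'a ell2 \<Rightarrow> real" where
  "norm_ell2 \<xi> = sqrt (\<xi> \<bullet> \<xi>)"

definition sgn_ell2 :: "'a ell2 \<Rightarrow> 'a ell2" where
  "sgn_ell2 \<xi> = inverse (norm \<xi>) *\<^sub>R \<xi>"

definition dist_ell2 :: "'a ell2 \<Rightarrow> 'a ell2 \<Rightarrow> real" where
  "dist_ell2 \<xi> \<eta> = norm (\<xi> - \<eta>)"

definition uniformity_ell2 :: "('a ell2 \<times> 'a ell2) filter" where
  "uniformity_ell2 = (INF e\<in>{0<..}. principal {(\<xi>, \<eta>). dist \<xi> \<eta> < e})"

definition open_ell2 :: "'a ell2 set \<Rightarrow> bool" where
  "open_ell2 U \<longleftrightarrow> (\<forall>\<xi>\<in>U. \<forall>\<^sub>F (\<xi>', \<eta>) in uniformity. \<xi>' = \<xi> \<longrightarrow> \<eta> \<in> U)"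

instance
proof
  fix \<xi> \<eta> \<zeta> :: "'a ell2" and a b :: real
  show "\<xi> + \<eta> + \<zeta> = \<xi> + (\<eta> + \<zeta>)" by transfer (simp add: add.assoc)
  show "\<xi> + \<eta> = \<eta> + \<xi>" by transfer (simp add: add.commute)
  show "0 + \<xi> = \<xi>" by transfer simp
  show "- \<xi> + \<xi> = 0" by transfer simp
  show "\<xi> - \<eta> = \<xi> + - \<eta>" by transfer simp
  show "a *\<^sub>R (\<xi> + \<eta>) = a *\<^sub>R \<xi> + a *\<^sub>R \<eta>" by transfer (simp add: scaleR_add_right)
  show "(a + b) *\<^sub>R \<xi> = a *\<^sub>R \<xi> + b *\<^sub>R \<xi>" by transfer (simp add: scaleR_add_left)
  show "a *\<^sub>R b *\<^sub>R \<xi> = (a * b) *\<^sub>R \<xi>" by transfer simp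
  show "1 *\<^sub>R \<xi> = \<xi>" by transfer simp
  show "sgn \<xi> = inverse (norm \<xi>) *\<^sub>R \<xi>" by (rule sgn_ell2_def)
  show "dist \<xi> \<eta> = norm (\<xi> - \<eta>)" by (rule dist_ell2_def)
  show "(uniformity :: ('a ell2 \<times> 'a ell2) filter)
      = (INF e\<in>{0<..}. principal {(\<xi>, \<eta>). dist \<xi> \<eta> < e})" by (rule uniformity_ell2_def)
  show "open U \<longleftrightarrow> (\<forall>\<xi>\<in>U. \<forall>\<^sub>F (\<xi>', \<eta>) in uniformity. \<xi>' = \<xi> \<longrightarrow> \<eta> \<in> U)" for U :: "'a ell2 set"
    by (rule open_ell2_def)
  show "norm \<xi> = sqrt (\<xi> \<bullet> \<xi>)" by (rule norm_ell2_def)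
  show "\<xi> \<bullet> \<eta> = \<eta> \<bullet> \<xi>" by (simp add: inner_ell2_def inner_commute)
  show "(\<xi> + \<eta>) \<bullet> \<zeta> = \<xi> \<bullet> \<zeta> + \<eta> \<bullet> \<zeta>"
    unfolding inner_ell2_def plus_ell2.rep_eq inner_add_left
    by (intro infsum_add ell2_inner_summable)
  show "(a *\<^sub>R \<xi>) \<bullet> \<eta> = a * (\<xi> \<bullet> \<eta>)"
    unfolding inner_ell2_def scaleR_ell2.rep_eq inner_scaleR_left
    by (rule infsum_cmult_right) (rule ell2_inner_summable)
  show "0 \<le> \<xi> \<bullet> \<xi>" unfolding inner_ell2_def by (rule infsum_nonneg) simp
  show "\<xi> \<bullet> \<xi> = 0 \<longleftrightarrow> \<xi> = 0"
  proof
    assume "\<xi> \<bullet> \<xi> = 0"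
    then have "ell2_apply \<xi> x \<bullet> ell2_apply \<xi> x = 0" for x
      unfolding inner_ell2_def
      using nonneg_infsum_le_0D[OF _ ell2_inner_summable[of \<xi> \<xi>], of x] by simp
    then have "ell2_apply \<xi> x = 0" for x by simp
    then show "\<xi> = 0" by (simp add: ell2_apply_inject[symmetric] zero_ell2.rep_eq fun_eq_iff)
  next
    assume "\<xi> = 0"
    then show "\<xi> \<bullet> \<xi> = 0" by (simp add: inner_ell2_def zero_ell2.rep_eq)
  qed
qed

end

definition ell2_cinner :: "'a ell2 \<Rightarrow> 'a ell2 \<Rightarrow> complex" where
  "ell2_cinner \<xi> \<eta> = (\<Sum>\<^sub>\<infinity>x. ell2_apply \<xi> x * cnj (ell2_apply \<eta> x))"

lift_definition ell2_scaleC :: "complex \<Rightarrow> 'a ell2 \<Rightarrow> 'a ell2" is "\<lambda>c \<xi> x. c * \<xi> x"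
  by (rule ell2_scale_summable)

lemma norm_ell2_eq: "norm \<xi> = sqrt (\<Sum>\<^sub>\<infinity>x. (cmod (ell2_apply \<xi> x))\<^sup>2)"
  by (simp add: norm_ell2_def inner_ell2_def dot_square_norm)

lemma norm_ell2_scaleC: "norm (ell2_scaleC c \<xi>) = cmod c * norm \<xi>"
proof -
  have "(\<Sum>\<^sub>\<infinity>x. (cmod (ell2_apply (ell2_scaleC c \<xi>) x))\<^sup>2)
      = (\<Sum>\<^sub>\<infinity>x. (cmod c)\<^sup>2 * (cmod (ell2_apply \<xi> x))\<^sup>2)"
    by (simp add: ell2_scaleC.rep_eq norm_mult power_mult_distrib)
  also have "\<dots> = (cmod c)\<^sup>2 * (\<Sum>\<^sub>\<infinity>x. (cmod (ell2_apply \<xi> x))\<^sup>2)"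
    by (rule infsum_cmult_right') 
  finally show ?thesis by (simp add: norm_ell2_eq real_sqrt_mult)
qed


section \<open>The group von Neumann algebra\<close>

lemma ell2_translate_summable:
  fixes \<xi> :: "'g::group_add \<Rightarrow> complex"
  assumes "(\<lambda>x. (cmod (\<xi> x))\<^sup>2) summable_on UNIV"
  shows "(\<lambda>h. (cmod (\<xi> (- g + h)))\<^sup>2) summable_on UNIV"
proof -
  have "bij (\<lambda>h. - g + h)"
    by (rule bij_betw_byWitness[where f' = "\<lambda>h. g + h"]) (auto simp flip: add.assoc)
  from summable_on_reindex_bij_betw[OF this, of "\<lambda>x. (cmod (\<xi> x))\<^sup>2"] assms
  show ?thesis by simp
qed

text \<open>The unitary \<open>\<lambda>(g)\<close> of the left regular representation, \<open>(\<lambda>(g)\<xi>)(h) = \<xi>(g\<inverse>h)\<close>.\<close>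

lift_definition left_translate :: "'g::group_add \<Rightarrow> 'g ell2 \<Rightarrow> 'g ell2" is
  "\<lambda>g \<xi> h. \<xi> (- g + h)"
  by (rule ell2_translate_summable)

lemma norm_left_translate: "norm (left_translate g \<xi>) = norm \<xi>"
proof -
  have "bij (\<lambda>h. - g + h)"
    by (rule bij_betw_byWitness[where f' = "\<lambda>h. g + h"]) (auto simp flip: add.assoc)
  from infsum_reindex_bij_betw[OF this, of "\<lambda>x. (cmod (ell2_apply \<xi> x))\<^sup>2"]
  show ?thesis by (simp add: norm_ell2_eq left_translate.rep_eq)
qed

lift_definition group_ring_op :: "('g::group_add \<Rightarrow>\<^sub>0 complex) \<Rightarrow> 'g ell2 \<Rightarrow>\<^sub>L 'g ell2" is
  "\<lambda>\<alpha> \<xi>. \<Sum>g\<in>Poly_Mapping.keys \<alpha>. ell2_scaleC (Poly_Mapping.lookup \<alpha> g) (left_translate g \<xi>)"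
proof (rule bounded_linear_sum)
  fix \<alpha> :: "'g \<Rightarrow>\<^sub>0 complex" and g :: 'g
  show "bounded_linear (\<lambda>\<xi>. ell2_scaleC (Poly_Mapping.lookup \<alpha> g) (left_translate g \<xi>))"
  proof (rule bounded_linear_intro)
    show "norm (ell2_scaleC (Poly_Mapping.lookup \<alpha> g) (left_translate g \<xi>))
        \<le> norm \<xi> * cmod (Poly_Mapping.lookup \<alpha> g)" for \<xi>
      by (simp add: norm_ell2_scaleC norm_left_translate)
  qed (transfer; simp add: algebra_simps)+
qed

definition clinear_ops :: "('a ell2 \<Rightarrow>\<^sub>L 'a ell2) set" where
  "clinear_ops = {T. \<forall>c \<xi>. blinfun_apply T (ell2_scaleC c \<xi>) = ell2_scaleC c (blinfun_apply T \<xi>)}"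

text \<open>The type \<open>'a ell2 \<Rightarrow>\<^sub>L 'a ell2\<close> contains all bounded real-linear maps; \<open>clinear_ops\<close> is
  \<open>B(\<ell>\<^sup>2)\<close>. The weak operator topology on it is the initial topology for the functionals
  \<open>T \<mapsto> \<langle>T\<xi>, \<eta>\<rangle>\<close>.\<close>

definition weak_operator_topology :: "('a ell2 \<Rightarrow>\<^sub>L 'a ell2) topology" where
  "weak_operator_topology =
    pullback_topology clinear_ops
      (\<lambda>T (\<xi>, \<eta>). ell2_cinner (blinfun_apply T \<xi>) \<eta>)
      (product_topology (\<lambda>_. euclidean) UNIV)"

definition group_vN_algebra :: "('g::group_add ell2 \<Rightarrow>\<^sub>L 'g ell2) set" where
  "group_vN_algebra = weak_operator_topology closure_of (range group_ring_op)"

definition op_matrix_mult ::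
    "('a ell2 \<Rightarrow>\<^sub>L 'a ell2)^'n^'n \<Rightarrow> ('a ell2 \<Rightarrow>\<^sub>L 'a ell2)^'n^'n \<Rightarrow> ('a ell2 \<Rightarrow>\<^sub>L 'a ell2)^'n^'n" where
  "op_matrix_mult A B = (\<chi> i j. \<Sum>k\<in>UNIV. A $ i $ k o\<^sub>L B $ k $ j)"

definition op_matrix_one :: "('a ell2 \<Rightarrow>\<^sub>L 'a ell2)^'n^'n" where
  "op_matrix_one = (\<chi> i j. if i = j then id_blinfun else 0)"

definition vN_matrices :: "(('g::group_add ell2 \<Rightarrow>\<^sub>L 'g ell2)^'n^'n) set" where
  "vN_matrices = {A. \<forall>i j. A $ i $ j \<in> group_vN_algebra}"

definition vN_GL :: "(('g::group_add ell2 \<Rightarrow>\<^sub>L 'g ell2)^'n^'n) set" where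
  "vN_GL = {A \<in> vN_matrices. \<exists>B\<in>vN_matrices.
     op_matrix_mult A B = op_matrix_one \<and> op_matrix_mult B A = op_matrix_one}"

text \<open>The identification of \<open>M\<^sub>n(\<int>(\<Gamma>)) \<subseteq> M\<^sub>n(\<complex>(\<Gamma>))\<close> with matrices of operators.\<close>

definition op_matrix_of :: "('g::group_add \<Rightarrow>\<^sub>0 int)^'n^'n \<Rightarrow> ('g ell2 \<Rightarrow>\<^sub>L 'g ell2)^'n^'n" where
  "op_matrix_of f = (\<chi> i j. group_ring_op (Poly_Mapping.map of_int (f $ i $ j)))"


section \<open>The algebraic action on \<open>X\<^sub>f\<close>\<close>

text \<open>The circle group \<open>\<real>/\<int>\<close> with the quotient topology.\<close>

definition int_cong :: "real \<Rightarrow> real \<Rightarrow> bool" where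
  "int_cong x y \<longleftrightarrow> x - y \<in> \<int>"

quotient_type circle = real / int_cong
proof (rule equivpI)
  show "reflp int_cong" by (simp add: reflp_def int_cong_def)
  show "symp int_cong"
    unfolding symp_def int_cong_def by (metis Ints_minus minus_diff_eq)
  show "transp int_cong"
  proof (rule transpI)
    fix x y z assume "int_cong x y" "int_cong y z"
    then have "(x - y) + (y - z) \<in> \<int>" unfolding int_cong_def by (rule Ints_add)
    then show "int_cong x z" by (simp add: int_cong_def)
  qed
qed

instantiation circle :: ab_group_add
begin

lift_definition zero_circle :: circle is 0 .

lift_definition plus_circle :: "circle \<Rightarrow> circle \<Rightarrow> circle" is "(+)"
  unfolding int_cong_def by (metis Ints_add add_diff_add)

lift_definition uminus_circle :: "circle \<Rightarrow> circle" is uminus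
  unfolding int_cong_def by (metis Ints_minus minus_diff_minus)

lift_definition minus_circle :: "circle \<Rightarrow> circle \<Rightarrow> circle" is "(-)"
  unfolding int_cong_def by (metis Ints_diff diff_diff_eq2 diff_add_eq add_diff_eq diff_diff_eq add.commute)

instance
  by standard (transfer; simp add: int_cong_def)+

end

instantiation circle :: topological_space
begin

definition open_circle :: "circle set \<Rightarrow> bool" where
  "open_circle U \<longleftrightarrow> open (abs_circle -` U)"

instance
  by standard (auto simp: open_circle_def vimage_Union)

end

definition additive_group :: "'a::ab_group_add monoid" where
  "additive_group = \<lparr>carrier = UNIV, mult = (+), one = 0\<rparr>"

text \<open>The Pontryagin dual of a discrete abelian group \<open>A\<close>. Its points are the characters of \<open>A\<close>
  extended by \<open>undefined\<close> outside the carrier.\<close>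

definition pontryagin_dual :: "'a monoid \<Rightarrow> ('a \<Rightarrow> circle) topology" where
  "pontryagin_dual A =
    subtopology (product_topology (\<lambda>_. euclidean) (carrier A))
      {\<theta> \<in> hom A additive_group.
         \<theta> \<in> extensional (carrier A) \<and> continuous_map (discrete_topology (carrier A)) euclidean \<theta>}"

text \<open>The library's \<open>v*\<close> multiplies entries in the opposite order, which matters here since the
  group ring need not be commutative.\<close>

definition right_mult :: "('a::semiring_0)^'n^'n \<Rightarrow> 'a^'n \<Rightarrow> 'a^'n" where
  "right_mult f \<xi> = (\<chi> m. \<Sum>l\<in>UNIV. \<xi> $ l * f $ l $ m)"

definition module_quotient ::
    "('g::group_add \<Rightarrow>\<^sub>0 int)^'n^'n \<Rightarrow> (('g \<Rightarrow>\<^sub>0 int)^'n) set monoid" where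
  "module_quotient f = additive_group Mod range (right_mult f)"

definition X_space ::
    "('g::group_add \<Rightarrow>\<^sub>0 int)^'n^'n \<Rightarrow> ((('g \<Rightarrow>\<^sub>0 int)^'n) set \<Rightarrow> circle) topology" where
  "X_space f = pontryagin_dual (module_quotient f)"

definition left_mult :: "'g::group_add \<Rightarrow> ('g \<Rightarrow>\<^sub>0 int)^'n \<Rightarrow> ('g \<Rightarrow>\<^sub>0 int)^'n" where
  "left_mult g v = (\<chi> l. Poly_Mapping.single g 1 * v $ l)"

text \<open>Elements \<open>a\<close> of the quotient are cosets, and \<open>g\<close> acts on them by \<open>ga = {gv | v \<in> a}\<close>.\<close>

definition X_action ::
    "('g::group_add \<Rightarrow>\<^sub>0 int)^'n^'n \<Rightarrow> 'g \<Rightarrow>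
      ((('g \<Rightarrow>\<^sub>0 int)^'n) set \<Rightarrow> circle) \<Rightarrow> (('g \<Rightarrow>\<^sub>0 int)^'n) set \<Rightarrow> circle" where
  "X_action f g \<theta> = (\<lambda>a\<in>carrier (module_quotient f). \<theta> (left_mult (- g) ` a))"


section \<open>Independence tuples\<close>

definition continuous_pseudometric :: "'x topology \<Rightarrow> ('x \<Rightarrow> 'x \<Rightarrow> real) \<Rightarrow> bool" where
  "continuous_pseudometric X \<rho> \<longleftrightarrow>
    (\<forall>x\<in>topspace X. \<forall>y\<in>topspace X. 0 \<le> \<rho> x y) \<and>
    (\<forall>x\<in>topspace X. \<rho> x x = 0) \<and>
    (\<forall>x\<in>topspace X. \<forall>y\<in>topspace X. \<rho> x y = \<rho> y x) \<and>
    (\<forall>x\<in>topspace X. \<forall>y\<in>topspace X. \<forall>z\<in>topspace X. \<rho> x z \<le> \<rho> x y + \<rho> y z) \<and>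
    continuous_map (prod_topology X X) euclideanreal (\<lambda>(x, y). \<rho> x y)"

definition dynamically_generating ::
    "'x topology \<Rightarrow> ('g \<Rightarrow> 'x \<Rightarrow> 'x) \<Rightarrow> ('x \<Rightarrow> 'x \<Rightarrow> real) \<Rightarrow> bool" where
  "dynamically_generating X act \<rho> \<longleftrightarrow>
    (\<forall>x\<in>topspace X. \<forall>y\<in>topspace X. x \<noteq> y \<longrightarrow> (\<exists>g. 0 < \<rho> (act g x) (act g y)))"

definition rho2 :: "('x \<Rightarrow> 'x \<Rightarrow> real) \<Rightarrow> nat \<Rightarrow> (nat \<Rightarrow> 'x) \<Rightarrow> (nat \<Rightarrow> 'x) \<Rightarrow> real" where
  "rho2 \<rho> d \<phi> \<psi> = sqrt (1 / real d * (\<Sum>j=1..d. (\<rho> (\<phi> j) (\<psi> j))\<^sup>2))"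

text \<open>In the following, \<open>s :: 'g \<Rightarrow> nat \<Rightarrow> nat\<close> is a single map \<open>\<sigma>\<^sub>i : \<Gamma> \<rightarrow> S\<^sub>d\<close> and \<open>d = d\<^sub>i\<close>.\<close>

definition Map_set ::
    "'x topology \<Rightarrow> ('g \<Rightarrow> 'x \<Rightarrow> 'x) \<Rightarrow> ('x \<Rightarrow> 'x \<Rightarrow> real) \<Rightarrow> 'g set \<Rightarrow> real \<Rightarrow>
      nat \<Rightarrow> ('g \<Rightarrow> nat \<Rightarrow> nat) \<Rightarrow> (nat \<Rightarrow> 'x) set" where
  "Map_set X act \<rho> F \<delta> d s =
    {\<phi> \<in> {1..d} \<rightarrow>\<^sub>E topspace X. \<forall>g\<in>F. rho2 \<rho> d (\<phi> \<circ> s g) (\<lambda>j. act g (\<phi> j)) < \<delta>}"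

definition independence_set ::
    "'x topology \<Rightarrow> ('g \<Rightarrow> 'x \<Rightarrow> 'x) \<Rightarrow> ('x \<Rightarrow> 'x \<Rightarrow> real) \<Rightarrow> 'g set \<Rightarrow> real \<Rightarrow>
      nat \<Rightarrow> ('g \<Rightarrow> nat \<Rightarrow> nat) \<Rightarrow> nat \<Rightarrow> (nat \<Rightarrow> 'x set) \<Rightarrow> nat set \<Rightarrow> bool" where
  "independence_set X act \<rho> F \<delta> d s k U J \<longleftrightarrow>
    J \<subseteq> {1..d} \<and>
    (\<forall>c \<in> J \<rightarrow> {1..k}. \<exists>\<phi> \<in> Map_set X act \<rho> F \<delta> d s. \<forall>j\<in>J. \<phi> j \<in> U (c j))"

definition IE_tuple ::
    "'x topology \<Rightarrow> ('g \<Rightarrow> 'x \<Rightarrow> 'x) \<Rightarrow> ('x \<Rightarrow> 'x \<Rightarrow> real) \<Rightarrow>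
      (nat \<Rightarrow> nat) \<Rightarrow> (nat \<Rightarrow> 'g \<Rightarrow> nat \<Rightarrow> nat) \<Rightarrow> nat \<Rightarrow> (nat \<Rightarrow> 'x) \<Rightarrow> bool" where
  "IE_tuple X act \<rho> d \<sigma> k x \<longleftrightarrow>
    (\<forall>l\<in>{1..k}. x l \<in> topspace X) \<and>
    (\<forall>U. (\<forall>l\<in>{1..k}. U l \<subseteq> topspace X \<and> (\<exists>V. openin X V \<and> x l \<in> V \<and> V \<subseteq> U l)) \<longrightarrow>
      (\<exists>r>0. \<forall>F \<delta>. finite F \<and> \<delta> > 0 \<longrightarrow>
        (\<exists>\<^sub>\<infinity>i. \<exists>J. independence_set X act \<rho> F \<delta> (d i) (\<sigma> i) k U J \<and>
                 real (card J) \<ge> r * real (d i))))"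

end

theory Submission
  imports Defs
begin

text \<open>
  Since \<open>f\<close> is invertible over \<open>L(\<Gamma>)\<close>, every \<open>w \<in> \<int>(\<Gamma>)\<^sup>n\<close> gives a square summable real vector
  \<open>\<Xi> w = f\<inverse> w\<close> whose reduction modulo \<open>\<int>\<close> is a point of \<open>X\<^sub>f\<close>, and these homoclinic points are dense
  in \<open>X\<^sub>f\<close>. Approximate the given points \<open>x\<^sub>l\<close> by \<open>\<Xi> (w l)\<close> and add one further vector
  \<open>w 0 = - \<Sum>l. w l\<close>, so that the sum over all indices vanishes. In a sofic model choose a set \<open>J\<close> of
  positive density whose points have disjoint neighbourhoods of a large fixed shape. For
  \<open>c : J \<rightarrow> {0..k}\<close>, superposing at each \<open>j \<in> J\<close> a copy of a finite truncation of \<open>\<Xi> (w (c j))\<close> gives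
  a vector which \<open>f\<close> maps to an integral vector up to an error. For a random \<open>c\<close> the error terms are
  independent and centred, so they are small in mean square by a computation near each
  single \<open>j\<close>; no bound on the norm of \<open>\<sigma>\<^sub>i(f)\<inverse>\<close> is needed. The same computation shows that the
  copies disturb each other little. Hence for most \<open>c\<close> the vector is close to a microstate with the
  prescribed behaviour at all \<open>j \<in> J\<close> outside a small exceptional set \<open>B c\<close>. Pigeonholing over the
  possible sets \<open>B c\<close> and applying a Sauer-Shelah bound to the remaining \<open>c\<close> produces a subset of
  \<open>J\<close> of positive density on which all prescriptions are realised.
\<close>

section \<open>Shattering\<close>

text \<open>Since \<open>f\<close> is invertible only over L(\<Gamma>), the vectors
  \<open>\<Xi> w\<close> are square summable but need not be summable. Copies of them superposed
  with positive density therefore admit no pointwise control for a fixed \<open>c\<close>; only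
  averages over \<open>c\<close> can be estimated. The order of the quantifiers shapes the rest: the
  density r has to be fixed before F and \<delta>. So there are two windows. The window
  \<open>L\<close> depends only on the given neighbourhoods; it determines how far the points of
  \<open>J\<close> are separated, and hence r. The window \<open>T\<close>, on which copies are
  truncated, is chosen after F and \<delta> and is so large that \<open>f\<close> maps a truncated
  copy close to an integral vector. Copies on \<open>T\<close> overlap freely, and their
  interference outside \<open>L\<close> is what the second moments bound. The extra symbol 0 centres
  the copies and costs nothing, as prescriptions with k symbols are among those with k + 1.
  Exceptional sets are harmless because sets of size at most \<beta> card J are fewer than the
  exponential gain of the Sauer-Shelah bound when \<beta> is small in terms of the number of symbols
  alone.\<close>

definition shatters :: "('a \<Rightarrow> 's) set \<Rightarrow> 's set \<Rightarrow> 'a set \<Rightarrow> bool" where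
  "shatters \<G> S J \<longleftrightarrow> (\<forall>c \<in> J \<rightarrow> S. \<exists>c'\<in>\<G>. \<forall>j\<in>J. c' j = c j)"

text \<open>For two symbols all weights are 1 and this is Pajor's inequality. A map \<open>u\<close>
  on the old coordinates has at most \<open>card S - 1\<close> extensions in \<open>\<G>\<close>
  unless the new coordinate is completely free. So \<open>\<G>\<close> is counted by
  \<open>card S - 1\<close> copies of the restrictions \<open>P\<close> and one copy of the free
  ones \<open>Q\<close>: sets shattered by \<open>P\<close> avoid the new coordinate, and sets
  shattered by \<open>Q\<close> stay shattered when it is added.\<close>

lemma sauer_shelah_pajor:
  assumes "finite J" "finite S" "S \<noteq> {}" "\<G> \<subseteq> (J \<rightarrow>\<^sub>E S)"
  shows "card \<G> \<le> (\<Sum>J'\<in>{J'. J' \<subseteq> J \<and> shatters \<G> S J'}. (card S - 1) ^ (card J - card J'))"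
  using assms(1,4)
proof (induction J arbitrary: \<G> rule: finite_induct)
  case empty
  show ?case
  proof (cases "\<G> = {}")
    case False
    then have "shatters \<G> S {}" by (auto simp: shatters_def)
    then have "{J'. J' \<subseteq> {} \<and> shatters \<G> S J'} = {{}}" by auto
    moreover have "card \<G> \<le> 1" using empty card_mono[of "{\<lambda>x. undefined}" \<G>] by auto
    ultimately show ?thesis by simp
  qed simp
next
  case (insert i J)
  define m where "m = card S - 1"
  define N where "N u = {s\<in>S. u(i := s) \<in> \<G>}" for u :: "'a \<Rightarrow> 'b"
  define P where "P = {u \<in> J \<rightarrow>\<^sub>E S. N u \<noteq> {}}"
  define Q where "Q = {u \<in> J \<rightarrow>\<^sub>E S. N u = S}"
  have fin: "finite (J \<rightarrow>\<^sub>E S)" using insert assms by (intro finite_PiE) auto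
  have fP: "finite P" "finite Q" using fin by (auto simp: P_def Q_def)
  have QP: "Q \<subseteq> P" using assms by (auto simp: P_def Q_def)
  have "\<G> \<subseteq> (\<lambda>(u,s). u(i:=s)) ` (SIGMA u:P. N u)"
  proof
    fix c assume c: "c \<in> \<G>"
    then have cE: "c \<in> insert i J \<rightarrow>\<^sub>E S" using insert by auto
    then obtain s u where su: "c = u(i := s)" "s \<in> S" "u \<in> J \<rightarrow>\<^sub>E S"
      by (auto simp: PiE_insert_eq)
    then have "s \<in> N u" "u \<in> P" using c by (auto simp: N_def P_def)
    then show "c \<in> (\<lambda>(u,s). u(i:=s)) ` (SIGMA u:P. N u)" using su by force
  qed
  moreover have fN: "finite (N u)" "card (N u) \<le> card S" for u
    using assms(2) by (auto simp: N_def intro!: card_mono)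
  ultimately have "card \<G> \<le> card (SIGMA u:P. N u)"
    using fP by (intro surj_card_le) auto
  also have "\<dots> = (\<Sum>u\<in>P. card (N u))" using fP fN by simp
  also have "\<dots> \<le> (\<Sum>u\<in>P. m + (if u \<in> Q then 1 else 0))"
  proof (rule sum_mono)
    fix u assume u: "u \<in> P"
    show "card (N u) \<le> m + (if u \<in> Q then 1 else 0)"
    proof (cases "u \<in> Q")
      case False
      then have "N u \<subset> S" using u by (auto simp: Q_def P_def N_def)
      then have "card (N u) < card S" using assms(2) by (rule psubset_card_mono[rotated])
      then show ?thesis using False by (auto simp: m_def)
    next
      case True then show ?thesis using fN(2)[of u] by (simp add: m_def)
    qed
  qed
  also have "\<dots> = m * card P + card Q"
    using fP QP by (simp add: sum.distrib sum.If_cases Int_absorb1)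
  also have "\<dots> \<le> m * (\<Sum>J'\<in>{J'. J' \<subseteq> J \<and> shatters P S J'}. m ^ (card J - card J'))
       + (\<Sum>J'\<in>{J'. J' \<subseteq> J \<and> shatters Q S J'}. m ^ (card J - card J'))"
    unfolding m_def by (intro add_mono mult_left_mono insert.IH) (auto simp: P_def Q_def)
  also have "m * (\<Sum>J'\<in>{J'. J' \<subseteq> J \<and> shatters P S J'}. m ^ (card J - card J'))
      = (\<Sum>J'\<in>{J'. J' \<subseteq> J \<and> shatters P S J'}. m ^ (card (insert i J) - card J'))"
    unfolding sum_distrib_left
  proof (rule sum.cong)
    fix J' assume "J' \<in> {J'. J' \<subseteq> J \<and> shatters P S J'}"
    then have "card J' \<le> card J" using insert(1) by (auto intro: card_mono)
    then show "m * m ^ (card J - card J') = m ^ (card (insert i J) - card J')"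
      using insert(1,2) by (simp add: Suc_diff_le)
  qed simp
  also have "\<dots> \<le> (\<Sum>J'\<in>{J'. J' \<subseteq> J \<and> shatters \<G> S J'}. m ^ (card (insert i J) - card J'))"
  proof (rule sum_mono2)
    show "{J'. J' \<subseteq> J \<and> shatters P S J'} \<subseteq> {J'. J' \<subseteq> J \<and> shatters \<G> S J'}"
    proof clarsimp
      fix J' assume J': "J' \<subseteq> J" "shatters P S J'"
      show "shatters \<G> S J'" unfolding shatters_def
      proof
        fix c assume "c \<in> J' \<rightarrow> S"
        then obtain u where u: "u \<in> P" "\<forall>j\<in>J'. u j = c j" using J' unfolding shatters_def by blast
        then obtain s where "u(i := s) \<in> \<G>" by (auto simp: P_def N_def)
        then show "\<exists>c'\<in>\<G>. \<forall>j\<in>J'. c' j = c j" using u J' insert(2)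
          by (intro bexI[of _ "u(i := s)"]) auto
      qed
    qed
  qed (use insert(1) in auto)
  \<comment> \<open>Adding \<open>i\<close> to both \<open>J\<close> and \<open>J'\<close> leaves
    the exponent unchanged.\<close>
  also have "(\<Sum>J'\<in>{J'. J' \<subseteq> J \<and> shatters Q S J'}. m ^ (card J - card J'))
     = (\<Sum>J'\<in>insert i ` {J'. J' \<subseteq> J \<and> shatters Q S J'}. m ^ (card (insert i J) - card J'))"
  proof (subst sum.reindex)
    show "inj_on (insert i) {J'. J' \<subseteq> J \<and> shatters Q S J'}" using insert(2) by (auto simp: inj_on_def)
    show "(\<Sum>J'\<in>{J'. J' \<subseteq> J \<and> shatters Q S J'}. m ^ (card J - card J'))
     = sum ((\<lambda>J'. m ^ (card (insert i J) - card J')) \<circ> insert i) {J'. J' \<subseteq> J \<and> shatters Q S J'}"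
    proof (rule sum.cong)
      fix J' assume J': "J' \<in> {J'. J' \<subseteq> J \<and> shatters Q S J'}"
      then have "finite J'" "i \<notin> J'" using insert(1,2) finite_subset by auto
      then show "m ^ (card J - card J') = ((\<lambda>J'. m ^ (card (insert i J) - card J')) \<circ> insert i) J'"
        using insert(1,2) by simp
    qed simp
  qed
  also have "\<dots> \<le> (\<Sum>J'\<in>{J'. i \<in> J' \<and> J' \<subseteq> insert i J \<and> shatters \<G> S J'}. m ^ (card (insert i J) - card J'))"
  proof (rule sum_mono2)
    show "insert i ` {J'. J' \<subseteq> J \<and> shatters Q S J'} \<subseteq> {J'. i \<in> J' \<and> J' \<subseteq> insert i J \<and> shatters \<G> S J'}"
    proof clarsimp
      fix J' assume J': "J' \<subseteq> J" "shatters Q S J'"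
      have "shatters \<G> S (insert i J')" unfolding shatters_def
      proof
        fix c assume c: "c \<in> insert i J' \<rightarrow> S"
        then have "c \<in> J' \<rightarrow> S" by auto
        then obtain u where u: "u \<in> Q" "\<forall>j\<in>J'. u j = c j" using J' unfolding shatters_def by blast
        have "c i \<in> S" using c by auto
        then have "u(i := c i) \<in> \<G>" using u by (auto simp: Q_def N_def)
        then show "\<exists>c'\<in>\<G>. \<forall>j\<in>insert i J'. c' j = c j" using u J' insert(2)
          by (intro bexI[of _ "u(i := c i)"]) auto
      qed
      then show "J' \<subseteq> insert i J \<and> shatters \<G> S (insert i J')" using J' by auto
    qed
  qed (use insert(1) in auto)
  also have "(\<Sum>J'\<in>{J'. J' \<subseteq> J \<and> shatters \<G> S J'}. m ^ (card (insert i J) - card J')) + \<dots>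
     = (\<Sum>J'\<in>{J'. J' \<subseteq> J \<and> shatters \<G> S J'} \<union> {J'. i \<in> J' \<and> J' \<subseteq> insert i J \<and> shatters \<G> S J'}.
          m ^ (card (insert i J) - card J'))"
    using insert(1,2) by (intro sum.union_disjoint[symmetric]) auto
  also have "{J'. J' \<subseteq> J \<and> shatters \<G> S J'} \<union> {J'. i \<in> J' \<and> J' \<subseteq> insert i J \<and> shatters \<G> S J'}
     = {J'. J' \<subseteq> insert i J \<and> shatters \<G> S J'}"
    using insert(2) by auto
  finally show ?case by (simp add: m_def)
qed

lemma sum_Pow_weight:
  fixes x y :: real
  assumes "finite J"
  shows "(\<Sum>J'\<in>Pow J. x ^ card J' * y ^ (card J - card J')) = (x + y) ^ card J"
  using assms
proof (induction J rule: finite_induct)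
  case (insert i J)
  have "(\<Sum>J'\<in>Pow (insert i J). x ^ card J' * y ^ (card (insert i J) - card J'))
    = (\<Sum>J'\<in>Pow J. x ^ card J' * y ^ (card (insert i J) - card J'))
    + (\<Sum>J'\<in>insert i ` Pow J. x ^ card J' * y ^ (card (insert i J) - card J'))"
    unfolding Pow_insert using insert by (intro sum.union_disjoint) auto
  also have "(\<Sum>J'\<in>insert i ` Pow J. x ^ card J' * y ^ (card (insert i J) - card J'))
    = (\<Sum>J'\<in>Pow J. x * (x ^ card J' * y ^ (card J - card J')))"
  proof (subst sum.reindex)
    show "inj_on (insert i) (Pow J)" using insert(2) by (auto simp: inj_on_def)
    show "sum ((\<lambda>J'. x ^ card J' * y ^ (card (insert i J) - card J')) \<circ> insert i) (Pow J)
      = (\<Sum>J'\<in>Pow J. x * (x ^ card J' * y ^ (card J - card J')))"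
    proof (rule sum.cong)
      fix J' assume J': "J' \<in> Pow J"
      then have "finite J'" "i \<notin> J'" using insert(1,2) finite_subset by auto
      then show "((\<lambda>J'. x ^ card J' * y ^ (card (insert i J) - card J')) \<circ> insert i) J'
        = x * (x ^ card J' * y ^ (card J - card J'))"
        using insert(1,2) by simp
    qed simp
  qed
  also have "(\<Sum>J'\<in>Pow J. x ^ card J' * y ^ (card (insert i J) - card J'))
    = (\<Sum>J'\<in>Pow J. y * (x ^ card J' * y ^ (card J - card J')))"
  proof (rule sum.cong)
    fix J' assume "J' \<in> Pow J"
    then have "card J' \<le> card J" using insert(1) by (auto intro: card_mono)
    then show "x ^ card J' * y ^ (card (insert i J) - card J') = y * (x ^ card J' * y ^ (card J - card J'))"
      using insert(1,2) by (simp add: Suc_diff_le)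
  qed simp
  finally show ?case using insert by (simp flip: sum_distrib_left add: algebra_simps)
qed simp

text \<open>Every shattered set is counted with the weight
  \<open>2 powr b * (1/2) ^ card J'\<close>, which is at least 1 by \<open>small\<close>. The
  binomial sum then has base \<open>1/2 + (card S - 1)\<close>; that this lies strictly below
  \<open>card S\<close> is the exponential gain.\<close>

lemma card_shattering_free_le:
  fixes b :: real
  assumes "finite J" "finite S" "S \<noteq> {}" "\<G> \<subseteq> (J \<rightarrow>\<^sub>E S)"
    and small: "\<And>J'. J' \<subseteq> J \<Longrightarrow> shatters \<G> S J' \<Longrightarrow> real (card J') \<le> b"
  shows "real (card \<G>) \<le> 2 powr b * (real (card S) - 1/2) ^ card J"
proof -
  have k: "real (card S - 1) = real (card S) - 1" "card S \<ge> 1"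
    using assms(2,3) by (auto simp: Suc_le_eq card_gt_0_iff of_nat_diff)
  have "real (card \<G>) \<le> (\<Sum>J'\<in>{J'. J' \<subseteq> J \<and> shatters \<G> S J'}. real (card S - 1) ^ (card J - card J'))"
    using of_nat_mono[OF sauer_shelah_pajor[OF assms(1-4)], where 'a=real] by simp
  also have "\<dots> \<le> (\<Sum>J'\<in>{J'. J' \<subseteq> J \<and> shatters \<G> S J'}.
      2 powr b * ((1/2) ^ card J' * real (card S - 1) ^ (card J - card J')))"
  proof (rule sum_mono)
    fix J' assume J': "J' \<in> {J'. J' \<subseteq> J \<and> shatters \<G> S J'}"
    then have "2 powr real (card J') \<le> 2 powr b" using small by (intro powr_mono) auto
    then have "1 \<le> 2 powr b * (1/2) ^ card J'"
      by (simp add: powr_realpow field_simps)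
    then have "1 * real (card S - 1) ^ (card J - card J') \<le> 2 powr b * (1/2) ^ card J' * real (card S - 1) ^ (card J - card J')"
      by (rule mult_right_mono) simp
    then show "real (card S - 1) ^ (card J - card J') \<le> 2 powr b * ((1/2) ^ card J' * real (card S - 1) ^ (card J - card J'))"
      by (simp add: mult.assoc)
  qed
  also have "\<dots> \<le> (\<Sum>J'\<in>Pow J. 2 powr b * ((1/2) ^ card J' * real (card S - 1) ^ (card J - card J')))"
    using assms(1) by (intro sum_mono2) auto
  also have "\<dots> = 2 powr b * (1/2 + real (card S - 1)) ^ card J"
    using sum_Pow_weight[OF assms(1), of "1/2" "real (card S - 1)"] by (simp flip: sum_distrib_left)
  finally show ?thesis using k by (simp add: algebra_simps)
qed

text \<open>The same exponential weighting with a free parameter: \<open>1 + t\<close> has to be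
  close enough to 1 not to consume the gain from \<open>card_shattering_free_le\<close>.\<close>

lemma card_small_subsets_le:
  fixes b t :: real
  assumes "finite J" "0 < t" "t \<le> 1"
  shows "real (card {B. B \<subseteq> J \<and> real (card B) \<le> b}) \<le> t powr (- b) * (1 + t) ^ card J"
proof -
  have "real (card {B. B \<subseteq> J \<and> real (card B) \<le> b}) = (\<Sum>B\<in>{B. B \<subseteq> J \<and> real (card B) \<le> b}. 1)" by simp
  also have "\<dots> \<le> (\<Sum>B\<in>{B. B \<subseteq> J \<and> real (card B) \<le> b}. t powr (- b) * (t ^ card B * 1 ^ (card J - card B)))"
  proof (rule sum_mono)
    fix B assume "B \<in> {B. B \<subseteq> J \<and> real (card B) \<le> b}"
    then have "t powr b \<le> t powr real (card B)" using assms by (intro powr_mono') auto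
    then show "1 \<le> t powr (- b) * (t ^ card B * 1 ^ (card J - card B))"
      using assms(2) by (simp add: powr_realpow powr_minus field_simps)
  qed
  also have "\<dots> \<le> (\<Sum>B\<in>Pow J. t powr (- b) * (t ^ card B * 1 ^ (card J - card B)))"
    using assms by (intro sum_mono2) auto
  also have "\<dots> = t powr (- b) * (t + 1) ^ card J"
    using sum_Pow_weight[OF assms(1), of t 1] by (simp flip: sum_distrib_left)
  finally show ?thesis by (simp add: add.commute)
qed

text \<open>As \<open>B c\<close> varies with \<open>c\<close>, a set shattered by
  \<open>\<G>\<close> could meet the exceptional set of every map that realises a prescription.
  Hence \<open>\<G>\<close> is split by the value of \<open>B\<close>. Some class, on which
  \<open>B c = C\<close> is constant, shatters more than \<open>2 * \<beta> * card J\<close> points,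
  and deleting \<open>C\<close> still leaves \<open>\<beta> * card J\<close> of them.\<close>

lemma shattering_off_exceptional_sets:
  fixes S :: "'s set"
  assumes S: "finite S" "S \<noteq> {}"
  obtains \<beta> q :: real where "0 < \<beta>" "0 < q" "q < 1"
    "\<And>(J :: 'a set) \<G> B. finite J \<Longrightarrow> J \<noteq> {} \<Longrightarrow> \<G> \<subseteq> (J \<rightarrow>\<^sub>E S) \<Longrightarrow>
       (\<And>c. c \<in> \<G> \<Longrightarrow> B c \<subseteq> J \<and> real (card (B c)) \<le> \<beta> * real (card J)) \<Longrightarrow>
       q * real (card S) ^ card J < real (card \<G>) \<Longrightarrow>
       \<exists>J'\<subseteq>J. \<beta> * real (card J) \<le> real (card J') \<and>
         (\<forall>c \<in> J' \<rightarrow> S. \<exists>c'\<in>\<G>. (\<forall>j\<in>J'. c' j = c j) \<and> B c' \<inter> J' = {})"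
proof -
  define k where "k = real (card S)"
  have k: "k \<ge> 1" using S by (simp add: k_def Suc_le_eq card_gt_0_iff)
  \<comment> \<open>With this \<open>t\<close>, \<open>p = 1 - 1/(4*k) - 1/(8*k*k)\<close>. It is
    the product of the base for small subsets and the base for shattering-free families, relative to
    \<open>k\<close>.\<close>
  define t where "t = 1 / (4 * k)"
  define p where "p = (1 + t) * (1 - 1 / (2 * k))"
  have t: "0 < t" "t \<le> 1" using k by (auto simp: t_def)
  have p: "0 < p" "p < 1"
  proof -
    have "1 - 1 / (2*k) > 0" using k by simp
    then show "0 < p" using t by (simp add: p_def)
    have "p = 1 - 1/(4*k) - 1/(8*k*k)" using k by (simp add: p_def t_def field_simps)
    moreover have "1/(4*k) > 0" "1/(8*k*k) > 0" using k by auto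
    ultimately show "p < 1" by linarith
  qed
  \<comment> \<open>Solves \<open>(16 * k) powr \<beta> = p powr (- 1/2)\<close>: the factor
    \<open>2 powr (2 * \<beta>) * t powr (- \<beta>)\<close> consumes half of the exponential gain,
    and \<open>q = sqrt p\<close> per point remains.\<close>
  define \<beta> where "\<beta> = - ln p / 2 / ln (16 * k)"
  define q where "q = sqrt p"
  have ln16: "ln (16 * k) > 0" using k by (intro ln_gt_zero) auto
  have \<beta>: "0 < \<beta>" using p ln16 by (simp add: \<beta>_def divide_neg_pos)
  have q: "0 < q" "q < 1" using p by (auto simp: q_def)
  have key: "2 powr (2 * \<beta>) * t powr (- \<beta>) * p = q"
  proof -
    have "2 powr (2 * \<beta>) * t powr (- \<beta>) = (16 * k) powr \<beta>"
    proof -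
      have "2 powr (2 * \<beta>) = (2 powr 2) powr \<beta>" by (simp only: powr_powr)
      also have "\<dots> = 4 powr \<beta>" by simp
      finally have 1: "2 powr (2 * \<beta>) = 4 powr \<beta>" .
      have 2: "t powr (- \<beta>) = (4 * k) powr \<beta>"
        using k by (simp add: t_def powr_minus powr_divide)
      show ?thesis unfolding 1 2 using k by (simp flip: powr_mult)
    qed
    also have "\<dots> = exp (\<beta> * ln (16 * k))" using k by (simp add: powr_def)
    also have "\<beta> * ln (16 * k) = - ln p / 2" using ln16 by (simp add: \<beta>_def)
    also have "exp (- ln p / 2) = p powr (- 1/2)" using p by (simp add: powr_def)
    also have "\<dots> = inverse (sqrt p)"
    proof -
      have "p powr (- (1/2)) = inverse (p powr (1/2))" by (rule powr_minus)
      then show ?thesis using p by (simp add: powr_half_sqrt)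
    qed
    finally have *: "2 powr (2 * \<beta>) * t powr (- \<beta>) = inverse (sqrt p)" .
    have "inverse (sqrt p) * p = sqrt p"
      using p real_div_sqrt[of p] by (simp add: field_simps)
    then show ?thesis unfolding * q_def .
  qed
  have main: "\<exists>J'\<subseteq>J. \<beta> * real (card J) \<le> real (card J') \<and>
         (\<forall>c \<in> J' \<rightarrow> S. \<exists>c'\<in>\<G>. (\<forall>j\<in>J'. c' j = c j) \<and> B c' \<inter> J' = {})"
    if J: "finite J" "J \<noteq> {}" and G: "\<G> \<subseteq> (J \<rightarrow>\<^sub>E S)"
      and B: "\<And>c. c \<in> \<G> \<Longrightarrow> B c \<subseteq> J \<and> real (card (B c)) \<le> \<beta> * real (card J)"
      and big: "q * real (card S) ^ card J < real (card \<G>)" for J :: "'a set" and \<G> B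
  proof -
    define n where "n = card J"
    have n: "n \<ge> 1" using J by (simp add: n_def Suc_le_eq card_gt_0_iff)
    define \<B> where "\<B> = {C. C \<subseteq> J \<and> real (card C) \<le> \<beta> * real n}"
    define \<H> where "\<H> C = {c\<in>\<G>. B c = C}" for C
    have fG: "finite \<G>" by (rule finite_subset[OF G]) (use J S in \<open>auto intro: finite_PiE\<close>)
    have f\<B>: "finite \<B>" using J by (auto simp: \<B>_def)
    have "\<exists>C\<in>\<B>. \<exists>J'\<subseteq>J. shatters (\<H> C) S J' \<and> 2 * \<beta> * real n < real (card J')"
    proof (rule ccontr)
      assume "\<not> ?thesis"
      then have *: "real (card J') \<le> 2 * \<beta> * real n" if "C \<in> \<B>" "J' \<subseteq> J" "shatters (\<H> C) S J'" for C J'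
        using that by (meson not_less)
      have "\<G> = (\<Union>C\<in>\<B>. \<H> C)" using B by (auto simp: \<B>_def \<H>_def n_def)
      then have "card \<G> \<le> (\<Sum>C\<in>\<B>. card (\<H> C))" using f\<B> card_UN_le by metis
      then have "real (card \<G>) \<le> (\<Sum>C\<in>\<B>. real (card (\<H> C)))" by (metis of_nat_mono of_nat_sum)
      also have "\<dots> \<le> (\<Sum>C\<in>\<B>. 2 powr (2 * \<beta> * real n) * (k - 1/2) ^ n)"
        unfolding k_def n_def
        by (rule sum_mono, rule card_shattering_free_le) (use J S G * in \<open>auto simp: \<H>_def n_def\<close>)
      also have "\<dots> = real (card \<B>) * (2 powr (2 * \<beta> * real n) * (k - 1/2) ^ n)" by simp
      also have "\<dots> \<le> (t powr (- (\<beta> * real n)) * (1 + t) ^ n) * (2 powr (2 * \<beta> * real n) * (k - 1/2) ^ n)"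
        using k unfolding \<B>_def n_def by (intro mult_right_mono card_small_subsets_le J t) auto
      also have "\<dots> = (2 powr (2 * \<beta>) * t powr (- \<beta>) * p) ^ n * k ^ n"
      proof -
        have 1: "t powr (- (\<beta> * real n)) = (t powr (- \<beta>)) ^ n"
          using t by (simp add: powr_powr flip: powr_realpow)
        have 2: "2 powr (2 * \<beta> * real n) = (2 powr (2 * \<beta>)) ^ n"
          by (simp add: powr_powr flip: powr_realpow)
        have 3: "k - 1/2 = (1 - 1 / (2 * k)) * k" using k by (simp add: field_simps)
        show ?thesis unfolding 1 2 3 p_def by (simp add: power_mult_distrib mult_ac)
      qed
      also have "\<dots> = q ^ n * k ^ n" by (simp only: key)
      also have "\<dots> \<le> q * k ^ n"
        using q n k power_decreasing[of 1 n q] by (intro mult_right_mono) auto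
      finally show False using big by (simp add: k_def n_def)
    qed
    then obtain C J' where C: "C \<in> \<B>" "J' \<subseteq> J" "shatters (\<H> C) S J'" "2 * \<beta> * real n < real (card J')"
      by blast
    have fC: "finite C" "finite J'" using C J by (auto simp: \<B>_def intro: finite_subset)
    obtain s where s: "s \<in> S" using S by blast
    show ?thesis
    proof (intro exI[of _ "J' - C"] conjI ballI)
      show "J' - C \<subseteq> J" using C by auto
      have "card J' - card C \<le> card (J' - C)" using fC by (simp add: diff_card_le_card_Diff)
      then have "real (card J') \<le> real (card (J' - C)) + real (card C)" by linarith
      moreover have "real (card C) \<le> \<beta> * real n" using C by (simp add: \<B>_def)
      moreover have "2 * \<beta> * real n = \<beta> * real n + \<beta> * real n" by simp
      ultimately show "\<beta> * real (card J) \<le> real (card (J' - C))"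
        using C(4) unfolding n_def by linarith
      fix c assume c: "c \<in> J' - C \<rightarrow> S"
      \<comment> \<open>On \<open>C\<close> an arbitrary symbol is prescribed, so that shattering of
        the whole of \<open>J'\<close> applies to a prescription given on \<open>J' - C\<close>
        only.\<close>
      have "(\<lambda>j. if j \<in> C then s else c j) \<in> J' \<rightarrow> S" using c s by auto
      from bspec[OF C(3)[unfolded shatters_def] this]
      obtain c' where "c' \<in> \<H> C" "\<forall>j\<in>J'. c' j = (if j \<in> C then s else c j)" by blast
      then show "\<exists>c'\<in>\<G>. (\<forall>j\<in>J' - C. c' j = c j) \<and> B c' \<inter> (J' - C) = {}"
        by (intro bexI[of _ c']) (auto simp: \<H>_def)
    qed
  qed
  show ?thesis by (rule that[OF \<beta> q]) (rule main)
qed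

section \<open>Random superpositions\<close>

lemma sum_PiE_insert:
  assumes "i \<notin> J"
  shows "(\<Sum>c\<in>insert i J \<rightarrow>\<^sub>E S. g c) = (\<Sum>s\<in>S. \<Sum>c\<in>J \<rightarrow>\<^sub>E S. g (c(i := s)))"
proof -
  have "(\<Sum>c\<in>insert i J \<rightarrow>\<^sub>E S. g c) = (\<Sum>x\<in>S \<times> (J \<rightarrow>\<^sub>E S). g ((snd x)(i := fst x)))"
    unfolding PiE_insert_eq
    using sum.reindex[OF inj_combinator[OF assms, of "\<lambda>_. S"], of g] by (simp add: case_prod_unfold)
  then show ?thesis by (simp add: sum.cartesian_product case_prod_unfold)
qed

text \<open>Independence and centring make the mixed terms vanish, so mean squares add up. Means are
  written as sums over \<open>J \<rightarrow>\<^sub>E S\<close>; the powers of \<open>card S\<close>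
  are the cleared denominators.\<close>

lemma sum_square_centered_product:
  fixes X :: "'a \<Rightarrow> 's \<Rightarrow> real"
  assumes "finite J" "finite S" "\<And>j. j \<in> J \<Longrightarrow> (\<Sum>s\<in>S. X j s) = 0"
  shows "real (card S) * (\<Sum>c\<in>J \<rightarrow>\<^sub>E S. (\<Sum>j\<in>J. X j (c j))\<^sup>2)
    = real (card S) ^ card J * (\<Sum>j\<in>J. \<Sum>s\<in>S. (X j s)\<^sup>2)"
  using assms(1,3)
proof (induction J rule: finite_induct)
  case (insert i J)
  define \<Omega> where "\<Omega> = (J \<rightarrow>\<^sub>E S)"
  define Y where "Y c = (\<Sum>j\<in>J. X j (c j))" for c
  have "(\<Sum>j\<in>insert i J. X j ((c(i := s)) j)) = X i s + Y c" for c s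
    using insert(1,2) by (simp add: Y_def) (intro sum.cong, auto)
  then have "(\<Sum>c\<in>insert i J \<rightarrow>\<^sub>E S. (\<Sum>j\<in>insert i J. X j (c j))\<^sup>2) = (\<Sum>s\<in>S. \<Sum>c\<in>\<Omega>. (X i s + Y c)\<^sup>2)"
    unfolding sum_PiE_insert[OF insert(2)] \<Omega>_def by simp
  also have "\<dots> = (\<Sum>s\<in>S. real (card \<Omega>) * (X i s)\<^sup>2 + 2 * X i s * (\<Sum>c\<in>\<Omega>. Y c) + (\<Sum>c\<in>\<Omega>. (Y c)\<^sup>2))"
  proof (intro sum.cong refl)
    fix s
    have "(\<Sum>c\<in>\<Omega>. (X i s + Y c)\<^sup>2) = (\<Sum>c\<in>\<Omega>. (X i s)\<^sup>2 + 2 * X i s * Y c + (Y c)\<^sup>2)"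
      by (intro sum.cong refl) (simp add: power2_sum)
    then show "(\<Sum>c\<in>\<Omega>. (X i s + Y c)\<^sup>2)
        = real (card \<Omega>) * (X i s)\<^sup>2 + 2 * X i s * (\<Sum>c\<in>\<Omega>. Y c) + (\<Sum>c\<in>\<Omega>. (Y c)\<^sup>2)"
      by (simp add: sum.distrib flip: sum_distrib_left)
  qed
  also have "\<dots> = real (card \<Omega>) * (\<Sum>s\<in>S. (X i s)\<^sup>2) + 2 * (\<Sum>s\<in>S. X i s) * (\<Sum>c\<in>\<Omega>. Y c)
      + real (card S) * (\<Sum>c\<in>\<Omega>. (Y c)\<^sup>2)"
    by (simp add: sum.distrib flip: sum_distrib_left sum_distrib_right)
  also have "(\<Sum>s\<in>S. X i s) = 0" using insert.prems by simp
  also have "real (card S) * (\<Sum>c\<in>\<Omega>. (Y c)\<^sup>2) = real (card S) ^ card J * (\<Sum>j\<in>J. \<Sum>s\<in>S. (X j s)\<^sup>2)"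
    unfolding Y_def \<Omega>_def by (rule insert.IH) (use insert.prems in auto)
  also have "card \<Omega> = card S ^ card J" using insert(1) by (simp add: \<Omega>_def card_PiE)
  finally show ?case using insert(1,2) by (simp add: algebra_simps)
qed simp

text \<open>The superposition of copies: later \<open>loc j \<gamma>\<close> is the point
  \<open>s \<gamma> j\<close> of the sofic model, and the copy attached to \<open>j\<close> puts the
  value \<open>v (c j) \<gamma>\<close> there. The indicator form lets copies overlap and add
  up.\<close>

definition scatter ::
    "('a \<Rightarrow> 'g \<Rightarrow> 'p) \<Rightarrow> 'g set \<Rightarrow> 'a set \<Rightarrow> ('s \<Rightarrow> 'g \<Rightarrow> real) \<Rightarrow> ('a \<Rightarrow> 's) \<Rightarrow> 'p \<Rightarrow> real" where
  "scatter loc T J v c p = (\<Sum>j\<in>J. \<Sum>\<gamma>\<in>T. if loc j \<gamma> = p then v (c j) \<gamma> else 0)"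

lemma scatter_add: "scatter loc T J (\<lambda>s \<gamma>. v s \<gamma> + w s \<gamma>) c p = scatter loc T J v c p + scatter loc T J w c p"
  unfolding scatter_def sum.distrib[symmetric] by (intro sum.cong) auto

lemma scatter_cong:
  "(\<And>s \<gamma>. \<gamma> \<in> T \<Longrightarrow> v s \<gamma> = w s \<gamma>) \<Longrightarrow> scatter loc T J v c p = scatter loc T J w c p"
  unfolding scatter_def by (intro sum.cong) auto

lemma scatter_Ints:
  "(\<And>s \<gamma>. \<gamma> \<in> T \<Longrightarrow> v s \<gamma> \<in> \<int>) \<Longrightarrow> scatter loc T J v c p \<in> \<int>"
  unfolding scatter_def by (intro Ints_sum) auto

lemma sum_pushforward_square:
  fixes u :: "'g \<Rightarrow> real"
  assumes "finite T" "finite D" "inj_on l T" "l ` T \<subseteq> D"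
  shows "(\<Sum>p\<in>D. (\<Sum>\<gamma>\<in>T. if l \<gamma> = p then u \<gamma> else 0)\<^sup>2) = (\<Sum>\<gamma>\<in>T. (u \<gamma>)\<^sup>2)"
proof -
  have "(\<Sum>p\<in>D. (\<Sum>\<gamma>\<in>T. if l \<gamma> = p then u \<gamma> else 0)\<^sup>2) = (\<Sum>p\<in>l ` T. (\<Sum>\<gamma>\<in>T. if l \<gamma> = p then u \<gamma> else 0)\<^sup>2)"
  proof (rule sum.mono_neutral_right)
    show "\<forall>p\<in>D - l ` T. (\<Sum>\<gamma>\<in>T. if l \<gamma> = p then u \<gamma> else 0)\<^sup>2 = 0"
      by (auto intro!: sum.neutral)
  qed (use assms in auto)
  also have "\<dots> = (\<Sum>\<gamma>'\<in>T. (\<Sum>\<gamma>\<in>T. if l \<gamma> = l \<gamma>' then u \<gamma> else 0)\<^sup>2)"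
    by (simp add: sum.reindex[OF assms(3)])
  also have "\<dots> = (\<Sum>\<gamma>'\<in>T. (u \<gamma>')\<^sup>2)"
  proof (rule sum.cong)
    fix \<gamma>' assume g: "\<gamma>' \<in> T"
    have "(\<Sum>\<gamma>\<in>T. if l \<gamma> = l \<gamma>' then u \<gamma> else 0) = (\<Sum>\<gamma>\<in>T. if \<gamma> = \<gamma>' then u \<gamma> else 0)"
      using assms(3) g by (intro sum.cong) (auto dest: inj_onD)
    then show "(\<Sum>\<gamma>\<in>T. if l \<gamma> = l \<gamma>' then u \<gamma> else 0)\<^sup>2 = (u \<gamma>')\<^sup>2" using assms(1) g by simp
  qed simp
  finally show ?thesis .
qed

text \<open>At each \<open>p\<close> the contributions of different \<open>j\<close> are independent
  and centred, so overlapping copies do not interact on average. Summation over \<open>p\<close>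
  recovers the square sum of one copy for each \<open>j\<close>, because \<open>loc j\<close> is
  injective on \<open>T\<close>; the images for different \<open>j\<close> may intersect.\<close>

lemma scatter_second_moment:
  assumes fin: "finite J" "finite S" "S \<noteq> {}" "finite T" "finite D"
    and loc: "\<And>j. j \<in> J \<Longrightarrow> inj_on (loc j) T" "\<And>j. j \<in> J \<Longrightarrow> loc j ` T \<subseteq> D"
    and cen: "\<And>\<gamma>. \<gamma> \<in> T \<Longrightarrow> (\<Sum>s\<in>S. v s \<gamma>) = 0"
    and small: "\<And>s. s \<in> S \<Longrightarrow> (\<Sum>\<gamma>\<in>T. (v s \<gamma>)\<^sup>2) \<le> \<eta>"
  shows "(\<Sum>c\<in>J \<rightarrow>\<^sub>E S. \<Sum>p\<in>D. (scatter loc T J v c p)\<^sup>2) \<le> real (card (J \<rightarrow>\<^sub>E S)) * (real (card J) * \<eta>)"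
proof -
  define X where "X p j s = (\<Sum>\<gamma>\<in>T. if loc j \<gamma> = p then v s \<gamma> else 0)" for p j s
  have X0: "(\<Sum>s\<in>S. X p j s) = 0" for p j
  proof -
    have "(\<Sum>s\<in>S. if loc j \<gamma> = p then v s \<gamma> else 0) = 0" if "\<gamma> \<in> T" for \<gamma>
      using cen[OF that] by (cases "loc j \<gamma> = p") simp_all
    then show ?thesis unfolding X_def by (subst sum.swap) simp
  qed
  have S0: "real (card S) > 0" using fin by (simp add: card_gt_0_iff)
  have cO: "real (card (J \<rightarrow>\<^sub>E S)) = real (card S) ^ card J" using fin by (simp add: card_PiE)
  have "real (card S) * (\<Sum>c\<in>J \<rightarrow>\<^sub>E S. \<Sum>p\<in>D. (scatter loc T J v c p)\<^sup>2)
      = (\<Sum>p\<in>D. real (card S) * (\<Sum>c\<in>J \<rightarrow>\<^sub>E S. (\<Sum>j\<in>J. X p j (c j))\<^sup>2))"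
    unfolding scatter_def X_def sum_distrib_left by (rule sum.swap)
  also have "\<dots> = (\<Sum>p\<in>D. real (card S) ^ card J * (\<Sum>j\<in>J. \<Sum>s\<in>S. (X p j s)\<^sup>2))"
    by (intro sum.cong refl sum_square_centered_product fin X0)
  also have "\<dots> = real (card S) ^ card J * (\<Sum>p\<in>D. \<Sum>j\<in>J. \<Sum>s\<in>S. (X p j s)\<^sup>2)"
    by (simp add: sum_distrib_left)
  also have "(\<Sum>p\<in>D. \<Sum>j\<in>J. \<Sum>s\<in>S. (X p j s)\<^sup>2) = (\<Sum>j\<in>J. \<Sum>s\<in>S. \<Sum>p\<in>D. (X p j s)\<^sup>2)"
    by (subst sum.swap) (intro sum.cong refl sum.swap)
  also have "\<dots> = (\<Sum>j\<in>J. \<Sum>s\<in>S. \<Sum>\<gamma>\<in>T. (v s \<gamma>)\<^sup>2)"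
    unfolding X_def by (intro sum.cong refl sum_pushforward_square fin loc)
  also have "real (card S) ^ card J * \<dots> \<le> real (card S) ^ card J * (\<Sum>j\<in>J. \<Sum>s\<in>S. \<eta>)"
    by (intro mult_left_mono sum_mono small) simp_all
  also have "\<dots> = real (card S) * (real (card S) ^ card J * (real (card J) * \<eta>))" by simp
  finally have "real (card S) * (\<Sum>c\<in>J \<rightarrow>\<^sub>E S. \<Sum>p\<in>D. (scatter loc T J v c p)\<^sup>2)
      \<le> real (card S) * (real (card S) ^ card J * (real (card J) * \<eta>))"
    .
  then show ?thesis using S0 unfolding cO by simp
qed

section \<open>Markov's inequality and independent sets of points\<close>

lemma card_markov:
  fixes Z :: "'a \<Rightarrow> real"
  assumes "finite \<Omega>" "\<And>c. c \<in> \<Omega> \<Longrightarrow> 0 \<le> Z c" "(\<Sum>c\<in>\<Omega>. Z c) \<le> real (card \<Omega>) * a" "0 < t"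
  shows "real (card {c\<in>\<Omega>. t \<le> Z c}) \<le> real (card \<Omega>) * (a / t)"
proof -
  have "t * real (card {c\<in>\<Omega>. t \<le> Z c}) = (\<Sum>c\<in>{c\<in>\<Omega>. t \<le> Z c}. t)" by simp
  also have "\<dots> \<le> (\<Sum>c\<in>{c\<in>\<Omega>. t \<le> Z c}. Z c)" by (rule sum_mono) simp
  also have "\<dots> \<le> (\<Sum>c\<in>\<Omega>. Z c)" using assms by (intro sum_mono2) auto
  finally show ?thesis using assms(3,4) by (simp add: field_simps)
qed

text \<open>If an independent set \<open>J\<close> has maximal size, every further point of
  \<open>G\<close> is related to a member, so \<open>J\<close> and its at most
  \<open>M * card J\<close> neighbours cover \<open>G\<close>.\<close>

lemma large_independent_subset:
  assumes "finite G" "\<And>x y. R x y \<Longrightarrow> R y x" "\<And>x. x \<in> G \<Longrightarrow> card {y\<in>G. R x y} \<le> M"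
  obtains J where "J \<subseteq> G" "\<And>x y. x \<in> J \<Longrightarrow> y \<in> J \<Longrightarrow> x \<noteq> y \<Longrightarrow> \<not> R x y" "card G \<le> (M + 1) * card J"
proof -
  define P where "P J \<longleftrightarrow> J \<subseteq> G \<and> (\<forall>x\<in>J. \<forall>y\<in>J. x \<noteq> y \<longrightarrow> \<not> R x y)" for J
  have "P {}" by (simp add: P_def)
  moreover have "card J \<le> card G" if "P J" for J using that assms(1) by (auto simp: P_def intro: card_mono)
  ultimately have "\<exists>J. P J \<and> (\<forall>J'. P J' \<longrightarrow> card J' \<le> card J)"
    by (intro ex_has_greatest_nat[where b = "Suc (card G)"]) (auto simp: less_Suc_eq_le)
  then obtain J where J: "P J" "\<And>J'. P J' \<Longrightarrow> card J' \<le> card J" by metis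
  have fJ: "finite J" using J assms(1) by (auto simp: P_def intro: finite_subset)
  have "G \<subseteq> J \<union> (\<Union>x\<in>J. {y\<in>G. R x y})"
  proof
    fix y assume y: "y \<in> G"
    show "y \<in> J \<union> (\<Union>x\<in>J. {y\<in>G. R x y})"
    proof (rule ccontr)
      assume n: "\<not> ?thesis"
      then have "P (insert y J)" using J(1) y assms(2) by (auto simp: P_def)
      from J(2)[OF this] n fJ show False by simp
    qed
  qed
  then have "card G \<le> card (J \<union> (\<Union>x\<in>J. {y\<in>G. R x y}))" using fJ assms(1) by (intro card_mono) auto
  also have "\<dots> \<le> card J + card (\<Union>x\<in>J. {y\<in>G. R x y})" by (rule card_Un_le)
  also have "card (\<Union>x\<in>J. {y\<in>G. R x y}) \<le> (\<Sum>x\<in>J. card {y\<in>G. R x y})" using fJ by (rule card_UN_le)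
  also have "\<dots> \<le> (\<Sum>x\<in>J. M)" using J(1) by (intro sum_mono assms(3)) (auto simp: P_def)
  finally have "card G \<le> (M + 1) * card J" by (simp add: mult.commute)
  then show ?thesis using J(1) that[of J] by (auto simp: P_def)
qed

section \<open>Kronecker's theorem\<close>

lemma norm_midpoint_one_less_one:
  fixes u :: complex
  assumes "cmod u = 1" "u \<noteq> 1"
  shows "cmod ((1 + u) / 2) < 1"
proof -
  have 1: "(Re u)\<^sup>2 + (Im u)\<^sup>2 = 1" using assms(1) by (simp add: cmod_def)
  have "Re u < 1"
  proof (rule ccontr)
    assume "\<not> ?thesis"
    then have r: "1 \<le> Re u" by simp
    then have "1 \<le> (Re u)\<^sup>2" by simp
    then have "(Im u)\<^sup>2 \<le> 0" "(Re u)\<^sup>2 \<le> 1" using 1 zero_le_power2[of "Im u"] by linarith+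
    then have "Im u = 0" "Re u = 1" using r by (auto simp: power2_le_iff_abs_le abs_square_le_1)
    then show False using assms(2) by (simp add: complex_eq_iff)
  qed
  then have "(cmod (1 + u))\<^sup>2 < 2\<^sup>2" using 1 by (simp add: cmod_power2 power2_sum)
  then have "cmod (1 + u) < 2" by (rule power_less_imp_less_base) simp
  then show ?thesis by (simp add: norm_divide)
qed

text \<open>Averaging a function over translation by \<open>s\<close> repeatedly suppresses every character that is
  nontrivial at \<open>s\<close>, without increasing the supremum norm. This replaces integration against the
  Haar measure of a dual group.\<close>

lemma norm_sum_trivial_characters_le:
  fixes u :: "'i \<Rightarrow> 'w::ab_group_add \<Rightarrow> complex"
  assumes "finite I"
    and "\<And>i v w. i \<in> I \<Longrightarrow> u i (v + w) = u i v * u i w"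
    and "\<And>i w. i \<in> I \<Longrightarrow> cmod (u i w) = 1"
    and "\<And>w. cmod (\<Sum>i\<in>I. a i * u i w) \<le> C"
  shows "cmod (\<Sum>i\<in>{i\<in>I. \<forall>w. u i w = 1}. a i) \<le> C"
  using assms
proof (induction I rule: finite_psubset_induct)
  case (psubset I)
  note mult = psubset.prems(1) and unim = psubset.prems(2) and bd = psubset.prems(3)
  show ?case
  proof (cases "\<forall>i\<in>I. \<forall>w. u i w = 1")
    case True
    then have "{i\<in>I. \<forall>w. u i w = 1} = I" by auto
    moreover have "(\<Sum>i\<in>I. a i * u i 0) = (\<Sum>i\<in>I. a i)" using True by (intro sum.cong) auto
    ultimately show ?thesis using bd[of 0] by simp
  next
    case False
    then obtain i0 s where i0: "i0 \<in> I" "u i0 s \<noteq> 1" by blast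
    define I' where "I' = {i\<in>I. u i s = 1}"
    have ps: "I' \<subset> I" using i0 by (auto simp: I'_def)
    have avg: "cmod (\<Sum>i\<in>I. a i * ((1 + u i s) / 2) ^ m * u i w) \<le> C" for m w
    proof (induction m arbitrary: w)
      case 0 then show ?case using bd by simp
    next
      case (Suc m)
      have "(\<Sum>i\<in>I. a i * ((1 + u i s) / 2) ^ Suc m * u i w)
          = (\<Sum>i\<in>I. (a i * ((1 + u i s) / 2) ^ m * u i w + a i * ((1 + u i s) / 2) ^ m * u i (s + w)) / 2)"
        by (intro sum.cong refl) (simp add: mult field_simps)
      also have "\<dots> = ((\<Sum>i\<in>I. a i * ((1 + u i s) / 2) ^ m * u i w)
          + (\<Sum>i\<in>I. a i * ((1 + u i s) / 2) ^ m * u i (s + w))) / 2"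
        by (simp only: sum.distrib flip: sum_divide_distrib)
      also have "cmod \<dots> \<le> (C + C) / 2"
        unfolding norm_divide
        using norm_triangle_le[OF add_mono[OF Suc.IH[of w] Suc.IH[of "s + w"]]] by (simp only: norm_numeral) simp
      finally show ?case by simp
    qed
    have "cmod (\<Sum>i\<in>I'. a i * u i w) \<le> C" for w
    proof -
      \<comment> \<open>In the limit each factor becomes the indicator of \<open>u i s = 1\<close>,
        so the bound passes to the proper subset \<open>I'\<close>, which has lost
        \<open>i0\<close>.\<close>
      have "(\<lambda>m. \<Sum>i\<in>I. a i * ((1 + u i s) / 2) ^ m * u i w)
          \<longlonglongrightarrow> (\<Sum>i\<in>I. a i * (if u i s = 1 then 1 else 0) * u i w)"
      proof (intro tendsto_sum tendsto_mult tendsto_const)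
        fix i assume i: "i \<in> I"
        show "(\<lambda>m. ((1 + u i s) / 2) ^ m) \<longlonglongrightarrow> (if u i s = 1 then 1 else 0)"
        proof (cases "u i s = 1")
          case False
          then show ?thesis using norm_midpoint_one_less_one[OF unim[OF i] False]
            by (simp add: LIMSEQ_power_zero)
        qed simp
      qed
      then have "cmod (\<Sum>i\<in>I. a i * (if u i s = 1 then 1 else 0) * u i w) \<le> C"
        by (rule Lim_norm_ubound[OF trivial_limit_sequentially]) (simp add: avg)
      also have "(\<Sum>i\<in>I. a i * (if u i s = 1 then 1 else 0) * u i w) = (\<Sum>i\<in>I'. a i * u i w)"
        unfolding I'_def using psubset.hyps
        by (subst sum.inter_filter) (auto intro!: sum.cong)
      finally show ?thesis .
    qed
    then have "cmod (\<Sum>i\<in>{i\<in>I'. \<forall>w. u i w = 1}. a i) \<le> C"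
      using mult unim by (intro psubset.IH[OF ps]) (auto simp: I'_def)
    moreover have "{i\<in>I'. \<forall>w. u i w = 1} = {i\<in>I. \<forall>w. u i w = 1}" by (auto simp: I'_def)
    ultimately show ?thesis by simp
  qed
qed

text \<open>Chooses the degree of the Bohr kernel below: relative to \<open>4 ^ (M * N)\<close>, its
  constant coefficient loses only a factor polynomial in \<open>M\<close>, while its supremum would
  lose \<open>r ^ M\<close>. Taking an \<open>N\<close>-th root reduces the claim to
  \<open>n * s ^ n\<close> tending to 0.\<close>

lemma exists_poly_times_power_less_one:
  fixes r :: real
  assumes "0 \<le> r" "r < 1"
  obtains M where "M > 0" "(2 * real M) ^ N * r ^ M < 1"
proof (cases "N = 0")
  case True
  then show ?thesis using assms by (intro that[of 1]) auto
next
  case False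
  define s where "s = root N r"
  have s: "0 \<le> s" "s < 1" "s ^ N = r" using assms False by (auto simp: s_def real_root_lt_1_iff)
  have "(\<lambda>n. of_nat n * s ^ n) \<longlonglongrightarrow> 0" using s by (intro powser_times_n_limit_0) auto
  then have "eventually (\<lambda>n. real n * s ^ n < 1 / 2) sequentially"
    by (rule order_tendstoD) simp
  then have "eventually (\<lambda>n. real n * s ^ n < 1 / 2 \<and> n > 0) sequentially"
    by (intro eventually_conj eventually_gt_at_top)
  then obtain M where M: "real M * s ^ M < 1 / 2" "M > 0" by (auto simp: eventually_at_top_linorder)
  have "(2 * real M * s ^ M) ^ N < 1"
    using M s False by (intro power_less_one_iff[THEN iffD2]) auto
  then have "(2 * real M) ^ N * r ^ M < 1"
    unfolding s(3)[symmetric] by (simp add: power_mult_distrib power_mult[symmetric] mult.commute)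
  then show ?thesis using M that by blast
qed

text \<open>Kronecker's theorem by Bohr's method: the kernel \<open>\<Prod>\<kappa>. \<bar>1 + z \<kappa>\<bar>\<^bsup>2M\<^esup>\<close> has nonnegative Fourier
  coefficients, so by the hypothesis on \<open>y\<close> its mean is at least its constant coefficient, while it
  would be exponentially smaller if no point came close to \<open>y\<close>.\<close>

lemma kronecker_bohr:
  fixes \<theta> :: "'i \<Rightarrow> 'w::ab_group_add \<Rightarrow> complex" and y :: "'i \<Rightarrow> complex"
  assumes K: "finite K" and \<epsilon>: "0 < \<epsilon>"
    and mult: "\<And>\<kappa> v w. \<kappa> \<in> K \<Longrightarrow> \<theta> \<kappa> (v + w) = \<theta> \<kappa> v * \<theta> \<kappa> w"
    and unim: "\<And>\<kappa> w. \<kappa> \<in> K \<Longrightarrow> cmod (\<theta> \<kappa> w) = 1" "\<And>\<kappa>. \<kappa> \<in> K \<Longrightarrow> cmod (y \<kappa>) = 1"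
    and rel: "\<And>a b :: 'i \<Rightarrow> nat. (\<And>w. (\<Prod>\<kappa>\<in>K. \<theta> \<kappa> w ^ a \<kappa> * cnj (\<theta> \<kappa> w) ^ b \<kappa>) = 1) \<Longrightarrow>
      (\<Prod>\<kappa>\<in>K. y \<kappa> ^ a \<kappa> * cnj (y \<kappa>) ^ b \<kappa>) = 1"
  shows "\<exists>w. \<forall>\<kappa>\<in>K. cmod (\<theta> \<kappa> w - y \<kappa>) < \<epsilon>"
proof (rule ccontr)
  assume "\<not> ?thesis"
  then have far: "\<exists>\<kappa>\<in>K. \<epsilon> \<le> cmod (\<theta> \<kappa> w - y \<kappa>)" for w by (auto simp: not_less)
  then have K0: "K \<noteq> {}" by blast
  define z where "z \<kappa> w = \<theta> \<kappa> w * cnj (y \<kappa>)" for \<kappa> w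
  have uz: "cmod (z \<kappa> w) = 1" if "\<kappa> \<in> K" for \<kappa> w using that unim by (simp add: z_def norm_mult)
  have yy: "y \<kappa> * cnj (y \<kappa>) = 1" "cnj (y \<kappa>) * y \<kappa> = 1" if "\<kappa> \<in> K" for \<kappa>
    using unim(2)[OF that] by (simp_all add: complex_norm_square[symmetric] mult.commute)
  have zz: "z \<kappa> w * cnj (z \<kappa> w) = 1" if "\<kappa> \<in> K" for \<kappa> w
    using uz[OF that, of w] by (simp add: complex_norm_square[symmetric])
  \<comment> \<open>The parallelogram law for 1 and \<open>z \<kappa> w\<close>. Distance from
    \<open>y\<close> at one coordinate lowers the corresponding factor of the kernel below its
    maximum 4.\<close>
  have b4: "(cmod (1 + z \<kappa> w))\<^sup>2 + (cmod (\<theta> \<kappa> w - y \<kappa>))\<^sup>2 = 4" if "\<kappa> \<in> K" for \<kappa> w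
  proof -
    have "\<theta> \<kappa> w - y \<kappa> = y \<kappa> * (z \<kappa> w - 1)" using yy[OF that] by (simp add: z_def algebra_simps)
    then have "cmod (\<theta> \<kappa> w - y \<kappa>) = cmod (z \<kappa> w - 1)" using unim(2)[OF that] by (simp add: norm_mult)
    moreover have "(Re (z \<kappa> w))\<^sup>2 + (Im (z \<kappa> w))\<^sup>2 = 1" using uz[OF that, of w] by (simp add: cmod_def)
    ultimately show ?thesis by (simp add: cmod_power2 power2_sum power2_diff)
  qed
  \<comment> \<open>The proportion of its maximum that
    \<open>(cmod (1 + z \<kappa> w))\<^sup>2\<close> can keep at a coordinate that is \<epsilon>-far
    from \<open>y\<close>.\<close>
  define r where "r = (4 - \<epsilon>\<^sup>2) / 4"
  have r: "0 \<le> r" "r < 1"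
  proof -
    obtain \<kappa> where \<kappa>: "\<kappa> \<in> K" "\<epsilon> \<le> cmod (\<theta> \<kappa> 0 - y \<kappa>)" using far by blast
    then have "\<epsilon>\<^sup>2 \<le> (cmod (\<theta> \<kappa> 0 - y \<kappa>))\<^sup>2" using \<epsilon> by (intro power_mono) auto
    moreover have "0 \<le> (cmod (1 + z \<kappa> 0))\<^sup>2" by simp
    ultimately have "\<epsilon>\<^sup>2 \<le> 4" using b4[OF \<kappa>(1), of 0] by linarith
    then show "0 \<le> r" by (simp add: r_def)
    show "r < 1" using \<epsilon> by (simp add: r_def)
  qed
  define N where "N = card K"
  have N: "N > 0" using K K0 by (simp add: N_def card_gt_0_iff)
  obtain M where M: "M > 0" "(2 * real M) ^ N * r ^ M < 1"
    using exists_poly_times_power_less_one[OF r] by blast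
  define p where "p w = (\<Prod>\<kappa>\<in>K. (cmod (1 + z \<kappa> w)) ^ (2 * M))" for w
  define C where "C = 4 ^ (M * N) * r ^ M"
  have p_le: "p w \<le> C" for w
  proof -
    obtain \<kappa> where \<kappa>: "\<kappa> \<in> K" "\<epsilon> \<le> cmod (\<theta> \<kappa> w - y \<kappa>)" using far by blast
    have le4: "(cmod (1 + z \<kappa>' w)) ^ (2 * M) \<le> 4 ^ M" if "\<kappa>' \<in> K" for \<kappa>'
      unfolding power_mult using b4[OF that, of w] zero_le_power2[of "cmod (\<theta> \<kappa>' w - y \<kappa>')"]
      by (intro power_mono) (linarith, simp)
    have "\<epsilon>\<^sup>2 \<le> (cmod (\<theta> \<kappa> w - y \<kappa>))\<^sup>2" using \<epsilon> \<kappa> by (intro power_mono) auto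
    then have "(cmod (1 + z \<kappa> w))\<^sup>2 \<le> 4 * r" using b4[OF \<kappa>(1), of w] by (simp add: r_def)
    then have k: "(cmod (1 + z \<kappa> w)) ^ (2 * M) \<le> (4 * r) ^ M"
      unfolding power_mult by (intro power_mono) auto
    have "p w = (cmod (1 + z \<kappa> w)) ^ (2 * M) * (\<Prod>\<kappa>'\<in>K - {\<kappa>}. (cmod (1 + z \<kappa>' w)) ^ (2 * M))"
      unfolding p_def using K \<kappa> by (simp add: prod.remove)
    also have "\<dots> \<le> (4 * r) ^ M * (\<Prod>\<kappa>'\<in>K - {\<kappa>}. 4 ^ M)"
      using k le4 r by (intro mult_mono prod_mono) (auto intro: prod_nonneg)
    also have "\<dots> = (4 * r) ^ M * (4 ^ M) ^ (N - 1)" using K \<kappa> by (simp add: N_def)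
    also have "\<dots> = C"
    proof -
      have "(4::real) ^ M * (4 ^ M) ^ (N - 1) = (4 ^ M) ^ Suc (N - 1)" by simp
      also have "\<dots> = 4 ^ (M * N)" using N by (simp only: power_mult) simp
      finally show ?thesis by (simp add: C_def power_mult_distrib mult_ac)
    qed
    finally show ?thesis .
  qed
  define I where "I = (K \<rightarrow>\<^sub>E {..2 * M})"
  \<comment> \<open>On the unit circle \<open>1 + cnj z = (1 + z) * cnj z\<close>, so a factor of
    the kernel is \<open>(1 + z) ^ (2 * M) * cnj z ^ M\<close>. Its frequencies
    \<open>i \<kappa> - M\<close> are written with two natural exponents, the form in which
    \<open>rel\<close> speaks about relations.\<close>
  define u where "u i w = (\<Prod>\<kappa>\<in>K. \<theta> \<kappa> w ^ i \<kappa> * cnj (\<theta> \<kappa> w) ^ M)" for i :: "'i \<Rightarrow> nat" and w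
  define t where "t i = (\<Prod>\<kappa>\<in>K. y \<kappa> ^ i \<kappa> * cnj (y \<kappa>) ^ M)" for i :: "'i \<Rightarrow> nat"
  define a where "a i = (\<Prod>\<kappa>\<in>K. of_nat ((2 * M) choose i \<kappa>)) * cnj (t i)" for i :: "'i \<Rightarrow> nat"
  have fI: "finite I" using K by (auto simp: I_def intro: finite_PiE)
  have expand: "complex_of_real (p w) = (\<Sum>i\<in>I. a i * u i w)" for w
  proof -
    have "complex_of_real ((cmod (1 + z \<kappa> w)) ^ (2 * M))
        = (\<Sum>i\<le>2 * M. of_nat ((2 * M) choose i) * z \<kappa> w ^ i * cnj (z \<kappa> w) ^ M)" if \<kappa>: "\<kappa> \<in> K" for \<kappa>
    proof -
      have c: "cnj (1 + z \<kappa> w) = (1 + z \<kappa> w) * cnj (z \<kappa> w)" using zz[OF \<kappa>, of w] by (simp add: algebra_simps)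
      have "complex_of_real ((cmod (1 + z \<kappa> w)) ^ (2 * M)) = (complex_of_real ((cmod (1 + z \<kappa> w))\<^sup>2)) ^ M"
        by (simp add: power_mult)
      also have "\<dots> = ((1 + z \<kappa> w) * cnj (1 + z \<kappa> w)) ^ M" by (simp only: complex_norm_square)
      also have "\<dots> = (z \<kappa> w + 1) ^ (2 * M) * cnj (z \<kappa> w) ^ M"
        unfolding c by (simp add: power_mult_distrib power_mult power2_eq_square add.commute mult.assoc)
      also have "(z \<kappa> w + 1) ^ (2 * M) = (\<Sum>i\<le>2 * M. of_nat ((2 * M) choose i) * z \<kappa> w ^ i)"
        by (subst binomial_ring) simp
      finally show ?thesis by (simp add: sum_distrib_right)
    qed
    then have "complex_of_real (p w)
        = (\<Prod>\<kappa>\<in>K. \<Sum>i\<le>2 * M. of_nat ((2 * M) choose i) * z \<kappa> w ^ i * cnj (z \<kappa> w) ^ M)"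
      unfolding p_def of_real_prod by (intro prod.cong) auto
    also have "\<dots> = (\<Sum>i\<in>I. \<Prod>\<kappa>\<in>K. of_nat ((2 * M) choose i \<kappa>) * z \<kappa> w ^ i \<kappa> * cnj (z \<kappa> w) ^ M)"
      unfolding I_def by (rule prod_sum_PiE) (use K in auto)
    also have "\<dots> = (\<Sum>i\<in>I. a i * u i w)"
      by (intro sum.cong refl)
        (simp add: a_def u_def t_def z_def power_mult_distrib prod.distrib mult_ac)
    finally show ?thesis .
  qed
  have "cmod (\<Sum>i\<in>{i\<in>I. \<forall>w. u i w = 1}. a i) \<le> C"
  proof (rule norm_sum_trivial_characters_le[OF fI])
    show "u i (v + w) = u i v * u i w" for i v w
      unfolding u_def prod.distrib[symmetric] by (intro prod.cong refl) (simp add: mult power_mult_distrib mult_ac)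
    show "cmod (u i w) = 1" for i w
      unfolding u_def prod_norm[symmetric] by (intro prod.neutral) (simp add: norm_mult norm_power unim)
    show "cmod (\<Sum>i\<in>I. a i * u i w) \<le> C" for w
    proof -
      have "0 \<le> p w" by (simp add: p_def prod_nonneg)
      then show ?thesis using p_le[of w] by (simp flip: expand)
    qed
  qed
  also have "(\<Sum>i\<in>{i\<in>I. \<forall>w. u i w = 1}. a i)
      = complex_of_real (\<Sum>i\<in>{i\<in>I. \<forall>w. u i w = 1}. \<Prod>\<kappa>\<in>K. real ((2 * M) choose i \<kappa>))"
    unfolding of_real_sum
  proof (intro sum.cong refl)
    fix i assume "i \<in> {i\<in>I. \<forall>w. u i w = 1}"
    \<comment> \<open>By \<open>rel\<close> the twist by \<open>y\<close> disappears on trivial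
      characters, so that only positive binomial coefficients are summed.\<close>
    then have "t i = 1" unfolding t_def by (intro rel) (simp add: u_def)
    then show "a i = complex_of_real (\<Prod>\<kappa>\<in>K. real ((2 * M) choose i \<kappa>))" by (simp add: a_def)
  qed
  also have "cmod \<dots> = (\<Sum>i\<in>{i\<in>I. \<forall>w. u i w = 1}. \<Prod>\<kappa>\<in>K. real ((2 * M) choose i \<kappa>))"
    by (simp add: sum_nonneg prod_nonneg del: of_real_sum)
  finally have upper: "(\<Sum>i\<in>{i\<in>I. \<forall>w. u i w = 1}. \<Prod>\<kappa>\<in>K. real ((2 * M) choose i \<kappa>)) \<le> C" .
  \<comment> \<open>Frequency 0 in every coordinate. Its coefficient is a power of the central
    binomial coefficient, which by the choice of \<open>M\<close> alone exceeds the upper bound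
    \<open>C\<close>.\<close>
  define i0 where "i0 = (\<lambda>\<kappa>\<in>K. M)"
  have "i0 \<in> {i\<in>I. \<forall>w. u i w = 1}"
  proof -
    have "u i0 w = 1" for w
      unfolding u_def i0_def
      by (intro prod.neutral) (simp add: unim complex_norm_square[symmetric] flip: power_mult_distrib)
    then show ?thesis by (auto simp: I_def i0_def)
  qed
  then have "(\<Prod>\<kappa>\<in>K. real ((2 * M) choose i0 \<kappa>)) \<le> (\<Sum>i\<in>{i\<in>I. \<forall>w. u i w = 1}. \<Prod>\<kappa>\<in>K. real ((2 * M) choose i \<kappa>))"
    using fI by (intro member_le_sum) (auto intro: prod_nonneg)
  also have "(\<Prod>\<kappa>\<in>K. real ((2 * M) choose i0 \<kappa>)) = real ((2 * M) choose M) ^ N"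
    by (simp add: i0_def N_def)
  finally have "(4 ^ M / (2 * real M)) ^ N \<le> C"
    using upper central_binomial_lower_bound[OF M(1)] M(1)
    by (smt (verit) divide_nonneg_nonneg of_nat_0_le_iff power_mono zero_le_power)
  then have "4 ^ (M * N) * 1 \<le> 4 ^ (M * N) * ((2 * real M) ^ N * r ^ M)"
    using M(1) by (simp add: C_def power_divide power_mult field_simps)
  then show False using M(2) by (subst (asm) mult_le_cancel_left_pos) auto
qed

section \<open>The circle and the dual module\<close>

text \<open>The type \<open>circle\<close> carries a quotient topology but no metric. This injective
  character into the unit circle supplies one, and all approximations in the circle are expressed
  through it.\<close>

lift_definition circle_exp :: "circle \<Rightarrow> complex" is "\<lambda>x. cis (2 * pi * x)"
proof -
  fix x y assume "int_cong x y"
  then have "cis (2 * pi * (x - y)) = 1" unfolding int_cong_def by (rule cis_multiple_2pi)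
  moreover have "cis (2 * pi * x) = cis (2 * pi * (x - y)) * cis (2 * pi * y)"
    by (simp add: cis_mult algebra_simps)
  ultimately show "cis (2 * pi * x) = cis (2 * pi * y)" by simp
qed

lemma circle_exp_add: "circle_exp (s + t) = circle_exp s * circle_exp t"
  by transfer (simp add: cis_mult algebra_simps)

lemma circle_exp_0 [simp]: "circle_exp 0 = 1"
  by transfer simp

lemma norm_circle_exp [simp]: "cmod (circle_exp t) = 1"
  by transfer simp

lemma circle_exp_abs: "circle_exp (abs_circle x) = cis (2 * pi * x)"
  by (rule circle_exp.abs_eq)

lemma abs_circle_add: "abs_circle (x + y) = abs_circle x + abs_circle y"
  by (simp add: plus_circle.abs_eq)

lemma circle_exp_eq_1_iff: "circle_exp t = 1 \<longleftrightarrow> t = 0"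
proof
  show "circle_exp t = 1 \<Longrightarrow> t = 0"
  proof transfer
    fix x assume "cis (2 * pi * x) = 1"
    then have "exp (\<i> * of_real (2 * pi * x)) = 1" by (simp add: cis_conv_exp)
    then obtain n :: int where "2 * pi * x = of_int (2 * n) * pi" unfolding exp_eq_1 by auto
    then have "x = of_int n" by simp
    then show "int_cong x 0" by (simp add: int_cong_def)
  qed
qed simp

lemma circle_exp_eq_iff: "circle_exp s = circle_exp t \<longleftrightarrow> s = t"
proof
  assume eq: "circle_exp s = circle_exp t"
  have "circle_exp s = circle_exp (s - t) * circle_exp t" by (simp flip: circle_exp_add)
  moreover have "circle_exp t \<noteq> 0" using norm_circle_exp[of t] by force
  ultimately have "circle_exp (s - t) = 1" using eq by simp
  then show "s = t" by (simp add: circle_exp_eq_1_iff)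
qed simp

lemma circle_exp_abs_eq_1_iff: "circle_exp (abs_circle x) = 1 \<longleftrightarrow> x \<in> \<int>"
  unfolding circle_exp_eq_1_iff by transfer (simp add: int_cong_def)

lemma norm_circle_exp_abs_minus_1_le: "cmod (circle_exp (abs_circle x) - 1) \<le> 2 * pi * \<bar>x\<bar>"
proof -
  have "cmod (circle_exp (abs_circle x) - 1) = 2 * \<bar>sin (2 * pi * x / 2)\<bar>"
    unfolding circle_exp_abs cis_conv_exp by (rule dist_exp_i_1)
  also have "\<dots> \<le> 2 * \<bar>2 * pi * x / 2\<bar>" using abs_sin_x_le_abs_x[of "2 * pi * x / 2"] by simp
  finally show ?thesis by (simp add: abs_mult)
qed

lemma norm_circle_exp_abs_diff_le:
  "cmod (circle_exp (abs_circle x) - circle_exp (abs_circle y)) \<le> 2 * pi * \<bar>x - y\<bar>"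
proof -
  have "circle_exp (abs_circle x) = circle_exp (abs_circle (x - y)) * circle_exp (abs_circle y)"
    by (simp flip: circle_exp_add abs_circle_add)
  then have "circle_exp (abs_circle x) - circle_exp (abs_circle y)
      = (circle_exp (abs_circle (x - y)) - 1) * circle_exp (abs_circle y)" by (simp add: algebra_simps)
  then show ?thesis using norm_circle_exp_abs_minus_1_le[of "x - y"] by (simp add: norm_mult)
qed

lemma continuous_on_abs_circle: "continuous_on UNIV abs_circle"
  by (simp add: continuous_on_open_vimage open_circle_def)

lemma continuous_on_circle_exp: "continuous_on UNIV circle_exp"
proof -
  have "continuous_on UNIV (\<lambda>x::real. cis (2 * pi * x))"
    unfolding cis_conv_exp by (intro continuous_intros)
  then show ?thesis
    by (simp add: continuous_on_open_vimage open_circle_def vimage_def circle_exp_abs)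
qed

lemma compact_UNIV_circle: "compact (UNIV :: circle set)"
proof -
  have "t \<in> abs_circle ` {0..1}" for t
  proof -
    obtain x where x: "t = abs_circle x" by (metis Quotient3_abs_rep Quotient3_circle)
    have "abs_circle x = abs_circle (frac x)"
      by (simp add: circle.abs_eq_iff int_cong_def frac_def)
    then show ?thesis using x frac_ge_0[of x] frac_lt_1[of x] by (intro image_eqI[of _ _ "frac x"]) auto
  qed
  then have "UNIV = abs_circle ` {0..1}" by blast
  moreover have "compact (abs_circle ` {0..1})"
    by (intro compact_continuous_image continuous_on_subset[OF continuous_on_abs_circle]) auto
  ultimately show ?thesis by simp
qed

lemma compact_UNIV_circle_fun: "compact (UNIV :: ('a \<Rightarrow> circle) set)"
proof -
  have "compact_space (euclidean :: circle topology)"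
    using compact_UNIV_circle by (simp add: compact_space_def)
  then have "compact_space (product_topology (\<lambda>_::'a. euclidean :: circle topology) UNIV)"
    by (simp add: compact_space_product_topology)
  then show ?thesis by (simp add: compact_space_def euclidean_product_topology)
qed

lemma continuous_on_circle_exp_eval: "continuous_on UNIV (\<lambda>\<theta> :: 'a \<Rightarrow> circle. circle_exp (\<theta> a))"
  by (rule continuous_on_compose2[OF continuous_on_circle_exp continuous_on_product_coordinates]) simp

text \<open>The open sets where \<open>p i\<close> exceeds \<open>1/(n+1)\<close> cover
  \<open>C\<close>. With \<open>p i\<close> the distance of two characters at an element, or the
  defect of a relation, a mere inequality becomes a finite test with a uniform margin.\<close>

lemma compact_finite_lower_bound:
  fixes p :: "'i \<Rightarrow> 'x::topological_space \<Rightarrow> real"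
  assumes C: "compact C" and p: "\<And>i. i \<in> I \<Longrightarrow> continuous_on UNIV (p i)"
    and pos: "\<And>x. x \<in> C \<Longrightarrow> \<exists>i\<in>I. 0 < p i x"
  obtains I0 \<epsilon> where "finite I0" "I0 \<subseteq> I" "0 < \<epsilon>" "\<And>x. x \<in> C \<Longrightarrow> \<exists>i\<in>I0. \<epsilon> \<le> p i x"
proof -
  define U where "U = (\<lambda>(i, n::nat). {x. 1 / real (Suc n) < p i x})"
  have 1: "open (U j)" if "j \<in> I \<times> UNIV" for j
    using that by (auto simp: U_def intro!: open_Collect_less continuous_intros p)
  have 2: "C \<subseteq> (\<Union>j\<in>I \<times> UNIV. U j)"
  proof
    fix x assume "x \<in> C"
    then obtain i where i: "i \<in> I" "0 < p i x" using pos by blast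
    then obtain n where "inverse (real (Suc n)) < p i x" using reals_Archimedean by blast
    then show "x \<in> (\<Union>j\<in>I \<times> UNIV. U j)"
      using i by (intro UN_I[of "(i, n)"]) (auto simp: U_def inverse_eq_divide)
  qed
  obtain D where D: "D \<subseteq> I \<times> UNIV" "finite D" "C \<subseteq> (\<Union>j\<in>D. U j)"
    using compactE_image[OF C 1 2] by metis
  \<comment> \<open>The inserted 1 provides for an empty \<open>D\<close>.\<close>
  define \<epsilon> where "\<epsilon> = Min (insert 1 ((\<lambda>j. 1 / real (Suc (snd j))) ` D))"
  have "0 < \<epsilon>" using D by (auto simp: \<epsilon>_def)
  moreover have "\<exists>i\<in>fst ` D. \<epsilon> \<le> p i x" if "x \<in> C" for x
  proof -
    from subsetD[OF D(3) that] obtain j where j: "j \<in> D" "x \<in> U j" by (rule UN_E)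
    have "\<epsilon> \<le> 1 / real (Suc (snd j))" using j D unfolding \<epsilon>_def by (intro Min_le) auto
    then show ?thesis using j by (intro bexI[of _ "fst j"]) (auto simp: U_def split: prod.splits)
  qed
  moreover have "finite (fst ` D)" "fst ` D \<subseteq> I" using D by auto
  ultimately show ?thesis using that[of "fst ` D" \<epsilon>] by blast
qed

section \<open>Characters of the free module that vanish on the relations\<close>

text \<open>Points of X_f as homomorphisms on the whole free module. Approximate solutions are
  homomorphisms there that do not factor through the quotient, so both kinds can be compared in one
  compact space.\<close>

definition annihilator :: "('g::group_add \<Rightarrow>\<^sub>0 int)^'n^'n \<Rightarrow> (('g \<Rightarrow>\<^sub>0 int)^'n \<Rightarrow> circle) set" where
  "annihilator f = {\<theta>. (\<forall>a b. \<theta> (a + b) = \<theta> a + \<theta> b) \<and> (\<forall>b. \<theta> (right_mult f b) = 0)}"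

definition coset_of :: "('g::group_add \<Rightarrow>\<^sub>0 int)^'n^'n \<Rightarrow> ('g \<Rightarrow>\<^sub>0 int)^'n \<Rightarrow> (('g \<Rightarrow>\<^sub>0 int)^'n) set" where
  "coset_of f a = (\<lambda>b. right_mult f b + a) ` UNIV"

text \<open>For \<theta> in \<open>annihilator f\<close> the choice of representative is harmless,
  as \<theta> is constant on cosets; this is \<open>descend_coset\<close>.\<close>

definition descend ::
    "('g::group_add \<Rightarrow>\<^sub>0 int)^'n^'n \<Rightarrow> (('g \<Rightarrow>\<^sub>0 int)^'n \<Rightarrow> circle) \<Rightarrow> (('g \<Rightarrow>\<^sub>0 int)^'n) set \<Rightarrow> circle" where
  "descend f \<theta> = (\<lambda>C\<in>carrier (module_quotient f). \<theta> (SOME a. a \<in> C))"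

lemma right_mult_add: "right_mult f (a + b) = right_mult f a + right_mult f b"
  by (simp add: right_mult_def vec_eq_iff sum.distrib distrib_right)

lemma right_mult_0: "right_mult f 0 = 0"
  by (simp add: right_mult_def vec_eq_iff)

lemma left_mult_add: "left_mult g (a + b) = left_mult g a + left_mult g b"
  by (simp add: left_mult_def vec_eq_iff distrib_left)

lemma left_mult_right_mult: "left_mult g (right_mult f b) = right_mult f (left_mult g b)"
  by (simp add: left_mult_def right_mult_def vec_eq_iff sum_distrib_left mult.assoc)

lemma left_mult_left_mult: "left_mult g (left_mult h b) = left_mult (g + h) b"
  by (simp add: left_mult_def vec_eq_iff mult.assoc[symmetric] mult_single)

lemma left_mult_0: "left_mult 0 b = b"
  by (simp add: left_mult_def vec_eq_iff)

lemma carrier_module_quotient: "carrier (module_quotient f) = range (coset_of f)"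
  by (auto simp: module_quotient_def FactGroup_def RCOSETS_def r_coset_def additive_group_def coset_of_def)

lemma mult_module_quotient: "coset_of f a \<otimes>\<^bsub>module_quotient f\<^esub> coset_of f b = coset_of f (a + b)"
proof -
  have "coset_of f a \<otimes>\<^bsub>module_quotient f\<^esub> coset_of f b = {x + y |x y. x \<in> coset_of f a \<and> y \<in> coset_of f b}"
    by (auto simp: module_quotient_def FactGroup_def set_mult_def additive_group_def)
  also have "\<dots> = coset_of f (a + b)"
  proof (intro equalityI subsetI)
    fix z assume "z \<in> {x + y |x y. x \<in> coset_of f a \<and> y \<in> coset_of f b}"
    then obtain c d where "z = (right_mult f c + a) + (right_mult f d + b)" by (auto simp: coset_of_def)
    then have "z = right_mult f (c + d) + (a + b)" by (simp add: right_mult_add algebra_simps)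
    then show "z \<in> coset_of f (a + b)" by (auto simp: coset_of_def)
  next
    fix z assume "z \<in> coset_of f (a + b)"
    then obtain c where "z = right_mult f c + (a + b)" by (auto simp: coset_of_def)
    then have "z = (right_mult f c + a) + (right_mult f 0 + b)" by (simp add: right_mult_0 algebra_simps)
    then show "z \<in> {x + y |x y. x \<in> coset_of f a \<and> y \<in> coset_of f b}" unfolding coset_of_def by blast
  qed
  finally show ?thesis .
qed

lemma descend_coset:
  assumes "\<theta> \<in> annihilator f"
  shows "descend f \<theta> (coset_of f a) = \<theta> a"
proof -
  have "a \<in> coset_of f a" by (auto simp: coset_of_def right_mult_0 intro!: image_eqI[of _ _ 0])
  then have "(SOME x. x \<in> coset_of f a) \<in> coset_of f a" by (rule someI)
  then obtain b where "(SOME x. x \<in> coset_of f a) = right_mult f b + a" by (auto simp: coset_of_def)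
  then show ?thesis using assms by (auto simp: descend_def carrier_module_quotient annihilator_def)
qed

lemma topspace_X_space:
  "topspace (X_space f) = {x \<in> hom (module_quotient f) additive_group. x \<in> extensional (carrier (module_quotient f))}"
  by (auto simp: X_space_def pontryagin_dual_def PiE_def)

lemma descend_in_X_space:
  assumes "\<theta> \<in> annihilator f"
  shows "descend f \<theta> \<in> topspace (X_space f)"
proof -
  have "descend f \<theta> \<in> hom (module_quotient f) additive_group"
  proof (rule homI)
    fix x y assume "x \<in> carrier (module_quotient f)" "y \<in> carrier (module_quotient f)"
    then obtain a b where "x = coset_of f a" "y = coset_of f b" by (auto simp: carrier_module_quotient)
    then show "descend f \<theta> (x \<otimes>\<^bsub>module_quotient f\<^esub> y) = descend f \<theta> x \<otimes>\<^bsub>additive_group\<^esub> descend f \<theta> y"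
      using assms by (simp add: mult_module_quotient descend_coset) (simp add: annihilator_def additive_group_def)
  qed (simp add: additive_group_def)
  then show ?thesis by (simp add: topspace_X_space) (simp add: descend_def)
qed

lemma X_space_descend:
  assumes "x \<in> topspace (X_space f)"
  obtains \<theta> where "\<theta> \<in> annihilator f" "x = descend f \<theta>"
proof -
  define \<theta> where "\<theta> a = x (coset_of f a)" for a
  have x: "x \<in> hom (module_quotient f) additive_group" "x \<in> extensional (carrier (module_quotient f))"
    using assms by (auto simp: topspace_X_space)
  have add: "\<theta> (a + b) = \<theta> a + \<theta> b" for a b
    using hom_mult[OF x(1), of "coset_of f a" "coset_of f b"]
    by (simp add: \<theta>_def mult_module_quotient carrier_module_quotient additive_group_def)
  have "\<theta> 0 = 0" using add[of 0 0] by simp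
  moreover have "coset_of f (right_mult f b) = coset_of f 0" for b
    unfolding coset_of_def
  proof (intro equalityI subsetI; clarsimp)
    show "right_mult f c + right_mult f b \<in> range (right_mult f)" for c
      by (simp flip: right_mult_add)
    have "right_mult f c = right_mult f (c - b) + right_mult f b" for c by (simp flip: right_mult_add)
    then show "right_mult f c \<in> range (\<lambda>c. right_mult f c + right_mult f b)" for c by blast
  qed
  ultimately have "\<theta> (right_mult f b) = 0" for b by (simp add: \<theta>_def)
  with add have t: "\<theta> \<in> annihilator f" by (simp add: annihilator_def)
  have "x = descend f \<theta>"
  proof (rule extensionalityI[OF x(2)])
    show "descend f \<theta> \<in> extensional (carrier (module_quotient f))" by (simp add: descend_def)
    show "x C = descend f \<theta> C" if "C \<in> carrier (module_quotient f)" for C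
      using that t by (auto simp: carrier_module_quotient descend_coset \<theta>_def)
  qed
  with t show ?thesis by (rule that)
qed

lemma annihilator_left_mult: "\<theta> \<in> annihilator f \<Longrightarrow> \<theta> \<circ> left_mult g \<in> annihilator f"
  by (simp add: annihilator_def left_mult_add left_mult_right_mult)

lemma X_action_descend:
  assumes "\<theta> \<in> annihilator f"
  shows "X_action f g (descend f \<theta>) = descend f (\<theta> \<circ> left_mult (- g))"
proof (rule extensionalityI)
  show "X_action f g (descend f \<theta>) \<in> extensional (carrier (module_quotient f))"
    "descend f (\<theta> \<circ> left_mult (- g)) \<in> extensional (carrier (module_quotient f))"
    by (simp_all add: X_action_def descend_def)
  fix C assume C: "C \<in> carrier (module_quotient f)"
  then obtain a where a: "C = coset_of f a" by (auto simp: carrier_module_quotient)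
  have "left_mult (- g) ` coset_of f a = coset_of f (left_mult (- g) a)"
  proof (intro equalityI subsetI)
    fix z assume "z \<in> coset_of f (left_mult (- g) a)"
    then obtain b where "z = right_mult f b + left_mult (- g) a" by (auto simp: coset_of_def)
    then have "z = left_mult (- g) (right_mult f (left_mult g b) + a)"
      by (simp add: left_mult_add left_mult_right_mult left_mult_left_mult left_mult_0)
    then show "z \<in> left_mult (- g) ` coset_of f a" by (auto simp: coset_of_def)
  qed (auto simp: coset_of_def left_mult_add left_mult_right_mult)
  then show "X_action f g (descend f \<theta>) C = descend f (\<theta> \<circ> left_mult (- g)) C"
    using C assms annihilator_left_mult[OF assms, of "- g"] by (simp add: X_action_def a descend_coset)
qed

section \<open>Compactness, and continuity of the passage to X_f\<close>

lemma closed_additive_maps: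
  "closed {\<theta> :: 'a::plus \<Rightarrow> circle. \<forall>a b. \<theta> (a + b) = \<theta> a + \<theta> b}"
proof -
  have "{\<theta> :: 'a \<Rightarrow> circle. \<forall>a b. \<theta> (a + b) = \<theta> a + \<theta> b}
      = (\<Inter>a. \<Inter>b. {\<theta>. circle_exp (\<theta> (a + b)) = circle_exp (\<theta> a) * circle_exp (\<theta> b)})"
    by (auto simp: circle_exp_eq_iff simp flip: circle_exp_add)
  also have "closed \<dots>"
    by (intro closed_INT ballI closed_Collect_eq continuous_on_mult continuous_on_circle_exp_eval)
  finally show ?thesis .
qed

lemma closed_annihilator: "closed (annihilator f)"
proof -
  have "annihilator f = {\<theta>. \<forall>a b. \<theta> (a + b) = \<theta> a + \<theta> b} \<inter> (\<Inter>b. {\<theta>. circle_exp (\<theta> (right_mult f b)) = 1})"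
    by (auto simp: annihilator_def circle_exp_eq_1_iff)
  also have "closed \<dots>"
    by (intro closed_Int closed_additive_maps closed_INT ballI closed_Collect_eq continuous_on_const continuous_on_circle_exp_eval)
  finally show ?thesis .
qed

lemma compact_annihilator: "compact (annihilator f)"
  using compact_Int_closed[OF compact_UNIV_circle_fun closed_annihilator] by simp

lemma continuous_map_descend: "continuous_map (top_of_set (annihilator f)) (X_space f) (descend f)"
  unfolding X_space_def pontryagin_dual_def
proof (rule continuous_map_into_subtopology)
  show "continuous_map (top_of_set (annihilator f))
      (product_topology (\<lambda>_. euclidean) (carrier (module_quotient f))) (descend f)"
    unfolding continuous_map_componentwise
  proof (intro conjI ballI)
    show "descend f ` topspace (top_of_set (annihilator f)) \<subseteq> extensional (carrier (module_quotient f))"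
      by (auto simp: descend_def)
    fix C assume "C \<in> carrier (module_quotient f)"
    then have "(\<lambda>\<theta>. descend f \<theta> C) = (\<lambda>\<theta>. \<theta> (SOME a. a \<in> C))" by (simp add: descend_def fun_eq_iff)
    then show "continuous_map (top_of_set (annihilator f)) euclidean (\<lambda>\<theta>. descend f \<theta> C)"
      using continuous_on_subset[OF continuous_on_product_coordinates] by auto
  qed
  show "descend f \<in> topspace (top_of_set (annihilator f)) \<rightarrow>
      {\<theta> \<in> hom (module_quotient f) additive_group. \<theta> \<in> extensional (carrier (module_quotient f)) \<and>
        continuous_map (discrete_topology (carrier (module_quotient f))) euclidean \<theta>}"
    using descend_in_X_space[of _ f] by (auto simp: topspace_X_space)
qed

lemma compact_annihilator_Times:
  "compact (annihilator f \<times> annihilator f)"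
  by (intro compact_Times compact_annihilator)

lemma continuous_on_pseudometric_descend:
  assumes "continuous_pseudometric (X_space f) \<rho>"
  shows "continuous_on (annihilator f \<times> annihilator f) (\<lambda>(\<theta>, \<theta>'). \<rho> (descend f \<theta>) (descend f \<theta>'))"
proof -
  have "continuous_map (prod_topology (top_of_set (annihilator f)) (top_of_set (annihilator f)))
      (prod_topology (X_space f) (X_space f)) (\<lambda>(\<theta>, \<theta>'). (descend f \<theta>, descend f \<theta>'))"
    by (intro continuous_map_prod_top[THEN iffD2] disjI2 conjI continuous_map_descend)
  then have "continuous_map (prod_topology (top_of_set (annihilator f)) (top_of_set (annihilator f)))
      euclideanreal ((\<lambda>(x, y). \<rho> x y) \<circ> (\<lambda>(\<theta>, \<theta>'). (descend f \<theta>, descend f \<theta>')))"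
    by (rule continuous_map_compose) (use assms in \<open>simp add: continuous_pseudometric_def\<close>)
  moreover have "prod_topology (top_of_set (annihilator f)) (top_of_set (annihilator f))
      = top_of_set (annihilator f \<times> annihilator f)"
    by (simp flip: subtopology_Times)
  ultimately show ?thesis by (simp add: comp_def case_prod_unfold)
qed

lemma pseudometric_bounded:
  assumes "continuous_pseudometric (X_space f) \<rho>"
  obtains C where "0 < C" "\<And>x y. x \<in> topspace (X_space f) \<Longrightarrow> y \<in> topspace (X_space f) \<Longrightarrow> \<rho> x y \<le> C"
proof -
  have "bounded ((\<lambda>(\<theta>, \<theta>'). \<rho> (descend f \<theta>) (descend f \<theta>')) ` (annihilator f \<times> annihilator f))"
    by (intro compact_imp_bounded compact_continuous_image continuous_on_pseudometric_descend assms
        compact_annihilator_Times)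
  then obtain C where C: "0 < C" "\<And>t. t \<in> (\<lambda>(\<theta>, \<theta>'). \<rho> (descend f \<theta>) (descend f \<theta>')) ` (annihilator f \<times> annihilator f) \<Longrightarrow> norm t \<le> C"
    unfolding bounded_pos by blast
  show ?thesis
  proof (rule that[OF C(1)])
    fix x y assume "x \<in> topspace (X_space f)" "y \<in> topspace (X_space f)"
    then obtain \<theta> \<theta>' where "\<theta> \<in> annihilator f" "x = descend f \<theta>" "\<theta>' \<in> annihilator f" "y = descend f \<theta>'"
      by (metis X_space_descend)
    then have "norm (\<rho> x y) \<le> C" by (intro C(2)) auto
    then show "\<rho> x y \<le> C" by simp
  qed
qed

text \<open>The pairs at \<rho>-distance at least \<delta> form a compact set off the diagonal, so
  finitely many evaluations separate the members of all these pairs by a uniform margin.\<close>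

lemma pseudometric_uniformly_continuous:
  fixes f :: "('g::group_add \<Rightarrow>\<^sub>0 int)^'n^'n"
  assumes \<rho>: "continuous_pseudometric (X_space f) \<rho>" and "0 < \<delta>"
  obtains K \<epsilon> where "finite K" "0 < \<epsilon>"
    "\<And>\<theta> \<theta>'. \<theta> \<in> annihilator f \<Longrightarrow> \<theta>' \<in> annihilator f \<Longrightarrow>
      (\<And>a. a \<in> K \<Longrightarrow> cmod (circle_exp (\<theta> a) - circle_exp (\<theta>' a)) < \<epsilon>) \<Longrightarrow>
      \<rho> (descend f \<theta>) (descend f \<theta>') < \<delta>"
proof -
  define P where "P = (\<lambda>(\<theta>, \<theta>'). \<rho> (descend f \<theta>) (descend f \<theta>'))"
  define C where "C = (annihilator f \<times> annihilator f) \<inter> P -` {\<delta>..}"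
  have cl: "closed (annihilator f \<times> annihilator f)" by (intro closed_Times closed_annihilator)
  have "closed C" unfolding C_def P_def
    by (intro continuous_closed_preimage continuous_on_pseudometric_descend \<rho> cl closed_atLeast)
  then have "compact ((annihilator f \<times> annihilator f) \<inter> C)"
    by (rule compact_Int_closed[OF compact_annihilator_Times])
  moreover have "(annihilator f \<times> annihilator f) \<inter> C = C" by (auto simp: C_def)
  ultimately have comp: "compact C" by simp
  have cont: "continuous_on UNIV (\<lambda>z. cmod (circle_exp (fst z a) - circle_exp (snd z a)))"
    for a :: "('g \<Rightarrow>\<^sub>0 int)^'n"
    by (intro continuous_intros continuous_on_compose2[OF continuous_on_circle_exp_eval]) auto
  have "\<exists>a\<in>UNIV. 0 < cmod (circle_exp (fst z a) - circle_exp (snd z a))" if "z \<in> C" for z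
  proof (rule ccontr)
    assume n: "\<not> ?thesis"
    obtain \<theta> \<theta>' where z: "z = (\<theta>, \<theta>')" by (cases z)
    have "\<theta> = \<theta>'" using n by (auto simp: z circle_exp_eq_iff)
    moreover have "\<theta> \<in> annihilator f" "\<delta> \<le> \<rho> (descend f \<theta>) (descend f \<theta>')" using that by (auto simp: C_def z P_def)
    ultimately show False
      using \<rho> \<open>0 < \<delta>\<close> descend_in_X_space[of \<theta> f] by (auto simp: continuous_pseudometric_def)
  qed
  from compact_finite_lower_bound[OF comp cont this]
  obtain K \<epsilon> where K: "finite K" "0 < \<epsilon>"
    "\<And>z. z \<in> C \<Longrightarrow> \<exists>a\<in>K. \<epsilon> \<le> cmod (circle_exp (fst z a) - circle_exp (snd z a))"
    by metis
  show ?thesis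
  proof (rule that[OF K(1,2)], rule ccontr)
    fix \<theta> \<theta>' assume t: "\<theta> \<in> annihilator f" "\<theta>' \<in> annihilator f"
      and close: "\<And>a. a \<in> K \<Longrightarrow> cmod (circle_exp (\<theta> a) - circle_exp (\<theta>' a)) < \<epsilon>"
      and "\<not> \<rho> (descend f \<theta>) (descend f \<theta>') < \<delta>"
    then have "(\<theta>, \<theta>') \<in> C" by (auto simp: C_def P_def)
    from K(3)[OF this] close show False by (auto simp: not_less[symmetric])
  qed
qed

text \<open>The characters sent outside \<open>V\<close> form a compact set without \<theta>, and
  finitely many evaluations keep that set away from \<theta>.\<close>

lemma X_space_neighbourhood:
  assumes V: "openin (X_space f) V" "descend f \<theta> \<in> V" and \<theta>: "\<theta> \<in> annihilator f"
  obtains K \<epsilon> where "finite K" "0 < \<epsilon>"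
    "\<And>\<theta>'. \<theta>' \<in> annihilator f \<Longrightarrow>
      (\<And>a. a \<in> K \<Longrightarrow> cmod (circle_exp (\<theta>' a) - circle_exp (\<theta> a)) < \<epsilon>) \<Longrightarrow> descend f \<theta>' \<in> V"
proof -
  have "openin (top_of_set (annihilator f)) {\<theta>' \<in> topspace (top_of_set (annihilator f)). descend f \<theta>' \<in> V}"
    by (rule openin_continuous_map_preimage[OF continuous_map_descend V(1)])
  then obtain W where W: "open W" "{\<theta>' \<in> annihilator f. descend f \<theta>' \<in> V} = annihilator f \<inter> W"
    unfolding openin_open by auto
  define C where "C = annihilator f \<inter> - W"
  have comp: "compact C" unfolding C_def using W(1)
    by (intro compact_Int_closed compact_annihilator) auto
  have cont: "continuous_on UNIV (\<lambda>\<theta>'. cmod (circle_exp (\<theta>' a) - circle_exp (\<theta> a)))" for a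
    by (intro continuous_intros continuous_on_circle_exp_eval)
  have "\<exists>a\<in>UNIV. 0 < cmod (circle_exp (\<theta>' a) - circle_exp (\<theta> a))" if "\<theta>' \<in> C" for \<theta>'
  proof (rule ccontr)
    assume "\<not> ?thesis"
    then have "\<theta>' = \<theta>" by (auto simp: circle_exp_eq_iff)
    moreover have "\<theta> \<in> W" using W(2) \<theta> V(2) by blast
    ultimately show False using that by (simp add: C_def)
  qed
  from compact_finite_lower_bound[OF comp cont this]
  obtain K \<epsilon> where K: "finite K" "0 < \<epsilon>"
    "\<And>\<theta>'. \<theta>' \<in> C \<Longrightarrow> \<exists>a\<in>K. \<epsilon> \<le> cmod (circle_exp (\<theta>' a) - circle_exp (\<theta> a))"
    by metis
  show ?thesis
  proof (rule that[OF K(1,2)], rule ccontr)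
    fix \<theta>' assume t: "\<theta>' \<in> annihilator f"
      and close: "\<And>a. a \<in> K \<Longrightarrow> cmod (circle_exp (\<theta>' a) - circle_exp (\<theta> a)) < \<epsilon>"
      and "descend f \<theta>' \<notin> V"
    then have "\<theta>' \<in> C" using W(2) by (auto simp: C_def)
    from K(3)[OF this] close show False by (auto simp: not_less[symmetric])
  qed
qed

section \<open>Stability of the relations\<close>

lemma additive_map_eq_0:
  fixes \<theta> :: "('g \<Rightarrow>\<^sub>0 int)^'n \<Rightarrow> 'c::ab_group_add"
  assumes add: "\<And>a b. \<theta> (a + b) = \<theta> a + \<theta> b"
    and gen: "\<And>l g. \<theta> (axis l (frag_of g)) = 0"
  shows "\<theta> b = 0"
proof -
  have t0: "\<theta> 0 = 0" using add[of 0 0] by simp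
  have diff: "\<theta> (a - b) = \<theta> a - \<theta> b" for a b using add[of "a - b" b] by (simp add: algebra_simps)
  have "\<theta> (axis l p) = 0" for l p
    using subset_UNIV[of "Poly_Mapping.keys p"]
  proof (induction p rule: frag_induction)
    case (diff a b)
    have "axis l (a - b) = axis l a - axis l b" by (simp add: vec_eq_iff axis_def)
    then show ?case using diff \<open>\<And>b a. \<theta> (a - b) = \<theta> a - \<theta> b\<close> by simp
  next
    case zero
    have "axis l 0 = (0 :: ('g \<Rightarrow>\<^sub>0 int)^'n)" by (simp add: vec_eq_iff axis_def)
    then show ?case using t0 by (simp only:)
  qed (use gen in auto)
  moreover have "\<theta> (\<Sum>l\<in>L. axis l (b $ l)) = (\<Sum>l\<in>L. \<theta> (axis l (b $ l)))" if "finite L" for L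
    using that by (induction L rule: finite_induct) (simp_all add: t0 add)
  moreover have "b = (\<Sum>l\<in>UNIV. axis l (b $ l))"
    by (simp add: vec_eq_iff axis_def if_distrib[of "\<lambda>v. v $ _"] cong: if_cong)
  ultimately show ?thesis by (metis (no_types, lifting) finite sum.neutral)
qed

text \<open>Compactness in place of a quantitative estimate: a homomorphism that is \<epsilon>-far
  on \<open>K0\<close> from every member of \<open>annihilator f\<close> violates the relation of
  some generator, as otherwise it would be a member itself. Finiteness of \<open>K0\<close> makes
  the set \<open>C\<close> of such homomorphisms closed.\<close>

lemma almost_annihilating_near_annihilator:
  fixes f :: "('g::group_add \<Rightarrow>\<^sub>0 int)^'n^'n"
  assumes "finite K0" "0 < \<epsilon>"
  obtains R \<epsilon>' where "finite R" "0 < \<epsilon>'"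
    "\<And>\<theta>. (\<And>a b. \<theta> (a + b) = \<theta> a + \<theta> b) \<Longrightarrow>
      (\<And>l g. (l, g) \<in> R \<Longrightarrow> cmod (circle_exp (\<theta> (right_mult f (axis l (frag_of g)))) - 1) < \<epsilon>') \<Longrightarrow>
      \<exists>\<theta>'\<in>annihilator f. \<forall>a\<in>K0. cmod (circle_exp (\<theta> a) - circle_exp (\<theta>' a)) < \<epsilon>"
proof -
  define C where "C = {\<theta> :: ('g \<Rightarrow>\<^sub>0 int)^'n \<Rightarrow> circle. \<forall>a b. \<theta> (a + b) = \<theta> a + \<theta> b} \<inter>
    (\<Inter>\<theta>'\<in>annihilator f. \<Union>a\<in>K0. {\<theta>. \<epsilon> \<le> cmod (circle_exp (\<theta> a) - circle_exp (\<theta>' a))})"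
  have "closed C" unfolding C_def
    by (intro closed_Int closed_additive_maps closed_INT ballI closed_UN assms closed_Collect_le
        continuous_intros continuous_on_circle_exp_eval)
  then have comp: "compact C" using compact_Int_closed[OF compact_UNIV_circle_fun] by simp
  define p where "p = (\<lambda>(l, g) (\<theta> :: ('g \<Rightarrow>\<^sub>0 int)^'n \<Rightarrow> circle).
    cmod (circle_exp (\<theta> (right_mult f (axis l (frag_of g)))) - 1))"
  have cont: "continuous_on UNIV (p i)" for i
    unfolding p_def case_prod_unfold by (intro continuous_intros continuous_on_circle_exp_eval)
  have "\<exists>i\<in>UNIV. 0 < p i \<theta>" if "\<theta> \<in> C" for \<theta>
  proof (rule ccontr)
    assume n: "\<not> ?thesis"
    have add: "\<theta> (a + b) = \<theta> a + \<theta> b" for a b using that by (simp add: C_def)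
    have "circle_exp (\<theta> (right_mult f (axis l (frag_of g)))) = 1" for l g
      using n by (auto simp: p_def)
    then have "\<theta> (right_mult f b) = 0" for b
      using additive_map_eq_0[of "\<lambda>b. \<theta> (right_mult f b)" b]
      by (simp add: right_mult_add add circle_exp_eq_1_iff)
    then have "\<theta> \<in> annihilator f" using add by (simp add: annihilator_def)
    then show False using that \<open>0 < \<epsilon>\<close> by (auto simp: C_def)
  qed
  from compact_finite_lower_bound[OF comp cont this]
  obtain R \<epsilon>' where R: "finite R" "0 < \<epsilon>'" "\<And>\<theta>. \<theta> \<in> C \<Longrightarrow> \<exists>i\<in>R. \<epsilon>' \<le> p i \<theta>"
    by metis
  show ?thesis
  proof (rule that[OF R(1,2)], rule ccontr)
    fix \<theta> :: "('g \<Rightarrow>\<^sub>0 int)^'n \<Rightarrow> circle"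
    assume "\<And>a b. \<theta> (a + b) = \<theta> a + \<theta> b"
      and small: "\<And>l g. (l, g) \<in> R \<Longrightarrow> cmod (circle_exp (\<theta> (right_mult f (axis l (frag_of g)))) - 1) < \<epsilon>'"
      and "\<not> (\<exists>\<theta>'\<in>annihilator f. \<forall>a\<in>K0. cmod (circle_exp (\<theta> a) - circle_exp (\<theta>' a)) < \<epsilon>)"
    then have "\<theta> \<in> C" by (force simp: C_def not_less)
    from R(3)[OF this] small show False by (force simp: p_def not_less[symmetric])
  qed
qed

section \<open>Homoclinic points\<close>

abbreviation supp :: "('a \<Rightarrow>\<^sub>0 'b::zero) \<Rightarrow> 'a set" where
  "supp \<equiv> Poly_Mapping.keys"

abbreviation coef :: "('a \<Rightarrow>\<^sub>0 'b::zero) \<Rightarrow> 'a \<Rightarrow> 'b" where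
  "coef \<equiv> Poly_Mapping.lookup"

text \<open>A real lift of a character value: if \<open>\<Psi> m h\<close> lifts the value on the
  basis vector \<open>axis m (frag_of h)\<close>, then \<open>pairing a \<Psi>\<close> lifts the
  value on \<open>a\<close>.\<close>

definition pairing :: "('g \<Rightarrow>\<^sub>0 int)^'n \<Rightarrow> ('n \<Rightarrow> 'g \<Rightarrow> real) \<Rightarrow> real" where
  "pairing a \<Psi> = (\<Sum>m\<in>UNIV. \<Sum>h\<in>supp (a $ m). of_int (coef (a $ m) h) * \<Psi> m h)"

text \<open>Left multiplication of the column \<xi> by \<open>f\<close>. With
  \<open>\<Psi> m h = \<xi> m (- h)\<close>, pairing the relation
  \<open>right_mult f (axis l (frag_of g))\<close> with \<Psi> gives
  \<open>conv f \<xi> l (- g)\<close>. This is why homoclinic points are paired through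
  \<open>\<lambda>m g. \<Xi> w m (- g)\<close>, and why integrality of
  \<open>conv f (\<Xi> w)\<close> yields a point of X_f.\<close>

definition conv :: "('g::group_add \<Rightarrow>\<^sub>0 int)^'n^'n \<Rightarrow> ('n \<Rightarrow> 'g \<Rightarrow> real) \<Rightarrow> 'n \<Rightarrow> 'g \<Rightarrow> real" where
  "conv f \<xi> l \<gamma> = (\<Sum>m\<in>UNIV. \<Sum>h\<in>supp (f $ l $ m).
     of_int (coef (f $ l $ m) h) * \<xi> m (- h + \<gamma>))"

lemma sum_keys_superset:
  assumes "finite A" "supp p \<subseteq> A"
  shows "(\<Sum>h\<in>supp p. of_int (coef p h) * u h)
    = (\<Sum>h\<in>A. of_int (coef p h) * (u h :: real))"
  using assms by (intro sum.mono_neutral_left) (auto simp: in_keys_iff)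

lemma pairing_add: "pairing (a + b) \<Psi> = pairing a \<Psi> + pairing b \<Psi>"
  unfolding pairing_def sum.distrib[symmetric]
proof (intro sum.cong refl)
  fix m
  define A where "A = supp (a $ m) \<union> supp (b $ m)"
  have A: "finite A" "supp (a $ m) \<subseteq> A" "supp (b $ m) \<subseteq> A"
    "supp ((a + b) $ m) \<subseteq> A"
    using keys_add[of "a $ m" "b $ m"] by (auto simp: A_def)
  show "(\<Sum>h\<in>supp ((a + b) $ m). of_int (coef ((a + b) $ m) h) * \<Psi> m h)
    = (\<Sum>h\<in>supp (a $ m). of_int (coef (a $ m) h) * \<Psi> m h)
    + (\<Sum>h\<in>supp (b $ m). of_int (coef (b $ m) h) * \<Psi> m h)"
    unfolding sum_keys_superset[OF A(1,2)] sum_keys_superset[OF A(1,3)] sum_keys_superset[OF A(1,4)]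
    by (simp add: lookup_add distrib_right sum.distrib)
qed

lemma pairing_cong:
  "(\<And>m h. h \<in> supp (a $ m) \<Longrightarrow> \<Psi> m h = \<Phi> m h) \<Longrightarrow> pairing a \<Psi> = pairing a \<Phi>"
  unfolding pairing_def by (intro sum.cong refl) auto

lemma lookup_single_1_mult:
  fixes p :: "'g::group_add \<Rightarrow>\<^sub>0 int"
  shows "coef (frag_of x * p) k = coef p (- x + k)"
proof -
  have e: "(k = l + q) = (q = - l + k)" for l q :: 'g
    by (metis add.assoc add_minus_cancel minus_add_cancel)
  have "coef (frag_of x * p) k
      = (\<Sum>l. coef (frag_of x) l * coef p (- l + k))"
    by (simp add: lookup_mult e)
  also have "\<dots> = (\<Sum>l. (coef p (- l + k) when l = x))"
    by (rule Sum_any.cong) (auto simp: lookup_single when_def)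
  also have "\<dots> = coef p (- x + k)" by simp
  finally show ?thesis .
qed

lemma keys_single_1_mult:
  fixes p :: "'g::group_add \<Rightarrow>\<^sub>0 int"
  shows "supp (frag_of x * p) = (+) x ` supp p"
proof (intro equalityI subsetI)
  fix k assume "k \<in> supp (frag_of x * p)"
  then have "- x + k \<in> supp p" by (simp add: in_keys_iff lookup_single_1_mult)
  then show "k \<in> (+) x ` supp p" by (intro image_eqI[of _ _ "- x + k"]) (simp_all flip: add.assoc)
qed (auto simp: in_keys_iff lookup_single_1_mult simp flip: add.assoc)

lemma sum_keys_single_1_mult:
  fixes p :: "'g::group_add \<Rightarrow>\<^sub>0 int"
  shows "(\<Sum>h\<in>supp (frag_of x * p).
      of_int (coef (frag_of x * p) h) * u h)
    = (\<Sum>h\<in>supp p. of_int (coef p h) * (u (x + h) :: real))"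
  unfolding keys_single_1_mult by (subst sum.reindex) (auto simp: lookup_single_1_mult simp flip: add.assoc)

lemma pairing_left_mult: "pairing (left_mult g a) \<Psi> = pairing a (\<lambda>m h. \<Psi> m (g + h))"
  by (simp add: pairing_def left_mult_def sum_keys_single_1_mult)

lemma right_mult_axis: "right_mult f (axis l p) $ m = p * f $ l $ m"
  by (simp add: right_mult_def axis_def if_distrib[of "\<lambda>v. v * _"] cong: if_cong)

lemma pairing_right_mult_axis:
  fixes f :: "('g::group_add \<Rightarrow>\<^sub>0 int)^'n^'n"
  shows "pairing (right_mult f (axis l (frag_of g))) \<Psi>
    = (\<Sum>m\<in>UNIV. \<Sum>h\<in>supp (f $ l $ m). of_int (coef (f $ l $ m) h) * \<Psi> m (g + h))"
  by (simp add: pairing_def right_mult_axis sum_keys_single_1_mult)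

lemma lookup_mult_eq_sum_keys:
  fixes p q :: "'g::group_add \<Rightarrow>\<^sub>0 int"
  shows "coef (p * q) k
    = (\<Sum>h\<in>supp q. coef p (k - h) * coef q h)"
  using subset_UNIV[of "supp p"]
proof (induction p rule: frag_induction)
  case (one x)
  have "(\<Sum>h\<in>supp q. coef (frag_of x) (k - h) * coef q h)
      = (\<Sum>h\<in>supp q. if h = - x + k then coef q h else 0)"
  proof (intro sum.cong refl)
    fix h
    have "(k - h = x) = (h = - x + k)"
      by (metis add_diff_cancel diff_add_cancel minus_add_cancel add_minus_cancel)
    then show "coef (frag_of x) (k - h) * coef q h
        = (if h = - x + k then coef q h else 0)" by simp
  qed
  then show ?case by (simp add: lookup_single_1_mult in_keys_iff)
next
  case (diff a b)
  then show ?case by (simp add: left_diff_distrib lookup_minus sum_subtractf)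
qed simp

section \<open>Integral vectors in \<open>ell2\<close> and operators of the group ring\<close>

lift_definition embed_ell2 :: "('a \<Rightarrow>\<^sub>0 int) \<Rightarrow> 'a ell2" is "\<lambda>p x. of_int (coef p x)"
proof -
  fix p :: "'a \<Rightarrow>\<^sub>0 int"
  have "(\<lambda>x. (cmod (of_int (coef p x)))\<^sup>2) summable_on supp p"
    by (rule summable_on_finite) simp
  then show "(\<lambda>x. (cmod (of_int (coef p x)))\<^sup>2) summable_on UNIV"
    by (rule summable_on_cong_neutral[THEN iffD1, rotated -1]) (auto simp: in_keys_iff)
qed

lemma embed_ell2_add: "embed_ell2 (p + q) = embed_ell2 p + embed_ell2 q"
  by transfer (simp add: lookup_add fun_eq_iff)

lemma ell2_apply_sum: "ell2_apply (\<Sum>i\<in>I. F i) x = (\<Sum>i\<in>I. ell2_apply (F i) x)"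
  by (induction I rule: infinite_finite_induct) (simp_all add: zero_ell2.rep_eq plus_ell2.rep_eq)

lemma ell2_eqI: "(\<And>x. ell2_apply \<xi> x = ell2_apply \<eta> x) \<Longrightarrow> \<xi> = \<eta>"
  by (simp add: ell2_apply_inject[symmetric] fun_eq_iff)

lemma norm_ell2_apply_le: "cmod (ell2_apply \<xi> x) \<le> norm \<xi>"
proof -
  have s: "(\<lambda>x. (cmod (ell2_apply \<xi> x))\<^sup>2) summable_on UNIV" using ell2_apply[of \<xi>] by simp
  have "(\<Sum>\<^sub>\<infinity>x\<in>{x}. (cmod (ell2_apply \<xi> x))\<^sup>2) \<le> (\<Sum>\<^sub>\<infinity>x. (cmod (ell2_apply \<xi> x))\<^sup>2)"
    by (rule infsum_mono_neutral) (use s in auto)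
  then show ?thesis unfolding norm_ell2_eq by (intro real_le_rsqrt) simp
qed

lemma bounded_linear_Re_ell2_apply: "bounded_linear (\<lambda>\<xi>. Re (ell2_apply \<xi> x))"
proof (rule bounded_linear_intro)
  show "norm (Re (ell2_apply \<xi> x)) \<le> norm \<xi> * 1" for \<xi>
    using norm_ell2_apply_le[of \<xi> x] abs_Re_le_cmod[of "ell2_apply \<xi> x"] by simp
qed (simp_all add: plus_ell2.rep_eq scaleR_ell2.rep_eq)

lemma lookup_map_of_int:
  "coef (Poly_Mapping.map of_int (p :: 'a \<Rightarrow>\<^sub>0 int)) k = (of_int (coef p k) :: complex)"
  by (simp add: Poly_Mapping.map.rep_eq when_def)

lemma keys_map_of_int:
  "supp (Poly_Mapping.map of_int (p :: 'a \<Rightarrow>\<^sub>0 int) :: 'a \<Rightarrow>\<^sub>0 complex) = supp p"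
  by (auto simp: in_keys_iff lookup_map_of_int)

lemma ell2_apply_group_ring_op:
  fixes p :: "'g::group_add \<Rightarrow>\<^sub>0 int"
  shows "ell2_apply (blinfun_apply (group_ring_op (Poly_Mapping.map of_int p)) \<xi>) \<gamma>
    = (\<Sum>h\<in>supp p. of_int (coef p h) * ell2_apply \<xi> (- h + \<gamma>))"
  by (simp add: group_ring_op.rep_eq ell2_apply_sum ell2_scaleC.rep_eq left_translate.rep_eq
      lookup_map_of_int keys_map_of_int)

lemma group_ring_op_embed_single:
  fixes p :: "'g::group_add \<Rightarrow>\<^sub>0 int"
  shows "blinfun_apply (group_ring_op (Poly_Mapping.map of_int p)) (embed_ell2 (frag_of g))
    = (\<Sum>h\<in>supp p. of_int (coef p h) *\<^sub>R embed_ell2 (frag_of (h + g)))"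
proof (rule ell2_eqI)
  fix \<gamma>
  have e: "(- h + \<gamma> = g) = (\<gamma> = h + g)" for h by (metis add_minus_cancel minus_add_cancel)
  show "ell2_apply (blinfun_apply (group_ring_op (Poly_Mapping.map of_int p)) (embed_ell2 (frag_of g))) \<gamma>
    = ell2_apply (\<Sum>h\<in>supp p. of_int (coef p h) *\<^sub>R embed_ell2 (frag_of (h + g))) \<gamma>"
    unfolding ell2_apply_group_ring_op ell2_apply_sum
    by (intro sum.cong refl) (simp add: embed_ell2.rep_eq scaleR_ell2.rep_eq scaleR_conv_of_real e)
qed

lemma norm_sum_embed_single:
  assumes "finite H"
  shows "(norm (\<Sum>h\<in>H. c h *\<^sub>R embed_ell2 (frag_of (- h :: 'g::group_add))))\<^sup>2 = (\<Sum>h\<in>H. (c h)\<^sup>2)"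
proof -
  define \<xi> where "\<xi> = (\<Sum>h\<in>H. c h *\<^sub>R embed_ell2 (frag_of (- h)))"
  have ap: "ell2_apply \<xi> x = (if - x \<in> H then of_real (c (- x)) else 0)" for x
  proof -
    have "ell2_apply \<xi> x = (\<Sum>h\<in>H. if h = - x then of_real (c h) else 0)"
      unfolding \<xi>_def ell2_apply_sum
      by (intro sum.cong refl) (auto simp: scaleR_ell2.rep_eq embed_ell2.rep_eq scaleR_conv_of_real)
    then show ?thesis using assms by simp
  qed
  have "(norm \<xi>)\<^sup>2 = (\<Sum>\<^sub>\<infinity>x. (cmod (ell2_apply \<xi> x))\<^sup>2)"
    unfolding norm_ell2_eq by (simp add: infsum_nonneg)
  also have "\<dots> = (\<Sum>\<^sub>\<infinity>x\<in>uminus ` H. (cmod (ell2_apply \<xi> x))\<^sup>2)"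
  proof (rule infsum_cong_neutral)
    fix x assume "x \<in> UNIV - uminus ` H"
    then have "- x \<notin> H" by (metis DiffD2 image_eqI minus_minus)
    then show "(cmod (ell2_apply \<xi> x))\<^sup>2 = 0" by (simp add: ap)
  qed auto
  also have "\<dots> = (\<Sum>x\<in>uminus ` H. (cmod (ell2_apply \<xi> x))\<^sup>2)" using assms by (intro infsum_finite) auto
  also have "\<dots> = (\<Sum>h\<in>H. (c h)\<^sup>2)" by (subst sum.reindex) (auto simp: ap)
  finally show ?thesis by (simp add: \<xi>_def)
qed

text \<open>By Bessel's inequality the squares of the coefficients have a bounded sum, and every
  nonzero integer contributes at least 1. The index \<open>- h\<close> matches the inversion in the
  pairing with homoclinic points.\<close>

lemma finite_integral_coefficients:
  fixes L :: "'g::group_add ell2 \<Rightarrow> real"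
  assumes L: "bounded_linear L" and int: "\<And>h. L (embed_ell2 (frag_of (- h))) \<in> \<int>"
  shows "finite {h. L (embed_ell2 (frag_of (- h))) \<noteq> 0}"
proof -
  define b where "b h = L (embed_ell2 (frag_of (- h)))" for h
  obtain C where C: "0 < C" "\<And>\<omega>. norm (L \<omega>) \<le> norm \<omega> * C"
    using bounded_linear.pos_bounded[OF L] by blast
  have "card H \<le> nat \<lceil>C\<^sup>2\<rceil>" if H: "H \<subseteq> {h. b h \<noteq> 0}" "finite H" for H
  proof -
    define s where "s = (\<Sum>h\<in>H. (b h)\<^sup>2)"
    define \<omega> where "\<omega> = (\<Sum>h\<in>H. b h *\<^sub>R embed_ell2 (frag_of (- h)))"
    have s0: "0 \<le> s" by (simp add: s_def sum_nonneg)
    have "L \<omega> = s"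
      unfolding \<omega>_def s_def using L
      by (simp add: linear_sum[OF bounded_linear.linear] linear_cmul[OF bounded_linear.linear] b_def power2_eq_square)
    moreover have "norm \<omega> = sqrt s"
      using norm_sum_embed_single[OF H(2), of b] unfolding \<omega>_def s_def by (intro real_sqrt_unique[symmetric]) auto
    ultimately have "s \<le> sqrt s * C" using C(2)[of \<omega>] by simp
    then have *: "sqrt s * sqrt s \<le> sqrt s * C" using s0 by simp
    have "sqrt s \<le> C"
    proof (cases "s = 0")
      case False
      then have "0 < sqrt s" using s0 by simp
      with * show ?thesis by (rule mult_left_le_imp_le)
    qed (use C in simp)
    then have "(sqrt s)\<^sup>2 \<le> C\<^sup>2" using s0 by (intro power_mono) auto
    then have "s \<le> C\<^sup>2" using s0 by simp
    moreover have "real (card H) \<le> s"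
    proof -
      have "1 \<le> (b h)\<^sup>2" if "h \<in> H" for h
      proof -
        have "b h \<in> \<int>" "b h \<noteq> 0" using int that H by (auto simp: b_def)
        then have "1 \<le> \<bar>b h\<bar>" by (rule Ints_nonzero_abs_ge1)
        then show ?thesis using one_le_power[of "\<bar>b h\<bar>" 2] by simp
      qed
      then have "(\<Sum>h\<in>H. 1) \<le> s" unfolding s_def by (intro sum_mono) auto
      then show ?thesis by simp
    qed
    ultimately have "real (card H) \<le> C\<^sup>2" by linarith
    then show ?thesis by linarith
  qed
  then have "finite {h. b h \<noteq> 0}"
    using finite_if_finite_subsets_card_bdd[of "{h. b h \<noteq> 0}" "nat \<lceil>C\<^sup>2\<rceil>"] by blast
  then show ?thesis by (simp add: b_def)
qed


text \<open>The last property makes the homoclinic points \<open>\<Xi> w = f\<inverse> w\<close> dense in \<open>X\<^sub>f\<close>: an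
  element \<open>a\<close> that they all annihilate lies in the range of \<open>right_mult f\<close>, because the functional
  \<open>w \<mapsto> \<langle>a, f\<inverse> w\<rangle>\<close> is bounded on \<open>\<ell>\<^sup>2\<close> and integral on unit vectors, hence finitely supported.\<close>

lemma homoclinic_points:
  fixes f :: "('g::group_add \<Rightarrow>\<^sub>0 int)^'n^'n"
  assumes "op_matrix_of f \<in> vN_GL"
  obtains \<Xi> :: "('g \<Rightarrow>\<^sub>0 int)^'n \<Rightarrow> 'n \<Rightarrow> 'g \<Rightarrow> real" where
    "\<And>v w m \<gamma>. \<Xi> (v + w) m \<gamma> = \<Xi> v m \<gamma> + \<Xi> w m \<gamma>"
    "\<And>w l \<gamma>. conv f (\<Xi> w) l \<gamma> = of_int (coef (w $ l) \<gamma>)"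
    "\<And>w m. (\<lambda>\<gamma>. (\<Xi> w m \<gamma>)\<^sup>2) summable_on UNIV"
    "\<And>a. (\<And>w. pairing a (\<lambda>m g. \<Xi> w m (- g)) \<in> \<int>) \<Longrightarrow> \<exists>b. a = right_mult f b"
proof -
  define A where "A = op_matrix_of f"
  obtain B where AB: "op_matrix_mult A B = op_matrix_one" and BA: "op_matrix_mult B A = op_matrix_one"
    using assms by (auto simp: vN_GL_def A_def)
  have A_eq: "A $ l $ m = group_ring_op (Poly_Mapping.map of_int (f $ l $ m))" for l m
    by (simp add: A_def op_matrix_of_def)
  have mult_apply: "(\<Sum>k\<in>UNIV. blinfun_apply (P $ i $ k) (blinfun_apply (Q $ k $ j) \<xi>)) = (if i = j then \<xi> else 0)"
    if "op_matrix_mult P Q = op_matrix_one" for P Q :: "('g ell2 \<Rightarrow>\<^sub>L 'g ell2)^'n^'n" and i j \<xi>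
  proof -
    have "(\<Sum>k\<in>UNIV. P $ i $ k o\<^sub>L Q $ k $ j) = (if i = j then id_blinfun else 0)"
      using arg_cong[OF that, of "\<lambda>C. C $ i $ j"] by (simp add: op_matrix_mult_def op_matrix_one_def)
    from arg_cong[OF this, of "\<lambda>T. blinfun_apply T \<xi>"] show ?thesis
      by (simp add: blinfun.sum_left split: if_splits)
  qed
  define \<omega> where "\<omega> w m = (\<Sum>l\<in>UNIV. blinfun_apply (B $ m $ l) (embed_ell2 (w $ l)))" for w :: "('g \<Rightarrow>\<^sub>0 int)^'n" and m
  \<comment> \<open>Real parts may be taken because \<open>f\<close> has integer coefficients, so
    that \<open>conv f\<close> commutes with \<open>Re\<close>.\<close>
  define \<Xi> where "\<Xi> w m \<gamma> = Re (ell2_apply (\<omega> w m) \<gamma>)" for w m \<gamma>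
  have \<omega>_add: "\<omega> (v + w) m = \<omega> v m + \<omega> w m" for v w m
    by (simp add: \<omega>_def embed_ell2_add blinfun.add_right sum.distrib)
  have A\<omega>: "(\<Sum>m\<in>UNIV. blinfun_apply (A $ l $ m) (\<omega> w m)) = embed_ell2 (w $ l)" for w l
  proof -
    have "(\<Sum>m\<in>UNIV. blinfun_apply (A $ l $ m) (\<omega> w m))
        = (\<Sum>m\<in>UNIV. \<Sum>k\<in>UNIV. blinfun_apply (A $ l $ m) (blinfun_apply (B $ m $ k) (embed_ell2 (w $ k))))"
      by (simp add: \<omega>_def blinfun.sum_right)
    also have "\<dots> = (\<Sum>k\<in>UNIV. \<Sum>m\<in>UNIV. blinfun_apply (A $ l $ m) (blinfun_apply (B $ m $ k) (embed_ell2 (w $ k))))"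
      by (rule sum.swap)
    also have "\<dots> = embed_ell2 (w $ l)" by (simp add: mult_apply[OF AB])
    finally show ?thesis .
  qed
  show ?thesis
  proof (rule that[of \<Xi>])
    show "\<Xi> (v + w) m \<gamma> = \<Xi> v m \<gamma> + \<Xi> w m \<gamma>" for v w m \<gamma>
      by (simp add: \<Xi>_def \<omega>_add plus_ell2.rep_eq)
    show "(\<lambda>\<gamma>. (\<Xi> w m \<gamma>)\<^sup>2) summable_on UNIV" for w m
    proof (rule summable_on_comparison_test)
      show "(\<lambda>\<gamma>. (cmod (ell2_apply (\<omega> w m) \<gamma>))\<^sup>2) summable_on UNIV" using ell2_apply[of "\<omega> w m"] by simp
      show "(\<Xi> w m \<gamma>)\<^sup>2 \<le> (cmod (ell2_apply (\<omega> w m) \<gamma>))\<^sup>2" for \<gamma>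
        unfolding \<Xi>_def by (simp add: cmod_power2)
    qed simp
    show "conv f (\<Xi> w) l \<gamma> = of_int (coef (w $ l) \<gamma>)" for w l \<gamma>
    proof -
      have "conv f (\<Xi> w) l \<gamma> = Re (ell2_apply (\<Sum>m\<in>UNIV. blinfun_apply (A $ l $ m) (\<omega> w m)) \<gamma>)"
        by (simp add: conv_def \<Xi>_def A_eq ell2_apply_sum ell2_apply_group_ring_op)
      then show ?thesis by (simp add: A\<omega> embed_ell2.rep_eq)
    qed
    fix a assume int: "\<And>w. pairing a (\<lambda>m g. \<Xi> w m (- g)) \<in> \<int>"
    \<comment> \<open>The bounded functional that places \<eta> in coordinate \<open>l\<close>,
      applies \<open>B\<close>, and pairs the real part with \<open>a\<close> at inverse
      positions.\<close>
    define L where "L l \<eta> = (\<Sum>m\<in>UNIV. \<Sum>h\<in>supp (a $ m). of_int (coef (a $ m) h) *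
      Re (ell2_apply (blinfun_apply (B $ m $ l) \<eta>) (- h)))" for l \<eta>
    have L: "bounded_linear (L l)" for l
      unfolding L_def
      by (intro bounded_linear_sum bounded_linear_const_mult
          bounded_linear_compose[OF bounded_linear_Re_ell2_apply] blinfun.bounded_linear_right)
    have L_int: "L l (embed_ell2 (frag_of (- h))) \<in> \<int>" for l h
    proof -
      have "embed_ell2 (axis l p $ k) = (if k = l then embed_ell2 p else 0)" for p :: "'g \<Rightarrow>\<^sub>0 int" and k
        by (rule ell2_eqI) (simp add: embed_ell2.rep_eq axis_def zero_ell2.rep_eq)
      then have "\<omega> (axis l (frag_of (- h))) m = blinfun_apply (B $ m $ l) (embed_ell2 (frag_of (- h)))" for m
        unfolding \<omega>_def by (simp add: if_distrib[of "blinfun_apply _"] cong: if_cong)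
      then have "L l (embed_ell2 (frag_of (- h)))
          = pairing a (\<lambda>m g. \<Xi> (axis l (frag_of (- h))) m (- g))"
        by (simp add: L_def pairing_def \<Xi>_def)
      then show ?thesis using int by simp
    qed
    \<comment> \<open>The candidate for a f^-1. The floor changes nothing, as the values are
      integers, and finiteness of the support makes \<open>Abs_poly_mapping\<close>
      meaningful.\<close>
    define b where "b = (\<chi> l. Abs_poly_mapping (\<lambda>h. \<lfloor>L l (embed_ell2 (frag_of (- h)))\<rfloor>))"
    have b: "of_int (coef (b $ l) h) = L l (embed_ell2 (frag_of (- h)))" for l h
    proof -
      have "finite {h. \<lfloor>L l (embed_ell2 (frag_of (- h)))\<rfloor> \<noteq> 0}"
        by (rule finite_subset[OF _ finite_integral_coefficients[of "L l", OF L L_int]]) auto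
      then show ?thesis using L_int[of l h] by (simp add: b_def)
    qed
    \<comment> \<open>The coefficient of b f at \<open>g\<close> is the pairing of \<open>a\<close>
      with B A applied to the unit vector at \<open>- g\<close> in coordinate \<open>m\<close>, so B
      A = 1 returns \<open>a\<close>. The other identity, A B = 1, has given the integrality of
      \<open>conv f (\<Xi> w)\<close>.\<close>
    have "coef (right_mult f b $ m) g = coef (a $ m) g" for m g
    proof -
      have "of_int (coef (right_mult f b $ m) g)
          = (\<Sum>l\<in>UNIV. \<Sum>h\<in>supp (f $ l $ m). L l (embed_ell2 (frag_of (h + - g))) *
              of_int (coef (f $ l $ m) h))"
        by (simp add: right_mult_def lookup_sum lookup_mult_eq_sum_keys b)
      also have "\<dots> = (\<Sum>l\<in>UNIV. L l (blinfun_apply (A $ l $ m) (embed_ell2 (frag_of (- g)))))"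
        unfolding A_eq group_ring_op_embed_single
        by (simp add: linear_sum[OF bounded_linear.linear[OF L]] linear_cmul[OF bounded_linear.linear[OF L]] mult.commute)
      also have "\<dots> = (\<Sum>l\<in>UNIV. \<Sum>k\<in>UNIV. \<Sum>h\<in>supp (a $ k). of_int (coef (a $ k) h) *
          Re (ell2_apply (blinfun_apply (B $ k $ l) (blinfun_apply (A $ l $ m) (embed_ell2 (frag_of (- g))))) (- h)))"
        by (simp add: L_def)
      also have "\<dots> = (\<Sum>k\<in>UNIV. \<Sum>h\<in>supp (a $ k). \<Sum>l\<in>UNIV. of_int (coef (a $ k) h) *
          Re (ell2_apply (blinfun_apply (B $ k $ l) (blinfun_apply (A $ l $ m) (embed_ell2 (frag_of (- g))))) (- h)))"
        by (subst sum.swap) (intro sum.cong refl sum.swap)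
      also have "\<dots> = (\<Sum>k\<in>UNIV. \<Sum>h\<in>supp (a $ k). of_int (coef (a $ k) h) *
          Re (ell2_apply (\<Sum>l\<in>UNIV. blinfun_apply (B $ k $ l) (blinfun_apply (A $ l $ m) (embed_ell2 (frag_of (- g))))) (- h)))"
        by (simp add: ell2_apply_sum sum_distrib_left)
      also have "\<dots> = (\<Sum>k\<in>UNIV. \<Sum>h\<in>supp (a $ k). if k = m \<and> h = g then of_int (coef (a $ k) h) else 0)"
        unfolding mult_apply[OF BA]
        by (intro sum.cong refl) (auto simp: embed_ell2.rep_eq zero_ell2.rep_eq)
      also have "\<dots> = (\<Sum>k\<in>UNIV. if k = m then (\<Sum>h\<in>supp (a $ k). if h = g then of_int (coef (a $ k) h) else 0) else 0)"
        by (intro sum.cong refl) simp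
      also have "\<dots> = of_int (coef (a $ m) g)" by (simp add: in_keys_iff)
      finally show ?thesis by (simp only: of_int_eq_iff)
    qed
    then have "a = right_mult f b" by (simp add: vec_eq_iff poly_mapping_eqI)
    then show "\<exists>b. a = right_mult f b" by blast
  qed
qed

section \<open>Density of the homoclinic points\<close>

lemma circle_exp_minus: "circle_exp (- t) = cnj (circle_exp t)"
  by transfer (simp add: cis_cnj)

text \<open>Translates an integer combination of elements into a monomial in character values and
  their conjugates, the shape of the relations in \<open>kronecker_bohr\<close>.\<close>

lemma circle_exp_additive_combination:
  fixes \<phi> :: "'a::ab_group_add \<Rightarrow> circle"
  assumes add: "\<And>a b. \<phi> (a + b) = \<phi> a + \<phi> b" and K: "finite K"
  shows "circle_exp (\<phi> (\<Sum>a\<in>K. (\<Sum>i<p a. a) - (\<Sum>i<q a. a)))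
    = (\<Prod>a\<in>K. circle_exp (\<phi> a) ^ p a * cnj (circle_exp (\<phi> a)) ^ q a)"
proof -
  have t0: "\<phi> 0 = 0" using add[of 0 0] by simp
  have diff: "\<phi> (a - b) = \<phi> a - \<phi> b" for a b using add[of "a - b" b] by (simp add: algebra_simps)
  have mult: "circle_exp (\<phi> (\<Sum>i<n. a)) = circle_exp (\<phi> a) ^ n" for a and n :: nat
    by (induction n) (simp_all add: t0 add circle_exp_add mult.commute)
  have one: "circle_exp (\<phi> ((\<Sum>i<p a. a) - (\<Sum>i<q a. a))) = circle_exp (\<phi> a) ^ p a * cnj (circle_exp (\<phi> a)) ^ q a" for a
  proof -
    have "circle_exp (x - y) = circle_exp x * cnj (circle_exp y)" for x y
      using circle_exp_add[of x "- y"] by (simp add: circle_exp_minus)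
    then show ?thesis by (simp add: diff mult)
  qed
  show ?thesis using K by (induction K rule: finite_induct) (simp_all only: sum.empty sum.insert prod.empty prod.insert t0 circle_exp_0 add circle_exp_add one not_False_eq_True)
qed

lemma pairing_add_right: "pairing a (\<lambda>m h. \<Psi> m h + \<Phi> m h) = pairing a \<Psi> + pairing a \<Phi>"
  by (simp add: pairing_def distrib_left sum.distrib)

text \<open>Kronecker's theorem for the characters of the group of all \<open>w\<close> given by
  pairing \<open>\<Xi> w\<close> with the elements of \<open>K\<close>. A multiplicative relation
  that holds for all \<open>w\<close> is a combination \<open>c\<close> of elements of
  \<open>K\<close> that pairs integrally with every homoclinic point. By \<open>sep\<close> it lies
  in the range of \<open>right_mult f\<close>, so \<theta> satisfies the same relation.\<close>

lemma homoclinic_points_dense: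
  fixes f :: "('g::group_add \<Rightarrow>\<^sub>0 int)^'n^'n"
  assumes add: "\<And>v w m \<gamma>. \<Xi> (v + w) m \<gamma> = \<Xi> v m \<gamma> + \<Xi> w m \<gamma>"
    and sep: "\<And>a. (\<And>w. pairing a (\<lambda>m g. \<Xi> w m (- g)) \<in> \<int>) \<Longrightarrow> \<exists>b. a = right_mult f b"
    and \<theta>: "\<theta> \<in> annihilator f" and K: "finite K" and \<epsilon>: "0 < \<epsilon>"
  shows "\<exists>w :: ('g \<Rightarrow>\<^sub>0 int)^'n. \<forall>a\<in>K.
    cmod (circle_exp (abs_circle (pairing a (\<lambda>m g. \<Xi> w m (- g)))) - circle_exp (\<theta> a)) < \<epsilon>"
proof (rule kronecker_bohr[OF K \<epsilon>])
  fix p q :: "('g \<Rightarrow>\<^sub>0 int)^'n \<Rightarrow> nat"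
  assume triv: "(\<Prod>a\<in>K. circle_exp (abs_circle (pairing a (\<lambda>m g. \<Xi> w m (- g)))) ^ p a *
      cnj (circle_exp (abs_circle (pairing a (\<lambda>m g. \<Xi> w m (- g))))) ^ q a) = 1" for w :: "('g \<Rightarrow>\<^sub>0 int)^'n"
  define c where "c = (\<Sum>a\<in>K. (\<Sum>i<p a. a) - (\<Sum>i<q a. a))"
  have "pairing c (\<lambda>m g. \<Xi> w m (- g)) \<in> \<int>" for w
  proof -
    have "circle_exp (abs_circle (pairing c (\<lambda>m g. \<Xi> w m (- g)))) = 1"
      unfolding c_def using triv[of w]
      by (subst circle_exp_additive_combination[OF _ K]) (simp_all add: pairing_add abs_circle_add)
    then show ?thesis by (simp add: circle_exp_abs_eq_1_iff)
  qed
  then obtain b where "c = right_mult f b" using sep by blast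
  then have "\<theta> c = 0" using \<theta> by (simp add: annihilator_def)
  then have "circle_exp (\<theta> c) = 1" by simp
  then show "(\<Prod>a\<in>K. circle_exp (\<theta> a) ^ p a * cnj (circle_exp (\<theta> a)) ^ q a) = 1"
    using \<theta> unfolding c_def
    by (subst (asm) circle_exp_additive_combination[OF _ K]) (simp_all add: annihilator_def)
qed (simp_all add: add pairing_add_right abs_circle_add circle_exp_add)

section \<open>Square sum estimates for truncations\<close>

lemma summable_square_tail:
  fixes u :: "'i \<Rightarrow> 'g \<Rightarrow> real"
  assumes "finite I" "\<And>i. i \<in> I \<Longrightarrow> (\<lambda>\<gamma>. (u i \<gamma>)\<^sup>2) summable_on UNIV" "0 < \<eta>"
  obtains L where "finite L" "\<And>i T. i \<in> I \<Longrightarrow> finite T \<Longrightarrow> T \<inter> L = {} \<Longrightarrow> (\<Sum>\<gamma>\<in>T. (u i \<gamma>)\<^sup>2) \<le> \<eta>"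
proof -
  have "\<exists>L. finite L \<and> (\<forall>T. finite T \<longrightarrow> T \<inter> L = {} \<longrightarrow> (\<Sum>\<gamma>\<in>T. (u i \<gamma>)\<^sup>2) \<le> \<eta>)" if i: "i \<in> I" for i
  proof -
    define a where "a = (\<Sum>\<^sub>\<infinity>\<gamma>. (u i \<gamma>)\<^sup>2)"
    have "((\<lambda>\<gamma>. (u i \<gamma>)\<^sup>2) has_sum a) UNIV" unfolding a_def by (rule has_sum_infsum[OF assms(2)[OF i]])
    then have "eventually (\<lambda>X. a - \<eta> < (\<Sum>\<gamma>\<in>X. (u i \<gamma>)\<^sup>2)) (finite_subsets_at_top UNIV)"
      unfolding has_sum_def using assms(3) by (intro order_tendstoD(1)) auto
    then obtain L where L: "finite L" "a - \<eta> < (\<Sum>\<gamma>\<in>L. (u i \<gamma>)\<^sup>2)"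
      unfolding eventually_finite_subsets_at_top by blast
    have "(\<Sum>\<gamma>\<in>T. (u i \<gamma>)\<^sup>2) \<le> \<eta>" if T: "finite T" "T \<inter> L = {}" for T
    proof -
      have "(\<Sum>\<gamma>\<in>T \<union> L. (u i \<gamma>)\<^sup>2) \<le> a"
        unfolding a_def using T L by (intro finite_sum_le_infsum assms(2)[OF i]) auto
      then show ?thesis using T L by (simp add: sum.union_disjoint)
    qed
    then show ?thesis using L(1) by blast
  qed
  then obtain L where L: "\<And>i. i \<in> I \<Longrightarrow> finite (L i)"
    "\<And>i T. i \<in> I \<Longrightarrow> finite T \<Longrightarrow> T \<inter> L i = {} \<Longrightarrow> (\<Sum>\<gamma>\<in>T. (u i \<gamma>)\<^sup>2) \<le> \<eta>"
    by metis
  show ?thesis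
  proof (rule that[of "\<Union>i\<in>I. L i"])
    show "finite (\<Union>i\<in>I. L i)" using assms(1) L(1) by blast
    show "(\<Sum>\<gamma>\<in>T. (u i \<gamma>)\<^sup>2) \<le> \<eta>" if "i \<in> I" "finite T" "T \<inter> (\<Union>i\<in>I. L i) = {}" for i T
      using that by (intro L(2)) auto
  qed
qed

text \<open>Boundedness of \<open>f\<close> on square summable columns, by Cauchy-Schwarz over the
  finite support of row \<open>l\<close>; finite sums with a common bound \<eta> stand for norms. It
  transfers smallness of a tail to the defect of the relations.\<close>

lemma conv_square_sum_le:
  fixes f :: "('g::group_add \<Rightarrow>\<^sub>0 int)^'n^'n"
  obtains C where "0 < C"
    "\<And>u \<eta> l T. finite T \<Longrightarrow> (\<And>m T'. finite T' \<Longrightarrow> (\<Sum>\<gamma>\<in>T'. (u m \<gamma>)\<^sup>2) \<le> \<eta>) \<Longrightarrow>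
      (\<Sum>\<gamma>\<in>T. (conv f u l \<gamma>)\<^sup>2) \<le> C * \<eta>"
proof -
  define P where "P l = (SIGMA m:UNIV. supp (f $ l $ m))" for l
  define c where "c l = (\<lambda>(m, h). real_of_int (coef (f $ l $ m) h))" for l
  define C0 where "C0 l = (\<Sum>i\<in>P l. (c l i)\<^sup>2) * real (card (P l))" for l
  have C0: "0 \<le> C0 l" for l by (simp add: C0_def sum_nonneg)
  have fP: "finite (P l)" for l by (simp add: P_def)
  have main: "(\<Sum>\<gamma>\<in>T. (conv f u l \<gamma>)\<^sup>2) \<le> C0 l * \<eta>"
    if T: "finite T" and u: "\<And>m T'. finite T' \<Longrightarrow> (\<Sum>\<gamma>\<in>T'. (u m \<gamma>)\<^sup>2) \<le> \<eta>" for u \<eta> l T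
  proof -
    have conv: "conv f u l \<gamma> = (\<Sum>i\<in>P l. c l i * (case i of (m, h) \<Rightarrow> u m (- h + \<gamma>)))" for \<gamma>
      by (simp add: conv_def P_def c_def sum.Sigma case_prod_unfold)
    have "(\<Sum>\<gamma>\<in>T. (conv f u l \<gamma>)\<^sup>2)
        \<le> (\<Sum>\<gamma>\<in>T. (\<Sum>i\<in>P l. (c l i)\<^sup>2) * (\<Sum>i\<in>P l. (case i of (m, h) \<Rightarrow> u m (- h + \<gamma>))\<^sup>2))"
      unfolding conv by (intro sum_mono Cauchy_Schwarz_ineq_sum)
    also have "\<dots> = (\<Sum>i\<in>P l. (c l i)\<^sup>2) * (\<Sum>i\<in>P l. \<Sum>\<gamma>\<in>T. (case i of (m, h) \<Rightarrow> u m (- h + \<gamma>))\<^sup>2)"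
      unfolding sum_distrib_left[symmetric] by (subst sum.swap) (rule refl)
    also have "\<dots> \<le> (\<Sum>i\<in>P l. (c l i)\<^sup>2) * (\<Sum>i\<in>P l. \<eta>)"
    proof (intro mult_left_mono sum_mono sum_nonneg)
      fix i :: "'n \<times> 'g"
      obtain m h where i: "i = (m, h)" by (cases i)
      have "(\<Sum>\<gamma>\<in>T. (u m (- h + \<gamma>))\<^sup>2) = (\<Sum>\<gamma>\<in>(+) (- h) ` T. (u m \<gamma>)\<^sup>2)"
        by (subst sum.reindex) auto
      also have "\<dots> \<le> \<eta>" using T by (intro u) auto
      finally show "(\<Sum>\<gamma>\<in>T. (case i of (m, h) \<Rightarrow> u m (- h + \<gamma>))\<^sup>2) \<le> \<eta>" by (simp add: i)
    qed simp
    also have "\<dots> = C0 l * \<eta>" by (simp add: C0_def)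
    finally show ?thesis .
  qed
  show ?thesis
  proof (rule that[of "1 + (\<Sum>l\<in>UNIV. C0 l)"])
    show "0 < 1 + (\<Sum>l\<in>UNIV. C0 l)" using C0 by (simp add: add_pos_nonneg sum_nonneg)
    fix u :: "'n \<Rightarrow> 'g \<Rightarrow> real" and \<eta> :: real and l :: 'n and T :: "'g set"
    assume T: "finite T" and u: "\<And>m T'. finite T' \<Longrightarrow> (\<Sum>\<gamma>\<in>T'. (u m \<gamma>)\<^sup>2) \<le> \<eta>"
    have "0 \<le> \<eta>" using u[of "{}" undefined] by simp
    have "C0 l \<le> (\<Sum>l\<in>UNIV. C0 l)" using C0 by (intro member_le_sum) auto
    then have "C0 l * \<eta> \<le> (1 + (\<Sum>l\<in>UNIV. C0 l)) * \<eta>" using \<open>0 \<le> \<eta>\<close> by (intro mult_right_mono) auto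
    then show "(\<Sum>\<gamma>\<in>T. (conv f u l \<gamma>)\<^sup>2) \<le> (1 + (\<Sum>l\<in>UNIV. C0 l)) * \<eta>"
      using main[where u = u and l = l, OF T u] by linarith
  qed
qed

lemma conv_add: "conv f (\<lambda>m \<gamma>. u m \<gamma> + v m \<gamma>) l \<gamma> = conv f u l \<gamma> + conv f v l \<gamma>"
  by (simp add: conv_def distrib_left sum.distrib)

lemma conv_sum: "conv f (\<lambda>m \<gamma>. \<Sum>s\<in>S. u s m \<gamma>) l \<gamma> = (\<Sum>s\<in>S. conv f (u s) l \<gamma>)"
  unfolding conv_def sum_distrib_left
  by (subst (2) sum.swap) (subst sum.swap, simp)

section \<open>Good points of a sofic approximation\<close>

definition sofic_good :: "('g::group_add \<Rightarrow> nat \<Rightarrow> nat) \<Rightarrow> 'g set \<Rightarrow> nat \<Rightarrow> bool" where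
  "sofic_good s Q j \<longleftrightarrow> (\<forall>g\<in>Q. \<forall>h\<in>Q. s (g + h) j = s g (s h j)) \<and> (\<forall>g\<in>Q. g \<noteq> 0 \<longrightarrow> s g j \<noteq> j)"

lemma eventually_card_sofic_bad_le:
  assumes sof: "sofic_approximation d \<sigma>" and Q: "finite Q" and \<kappa>: "0 < \<kappa>"
  shows "eventually (\<lambda>i. real (card {j\<in>{1..d i}. \<not> sofic_good (\<sigma> i) Q j}) \<le> \<kappa> * real (d i)) sequentially"
proof -
  \<comment> \<open>Bounds the number of conditions in \<open>sofic_good\<close>, each of which may
    fail on a share \<open>\<kappa> / N\<close> of the points; the summand 1 keeps \<open>N\<close>
    positive for empty \<open>Q\<close>.\<close>
  define N where "N = real (card Q * card Q + card Q) + 1"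
  have N: "0 < N" by (simp add: N_def add_nonneg_pos)
  have ev: "eventually (\<lambda>i. real (card {j\<in>{1..d i}. \<not> P i j}) \<le> \<kappa> / N * real (d i)) sequentially"
    if "(\<lambda>i. measure (uniform_count_measure {1..d i}) {j \<in> {1..d i}. P i j}) \<longlonglongrightarrow> 1" for P
  proof -
    have "eventually (\<lambda>i. 1 - \<kappa> / N < measure (uniform_count_measure {1..d i}) {j \<in> {1..d i}. P i j}) sequentially"
      using that \<kappa> N by (intro order_tendstoD(1)) auto
    then show ?thesis
    proof (rule eventually_mono)
      fix i assume a: "1 - \<kappa> / N < measure (uniform_count_measure {1..d i}) {j \<in> {1..d i}. P i j}"
      have d: "0 < d i" using sof by (simp add: sofic_approximation_def)
      have "measure (uniform_count_measure {1..d i}) {j \<in> {1..d i}. P i j} = real (card {j \<in> {1..d i}. P i j}) / real (d i)"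
        by (subst measure_uniform_count_measure) auto
      then have "(1 - \<kappa> / N) * real (d i) < real (card {j \<in> {1..d i}. P i j})"
        using a d by (simp add: pos_less_divide_eq)
      moreover have "{j \<in> {1..d i}. P i j} \<union> {j\<in>{1..d i}. \<not> P i j} = {1..d i}" by blast
      then have "card {j \<in> {1..d i}. P i j} + card {j\<in>{1..d i}. \<not> P i j} = card {1..d i}"
        using card_Un_disjoint[of "{j \<in> {1..d i}. P i j}" "{j\<in>{1..d i}. \<not> P i j}"] by force
      then have "real (card {j \<in> {1..d i}. P i j}) + real (card {j\<in>{1..d i}. \<not> P i j}) = real (d i)"
        by (simp flip: of_nat_add)
      ultimately show "real (card {j\<in>{1..d i}. \<not> P i j}) \<le> \<kappa> / N * real (d i)"
        by (simp add: algebra_simps)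
    qed
  qed
  have 1: "eventually (\<lambda>i. \<forall>z\<in>Q \<times> Q. real (card {j\<in>{1..d i}. \<not> (\<sigma> i (fst z + snd z) j = \<sigma> i (fst z) (\<sigma> i (snd z) j))})
      \<le> \<kappa> / N * real (d i)) sequentially"
    using Q sof by (intro eventually_ball_finite ballI ev) (auto simp: sofic_approximation_def)
  have 2: "eventually (\<lambda>i. \<forall>g\<in>Q - {0}. real (card {j\<in>{1..d i}. \<not> (\<sigma> i g j \<noteq> j)}) \<le> \<kappa> / N * real (d i)) sequentially"
    using Q sof by (intro eventually_ball_finite ballI ev) (auto simp: sofic_approximation_def)
  show ?thesis
    using 1 2
  proof eventually_elim
    case (elim i)
    let ?A = "\<lambda>z. {j\<in>{1..d i}. \<not> (\<sigma> i (fst z + snd z) j = \<sigma> i (fst z) (\<sigma> i (snd z) j))}"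
    let ?B = "\<lambda>g. {j\<in>{1..d i}. \<not> (\<sigma> i g j \<noteq> j)}"
    have "{j\<in>{1..d i}. \<not> sofic_good (\<sigma> i) Q j} \<subseteq> (\<Union>z\<in>Q \<times> Q. ?A z) \<union> (\<Union>g\<in>Q - {0}. ?B g)"
      by (auto simp: sofic_good_def)
    then have "card {j\<in>{1..d i}. \<not> sofic_good (\<sigma> i) Q j} \<le> card ((\<Union>z\<in>Q \<times> Q. ?A z) \<union> (\<Union>g\<in>Q - {0}. ?B g))"
      using Q by (intro card_mono) auto
    also have "\<dots> \<le> card (\<Union>z\<in>Q \<times> Q. ?A z) + card (\<Union>g\<in>Q - {0}. ?B g)" by (rule card_Un_le)
    also have "\<dots> \<le> (\<Sum>z\<in>Q \<times> Q. card (?A z)) + (\<Sum>g\<in>Q - {0}. card (?B g))"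
      using Q by (intro add_mono card_UN_le) auto
    finally have "card {j\<in>{1..d i}. \<not> sofic_good (\<sigma> i) Q j}
        \<le> (\<Sum>z\<in>Q \<times> Q. card (?A z)) + (\<Sum>g\<in>Q - {0}. card (?B g))" .
    from of_nat_mono[OF this, where 'a = real]
    have "real (card {j\<in>{1..d i}. \<not> sofic_good (\<sigma> i) Q j})
        \<le> (\<Sum>z\<in>Q \<times> Q. real (card (?A z))) + (\<Sum>g\<in>Q - {0}. real (card (?B g)))"
      by (simp only: of_nat_add of_nat_sum)
    also have "\<dots> \<le> (\<Sum>z\<in>Q \<times> Q. \<kappa> / N * real (d i)) + (\<Sum>g\<in>Q - {0}. \<kappa> / N * real (d i))"
      using elim by (intro add_mono sum_mono) auto
    also have "\<dots> = real (card Q * card Q + card (Q - {0})) * (\<kappa> / N * real (d i))"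
      using Q by (simp add: card_cartesian_product algebra_simps)
    also have "\<dots> \<le> N * (\<kappa> / N * real (d i))"
    proof (rule mult_right_mono)
      have "card (Q - {0}) \<le> card Q" using Q by (intro card_mono) auto
      then show "real (card Q * card Q + card (Q - {0})) \<le> N" by (simp add: N_def)
    qed (use \<kappa> N in simp)
    also have "\<dots> = \<kappa> * real (d i)" using N by simp
    finally show ?case .
  qed
qed

section \<open>Patterns in sofic models\<close>

text \<open>A sofic approximation need not send the identity to the identity permutation. At a good
  point \<open>s 0 (s 0 j) = s 0 j\<close>, and injectivity removes one \<open>s 0\<close>.\<close>

lemma sofic_good_0:
  assumes "sofic_good s Q j" "0 \<in> Q" "inj (s 0)"
  shows "s 0 j = j"
proof -
  have "s (0 + 0) j = s 0 (s 0 j)" using assms(1,2) unfolding sofic_good_def by blast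
  then show ?thesis using assms(3) by (simp add: inj_eq)
qed

text \<open>If \<open>s x j = s y j\<close>, multiplicativity shows that \<open>- x + y\<close>
  fixes \<open>j\<close>, which freeness at a good point allows only for 0.\<close>

lemma sofic_good_inj_on:
  assumes good: "sofic_good s Q j" and s: "inj (s 0)"
    and E: "E \<subseteq> Q" "uminus ` E \<subseteq> Q" "0 \<in> Q" "\<And>x y. x \<in> E \<Longrightarrow> y \<in> E \<Longrightarrow> - x + y \<in> Q"
  shows "inj_on (\<lambda>\<gamma>. s \<gamma> j) E"
proof (rule inj_onI)
  fix x y assume xy: "x \<in> E" "y \<in> E" "s x j = s y j"
  have add: "s (g + h) j = s g (s h j)" if "g \<in> Q" "h \<in> Q" for g h
    using good that by (simp add: sofic_good_def)
  have "- x \<in> Q" "x \<in> Q" "y \<in> Q" using xy E by auto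
  then have "s (- x + y) j = s (- x + x) j" using xy(3) by (simp only: add)
  also have "\<dots> = j" using sofic_good_0[OF good E(3) s] by simp
  finally have "- x + y = 0" using good E(4)[OF xy(1,2)] by (auto simp: sofic_good_def)
  then show "x = y" by (metis add.right_neutral add_minus_cancel)
qed

text \<open>A function \<psi> on the model gives at each \<open>p\<close> the lift
  \<open>\<lambda>m h. \<psi> m (s (- h) p)\<close> of a character. Where the model is
  multiplicative on the window, these lifts are exactly equivariant, whatever \<psi> is.\<close>

lemma pairing_left_mult_sofic_good:
  assumes good: "sofic_good s Q p" and "g \<in> Q"
    and keys: "\<And>m h. h \<in> supp (a $ m) \<Longrightarrow> - h \<in> Q"
  shows "pairing (left_mult (- g) a) (\<lambda>m h. \<psi> m (s (- h) p)) = pairing a (\<lambda>m h. \<psi> m (s (- h) (s g p)))"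
  unfolding pairing_left_mult
proof (rule pairing_cong)
  fix m h assume "h \<in> supp (a $ m)"
  then have "s (- h + g) p = s (- h) (s g p)"
    using good assms(2) keys by (simp add: sofic_good_def)
  then show "\<psi> m (s (- (- g + h)) p) = \<psi> m (s (- h) (s g p))"
    by (simp add: minus_add)
qed

text \<open>Applying \<open>f\<close> to a superposition superposes \<open>f\<close> applied to the
  pieces: by multiplicativity and injectivity of \<open>s h\<close>,
  \<open>s \<gamma> j = s (- (g + h)) p\<close> holds iff
  \<open>s (h + \<gamma>) j = s (- g) p\<close>. The larger window \<open>T'\<close> holds the
  support of \<open>conv f (v c) l\<close>. Copies at different points may overlap.\<close>

lemma pairing_scatter:
  fixes f :: "('g::group_add \<Rightarrow>\<^sub>0 int)^'n^'n"
  assumes inj: "\<And>g. inj (s g)"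
    and T: "finite T" "finite T'"
    and TT': "\<And>m h \<gamma>. h \<in> supp (f $ l $ m) \<Longrightarrow> \<gamma> \<in> T \<Longrightarrow> h + \<gamma> \<in> T'"
    and supp: "\<And>c m \<gamma>. \<gamma> \<notin> T \<Longrightarrow> v c m \<gamma> = 0"
    and J: "\<And>j m h \<gamma>. j \<in> J \<Longrightarrow> h \<in> supp (f $ l $ m) \<Longrightarrow> \<gamma> \<in> T \<Longrightarrow> s (h + \<gamma>) j = s h (s \<gamma> j)"
    and p: "\<And>m h. h \<in> supp (f $ l $ m) \<Longrightarrow> s (h + (- h + - g)) p = s h (s (- h + - g) p)"
  shows "pairing (right_mult f (axis l (frag_of g)))
      (\<lambda>m h. scatter (\<lambda>j \<gamma>. s \<gamma> j) T J (\<lambda>c \<gamma>. v c m \<gamma>) c (s (- h) p))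
    = scatter (\<lambda>j \<gamma>. s \<gamma> j) T' J (\<lambda>c \<gamma>. conv f (v c) l \<gamma>) c (s (- g) p)"
proof -
  have shift: "scatter (\<lambda>j \<gamma>. s \<gamma> j) T J (\<lambda>c \<gamma>. v c m \<gamma>) c (s (- (g + h)) p)
      = (\<Sum>j\<in>J. \<Sum>\<gamma>\<in>T'. if s \<gamma> j = s (- g) p then v (c j) m (- h + \<gamma>) else 0)"
    if h: "h \<in> supp (f $ l $ m)" for m h
    unfolding scatter_def
  proof (rule sum.cong[OF refl])
    fix j assume j: "j \<in> J"
    have gh: "- (g + h) = - h + - g" by (simp add: minus_add)
    have eq: "(s \<gamma> j = s (- (g + h)) p) = (s (h + \<gamma>) j = s (- g) p)" if "\<gamma> \<in> T" for \<gamma>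
    proof -
      have "s (h + (- h + - g)) p = s (- g) p" by (simp only: add_minus_cancel)
      then have "s (- g) p = s h (s (- (g + h)) p)" using p[OF h] unfolding gh by simp
      then show ?thesis using J[OF j h that] inj[of h] by (simp add: inj_eq)
    qed
    have "(\<Sum>\<gamma>\<in>T. if s \<gamma> j = s (- (g + h)) p then v (c j) m \<gamma> else 0)
        = (\<Sum>\<gamma>\<in>T. if s (h + \<gamma>) j = s (- g) p then v (c j) m (- h + (h + \<gamma>)) else 0)"
      by (intro sum.cong refl) (simp add: eq flip: add.assoc)
    also have "\<dots> = (\<Sum>\<gamma>\<in>(+) h ` T. if s \<gamma> j = s (- g) p then v (c j) m (- h + \<gamma>) else 0)"
      by (subst sum.reindex) auto
    also have "\<dots> = (\<Sum>\<gamma>\<in>T'. if s \<gamma> j = s (- g) p then v (c j) m (- h + \<gamma>) else 0)"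
    proof (rule sum.mono_neutral_left)
      show "(+) h ` T \<subseteq> T'" using TT'[OF h] by auto
      show "\<forall>\<gamma>\<in>T' - (+) h ` T. (if s \<gamma> j = s (- g) p then v (c j) m (- h + \<gamma>) else 0) = 0"
      proof
        fix \<gamma> assume "\<gamma> \<in> T' - (+) h ` T"
        then have "- h + \<gamma> \<notin> T" by (metis DiffD2 add_minus_cancel image_eqI)
        then show "(if s \<gamma> j = s (- g) p then v (c j) m (- h + \<gamma>) else 0) = 0" by (simp add: supp)
      qed
    qed (rule T)
    finally show "(\<Sum>\<gamma>\<in>T. if s \<gamma> j = s (- (g + h)) p then v (c j) m \<gamma> else 0)
        = (\<Sum>\<gamma>\<in>T'. if s \<gamma> j = s (- g) p then v (c j) m (- h + \<gamma>) else 0)" .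
  qed
  define F where "F m h = real_of_int (coef (f $ l $ m) h)" for m h
  define P where "P = (SIGMA m:UNIV. supp (f $ l $ m))"
  have "pairing (right_mult f (axis l (frag_of g)))
      (\<lambda>m h. scatter (\<lambda>j \<gamma>. s \<gamma> j) T J (\<lambda>c \<gamma>. v c m \<gamma>) c (s (- h) p))
    = (\<Sum>m\<in>UNIV. \<Sum>h\<in>supp (f $ l $ m). F m h *
        (\<Sum>j\<in>J. \<Sum>\<gamma>\<in>T'. if s \<gamma> j = s (- g) p then v (c j) m (- h + \<gamma>) else 0))"
    unfolding pairing_right_mult_axis F_def by (intro sum.cong refl) (simp only: shift)
  also have "\<dots> = (\<Sum>i\<in>P. \<Sum>j\<in>J. \<Sum>\<gamma>\<in>T'. F (fst i) (snd i) * (if s \<gamma> j = s (- g) p then v (c j) (fst i) (- snd i + \<gamma>) else 0))"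
    by (simp add: P_def sum.Sigma case_prod_unfold sum_distrib_left)
  also have "\<dots> = (\<Sum>j\<in>J. \<Sum>i\<in>P. \<Sum>\<gamma>\<in>T'. F (fst i) (snd i) * (if s \<gamma> j = s (- g) p then v (c j) (fst i) (- snd i + \<gamma>) else 0))"
    by (rule sum.swap)
  also have "\<dots> = (\<Sum>j\<in>J. \<Sum>\<gamma>\<in>T'. \<Sum>i\<in>P. F (fst i) (snd i) * (if s \<gamma> j = s (- g) p then v (c j) (fst i) (- snd i + \<gamma>) else 0))"
    by (intro sum.cong refl sum.swap)
  also have "\<dots> = (\<Sum>j\<in>J. \<Sum>\<gamma>\<in>T'. if s \<gamma> j = s (- g) p then conv f (v (c j)) l \<gamma> else 0)"
  proof (intro sum.cong refl)
    fix j \<gamma>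
    have "conv f (v (c j)) l \<gamma> = (\<Sum>i\<in>P. F (fst i) (snd i) * v (c j) (fst i) (- snd i + \<gamma>))"
      by (simp add: conv_def P_def F_def sum.Sigma case_prod_unfold)
    then show "(\<Sum>i\<in>P. F (fst i) (snd i) * (if s \<gamma> j = s (- g) p then v (c j) (fst i) (- snd i + \<gamma>) else 0))
        = (if s \<gamma> j = s (- g) p then conv f (v (c j)) l \<gamma> else 0)" by simp
  qed
  finally show ?thesis by (simp add: scatter_def)
qed

lemma scatter_at_separated_point:
  assumes "finite J" "j \<in> J" "finite L" "\<kappa> \<in> L" "inj_on (loc j) L"
    and sep: "\<And>j' \<gamma>. j' \<in> J \<Longrightarrow> j' \<noteq> j \<Longrightarrow> \<gamma> \<in> L \<Longrightarrow> loc j' \<gamma> \<noteq> loc j \<kappa>"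
  shows "scatter loc L J v c (loc j \<kappa>) = v (c j) \<kappa>"
proof -
  have "scatter loc L J v c (loc j \<kappa>) = (\<Sum>j'\<in>J. if j' = j then v (c j) \<kappa> else 0)"
    unfolding scatter_def
  proof (intro sum.cong refl)
    fix j' assume j': "j' \<in> J"
    show "(\<Sum>\<gamma>\<in>L. if loc j' \<gamma> = loc j \<kappa> then v (c j') \<gamma> else 0) = (if j' = j then v (c j) \<kappa> else 0)"
    proof (cases "j' = j")
      case True
      have "(\<Sum>\<gamma>\<in>L. if loc j \<gamma> = loc j \<kappa> then v (c j) \<gamma> else 0) = (\<Sum>\<gamma>\<in>L. if \<gamma> = \<kappa> then v (c j) \<gamma> else 0)"
        using assms(4,5) by (intro sum.cong refl) (auto dest: inj_onD)
      also have "\<dots> = v (c j) \<kappa>" using assms(3,4) by simp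
      finally show ?thesis unfolding True by simp
    next
      case False
      then show ?thesis using sep[OF j'] by (auto intro: sum.neutral)
    qed
  qed
  then show ?thesis using assms(1,2) by simp
qed

lemma scatter_split:
  assumes "finite T" "L \<subseteq> T"
  shows "scatter loc T J v c p = scatter loc L J v c p + scatter loc (T - L) J v c p"
  unfolding scatter_def sum.distrib[symmetric]
  using assms by (intro sum.cong refl) (simp add: sum.subset_diff[of L T] add.commute)

lemma pairing_close:
  fixes K :: "(('g \<Rightarrow>\<^sub>0 int)^'n) set"
  assumes "finite K" "0 < \<epsilon>"
  obtains \<epsilon>' where "0 < \<epsilon>'"
    "\<And>a \<Psi> \<Phi>. a \<in> K \<Longrightarrow> (\<And>m h. h \<in> supp (a $ m) \<Longrightarrow> \<bar>\<Psi> m h - \<Phi> m h\<bar> < \<epsilon>') \<Longrightarrow>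
      \<bar>pairing a \<Psi> - pairing a \<Phi>\<bar> < \<epsilon>"
proof -
  define N where "N a = (\<Sum>m\<in>UNIV. \<Sum>h\<in>supp (a $ m). \<bar>real_of_int (coef (a $ m) h)\<bar>)"
    for a :: "('g \<Rightarrow>\<^sub>0 int)^'n"
  have N: "0 \<le> N a" for a by (simp add: N_def sum_nonneg)
  define M where "M = 1 + (\<Sum>a\<in>K. N a)"
  have M: "0 < M" using N by (simp add: M_def add_pos_nonneg sum_nonneg)
  show ?thesis
  proof (rule that[of "\<epsilon> / M"])
    show "0 < \<epsilon> / M" using M assms by simp
    fix a \<Psi> \<Phi> assume a: "a \<in> K" and close: "\<And>m h. h \<in> supp (a $ m) \<Longrightarrow> \<bar>\<Psi> m h - \<Phi> m h\<bar> < \<epsilon> / M"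
    have "pairing a \<Psi> - pairing a \<Phi>
        = (\<Sum>m\<in>UNIV. \<Sum>h\<in>supp (a $ m). of_int (coef (a $ m) h) * (\<Psi> m h - \<Phi> m h))"
      by (simp add: pairing_def sum_subtractf right_diff_distrib)
    also have "\<bar>\<dots>\<bar> \<le> (\<Sum>m\<in>UNIV. \<Sum>h\<in>supp (a $ m). \<bar>of_int (coef (a $ m) h)\<bar> * (\<epsilon> / M))"
    proof (rule order_trans[OF sum_abs], rule sum_mono, rule order_trans[OF sum_abs], rule sum_mono)
      fix m h assume "h \<in> supp (a $ m)"
      from close[OF this] show "\<bar>of_int (coef (a $ m) h) * (\<Psi> m h - \<Phi> m h)\<bar>
          \<le> \<bar>of_int (coef (a $ m) h)\<bar> * (\<epsilon> / M)"
        unfolding abs_mult by (intro mult_left_mono) auto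
    qed
    also have "\<dots> = N a * (\<epsilon> / M)" by (simp only: N_def sum_distrib_right)
    also have "\<dots> < M * (\<epsilon> / M)"
    proof (rule mult_strict_right_mono)
      have "N a \<le> (\<Sum>a\<in>K. N a)" using a assms N by (intro member_le_sum) auto
      then show "N a < M" by (simp add: M_def)
    qed (use M assms in simp)
    also have "\<dots> = \<epsilon>" using M by simp
    finally show "\<bar>pairing a \<Psi> - pairing a \<Phi>\<bar> < \<epsilon>" .
  qed
qed

section \<open>From approximate solutions to microstates\<close>

text \<open>Outside \<open>B\<close> each \<open>\<theta> p\<close> is replaced by a nearby member
  of \<open>annihilator f\<close>. Equivariance of \<theta> on the finite set \<open>K\<close> makes
  the replacements nearly equivariant for \<rho>, and points of \<open>B\<close> cost only their
  number, since \<rho> is bounded. The tolerances do not depend on \<open>d\<close> or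
  \<open>s\<close>.\<close>

lemma microstate_of_almost_solution:
  fixes f :: "('g::group_add \<Rightarrow>\<^sub>0 int)^'n^'n"
  assumes \<rho>: "continuous_pseudometric (X_space f) \<rho>" and F: "finite F" and \<delta>: "0 < \<delta>"
    and K0: "finite K0" and \<epsilon>0: "0 < \<epsilon>0"
  obtains K R and \<epsilon> \<tau> :: real where "finite K" "finite R" "0 < \<epsilon>" "0 < \<tau>"
    "\<And>d s \<theta> B. 0 < d \<Longrightarrow> (\<And>g. s g permutes {1..d}) \<Longrightarrow> B \<subseteq> {1..d} \<Longrightarrow> real (card B) \<le> \<tau> * real d \<Longrightarrow>
      (\<And>p a b. \<theta> p (a + b) = \<theta> p a + \<theta> p b) \<Longrightarrow>
      (\<And>p l g. p \<in> {1..d} - B \<Longrightarrow> (l, g) \<in> R \<Longrightarrow>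
        cmod (circle_exp (\<theta> p (right_mult f (axis l (frag_of g)))) - 1) < \<epsilon>) \<Longrightarrow>
      (\<And>p g a. p \<in> {1..d} - B \<Longrightarrow> g \<in> F \<Longrightarrow> a \<in> K \<Longrightarrow> \<theta> (s g p) a = \<theta> p (left_mult (- g) a)) \<Longrightarrow>
      \<exists>\<phi>\<in>Map_set (X_space f) (X_action f) \<rho> F \<delta> d s. \<forall>p\<in>{1..d} - B. \<exists>\<theta>'\<in>annihilator f.
        \<phi> p = descend f \<theta>' \<and> (\<forall>a\<in>K0. cmod (circle_exp (\<theta> p a) - circle_exp (\<theta>' a)) < \<epsilon>0)"
proof -
  obtain C where C: "0 < C" "\<And>x y. x \<in> topspace (X_space f) \<Longrightarrow> y \<in> topspace (X_space f) \<Longrightarrow> \<rho> x y \<le> C"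
    using pseudometric_bounded[OF \<rho>] by blast
  have "0 < \<delta> / 2" using \<delta> by simp
  from pseudometric_uniformly_continuous[OF \<rho> this]
  obtain K \<epsilon>2 where K: "finite K" and \<epsilon>2: "0 < \<epsilon>2"
    and uc: "\<And>\<theta> \<theta>'. \<theta> \<in> annihilator f \<Longrightarrow> \<theta>' \<in> annihilator f \<Longrightarrow>
      (\<And>a. a \<in> K \<Longrightarrow> cmod (circle_exp (\<theta> a) - circle_exp (\<theta>' a)) < \<epsilon>2) \<Longrightarrow>
      \<rho> (descend f \<theta>) (descend f \<theta>') < \<delta> / 2"
    by metis
  \<comment> \<open>The action composes characters with \<open>left_mult (- g)\<close>, so closeness
    on \<open>K\<close> after acting is closeness on a translate of \<open>K\<close>. The halving of
    \<open>\<epsilon>2\<close> below pays for the two replacements, at \<open>p\<close> and at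
    \<open>s g p\<close>.\<close>
  define K2 where "K2 = K0 \<union> K \<union> (\<Union>g\<in>F. left_mult (- g) ` K)"
  define \<epsilon>3 where "\<epsilon>3 = min \<epsilon>0 (\<epsilon>2 / 2)"
  have K2: "finite K2" using K0 K F by (simp add: K2_def)
  have \<epsilon>3: "0 < \<epsilon>3" using \<epsilon>0 \<epsilon>2 by (simp add: \<epsilon>3_def)
  from almost_annihilating_near_annihilator[OF K2 \<epsilon>3, of f]
  obtain R \<epsilon> where R: "finite R" "0 < \<epsilon>"
    and near: "\<And>\<theta>. (\<And>a b. \<theta> (a + b) = \<theta> a + \<theta> b) \<Longrightarrow>
      (\<And>l g. (l, g) \<in> R \<Longrightarrow> cmod (circle_exp (\<theta> (right_mult f (axis l (frag_of g)))) - 1) < \<epsilon>) \<Longrightarrow>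
      \<exists>\<theta>'\<in>annihilator f. \<forall>a\<in>K2. cmod (circle_exp (\<theta> a) - circle_exp (\<theta>' a)) < \<epsilon>3"
    by metis
  \<comment> \<open>At most \<open>2 * \<tau> * d\<close> points have \<open>p\<close> or
    \<open>s g p\<close> in \<open>B\<close>. They add at most half of
    \<open>\<delta>\<^sup>2\<close> to the mean square, and the pairs of close points add a
    quarter.\<close>
  define \<tau> where "\<tau> = \<delta>\<^sup>2 / (4 * C\<^sup>2)"
  have \<tau>: "0 < \<tau>" using \<delta> C by (simp add: \<tau>_def)
  show ?thesis
  proof (rule that[OF K R(1) R(2) \<tau>])
    fix d :: nat and s :: "'g \<Rightarrow> nat \<Rightarrow> nat" and \<theta> :: "nat \<Rightarrow> ('g \<Rightarrow>\<^sub>0 int)^'n \<Rightarrow> circle" and B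
    assume d: "0 < d" and s: "\<And>g. s g permutes {1..d}"
      and B: "B \<subseteq> {1..d}" "real (card B) \<le> \<tau> * real d"
      and add: "\<And>p a b. \<theta> p (a + b) = \<theta> p a + \<theta> p b"
      and rel: "\<And>p l g. p \<in> {1..d} - B \<Longrightarrow> (l, g) \<in> R \<Longrightarrow>
        cmod (circle_exp (\<theta> p (right_mult f (axis l (frag_of g)))) - 1) < \<epsilon>"
      and equiv: "\<And>p g a. p \<in> {1..d} - B \<Longrightarrow> g \<in> F \<Longrightarrow> a \<in> K \<Longrightarrow> \<theta> (s g p) a = \<theta> p (left_mult (- g) a)"
    have "\<exists>\<theta>'\<in>annihilator f. p \<in> {1..d} - B \<longrightarrow> (\<forall>a\<in>K2. cmod (circle_exp (\<theta> p a) - circle_exp (\<theta>' a)) < \<epsilon>3)" for p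
    proof (cases "p \<in> {1..d} - B")
      case True
      then show ?thesis using near[of "\<theta> p"] add rel[OF True] by metis
    next
      case False
      \<comment> \<open>The zero character is the default value at points where some point of X_f is
        needed but no closeness is claimed.\<close>
      have "(\<lambda>_. 0) \<in> annihilator f" by (simp add: annihilator_def)
      then show ?thesis using False by metis
    qed
    then obtain \<Theta> where \<Theta>: "\<And>p. \<Theta> p \<in> annihilator f"
      and close: "\<And>p a. p \<in> {1..d} - B \<Longrightarrow> a \<in> K2 \<Longrightarrow> cmod (circle_exp (\<theta> p a) - circle_exp (\<Theta> p a)) < \<epsilon>3"
      by metis
    define \<phi> where "\<phi> = (\<lambda>p\<in>{1..d}. descend f (\<Theta> p))"
    have sD: "s g p \<in> {1..d}" if "p \<in> {1..d}" for g p using permutes_in_image[OF s] that by blast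
    have "rho2 \<rho> d (\<phi> \<circ> s g) (\<lambda>j. X_action f g (\<phi> j)) < \<delta>" if g: "g \<in> F" for g
    proof -
      define Bad where "Bad = {p\<in>{1..d}. p \<in> B \<or> s g p \<in> B}"
      have fB: "finite B" using B by (rule_tac finite_subset) auto
      have "Bad = B \<union> {p\<in>{1..d}. s g p \<in> B}" using B by (auto simp: Bad_def)
      then have "card Bad \<le> card B + card {p\<in>{1..d}. s g p \<in> B}" by (simp add: card_Un_le)
      also have "card {p\<in>{1..d}. s g p \<in> B} \<le> card B"
        using fB by (intro card_inj_on_le[of "s g"] inj_on_subset[OF permutes_inj[OF s]]) auto
      finally have cBad: "real (card Bad) \<le> 2 * (\<tau> * real d)" using B(2) by linarith
      have bound: "(\<rho> ((\<phi> \<circ> s g) p) (X_action f g (\<phi> p)))\<^sup>2 \<le> \<delta>\<^sup>2 / 4 + (if p \<in> Bad then C\<^sup>2 else 0)"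
        if p: "p \<in> {1..d}" for p
      proof -
        have eq: "(\<phi> \<circ> s g) p = descend f (\<Theta> (s g p))" "X_action f g (\<phi> p) = descend f (\<Theta> p \<circ> left_mult (- g))"
          using p sD[OF p, of g] by (simp_all add: \<phi>_def X_action_descend \<Theta>)
        have ann: "\<Theta> (s g p) \<in> annihilator f" "\<Theta> p \<circ> left_mult (- g) \<in> annihilator f"
          by (intro \<Theta> annihilator_left_mult)+
        have \<rho>0: "0 \<le> \<rho> (descend f (\<Theta> (s g p))) (descend f (\<Theta> p \<circ> left_mult (- g)))"
          using \<rho> ann[THEN descend_in_X_space] by (simp add: continuous_pseudometric_def)
        show ?thesis
        proof (cases "p \<in> Bad")
          case True
          have "(\<rho> ((\<phi> \<circ> s g) p) (X_action f g (\<phi> p)))\<^sup>2 \<le> C\<^sup>2"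
            unfolding eq using \<rho>0 by (intro power_mono C ann[THEN descend_in_X_space])
          then show ?thesis using True by (simp add: add_increasing)
        next
          case False
          then have nB: "p \<in> {1..d} - B" "s g p \<in> {1..d} - B" using p sD[OF p, of g] by (auto simp: Bad_def)
          have "\<rho> (descend f (\<Theta> (s g p))) (descend f (\<Theta> p \<circ> left_mult (- g))) < \<delta> / 2"
          proof (rule uc[OF ann])
            fix a assume a: "a \<in> K"
            have "cmod (circle_exp (\<theta> (s g p) a) - circle_exp (\<Theta> (s g p) a)) < \<epsilon>2 / 2"
              using close[OF nB(2), of a] a by (simp add: K2_def \<epsilon>3_def)
            moreover have "cmod (circle_exp (\<theta> p (left_mult (- g) a)) - circle_exp (\<Theta> p (left_mult (- g) a))) < \<epsilon>2 / 2"
              using close[OF nB(1), of "left_mult (- g) a"] a g by (auto simp: K2_def \<epsilon>3_def)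
            ultimately show "cmod (circle_exp (\<Theta> (s g p) a) - circle_exp ((\<Theta> p \<circ> left_mult (- g)) a)) < \<epsilon>2"
              unfolding equiv[OF nB(1) g a] comp_def
              using norm_triangle_sub norm_diff_triangle_less norm_minus_commute
              by (metis field_sum_of_halves)
          qed
          then have "(\<rho> ((\<phi> \<circ> s g) p) (X_action f g (\<phi> p)))\<^sup>2 \<le> (\<delta> / 2)\<^sup>2"
            unfolding eq using \<rho>0 by (intro power_mono) auto
          then show ?thesis using False by (simp add: power_divide)
        qed
      qed
      have "(\<Sum>p=1..d. (\<rho> ((\<phi> \<circ> s g) p) (X_action f g (\<phi> p)))\<^sup>2)
          \<le> (\<Sum>p=1..d. \<delta>\<^sup>2 / 4 + (if p \<in> Bad then C\<^sup>2 else 0))"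
        by (intro sum_mono bound)
      also have "\<dots> = real d * (\<delta>\<^sup>2 / 4) + real (card Bad) * C\<^sup>2"
        by (simp add: sum.distrib sum.If_cases Bad_def Collect_conj_eq[symmetric] Int_def conj_ac)
      also have "\<dots> \<le> real d * (\<delta>\<^sup>2 / 4) + 2 * (\<tau> * real d) * C\<^sup>2"
        using cBad by (intro add_left_mono mult_right_mono) auto
      also have "\<dots> = real d * (3 / 4 * \<delta>\<^sup>2)" using C(1) by (simp add: \<tau>_def field_simps)
      also have "\<dots> < real d * \<delta>\<^sup>2" using d \<delta> by simp
      finally have "1 / real d * (\<Sum>p=1..d. (\<rho> ((\<phi> \<circ> s g) p) (X_action f g (\<phi> p)))\<^sup>2) < \<delta>\<^sup>2"
        using d by (simp add: field_simps)
      then show ?thesis unfolding rho2_def using \<delta> by (intro real_less_lsqrt) auto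
    qed
    moreover have "\<phi> \<in> {1..d} \<rightarrow>\<^sub>E topspace (X_space f)"
      using descend_in_X_space[OF \<Theta>] by (auto simp: \<phi>_def)
    ultimately have "\<phi> \<in> Map_set (X_space f) (X_action f) \<rho> F \<delta> d s" by (simp add: Map_set_def)
    moreover have "\<forall>p\<in>{1..d} - B. \<exists>\<theta>'\<in>annihilator f. \<phi> p = descend f \<theta>' \<and>
        (\<forall>a\<in>K0. cmod (circle_exp (\<theta> p a) - circle_exp (\<theta>' a)) < \<epsilon>0)"
    proof
      fix p assume p: "p \<in> {1..d} - B"
      have "\<forall>a\<in>K0. cmod (circle_exp (\<theta> p a) - circle_exp (\<Theta> p a)) < \<epsilon>0"
        using close[OF p] by (auto simp: K2_def \<epsilon>3_def)
      then show "\<exists>\<theta>'\<in>annihilator f. \<phi> p = descend f \<theta>' \<and>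
        (\<forall>a\<in>K0. cmod (circle_exp (\<theta> p a) - circle_exp (\<theta>' a)) < \<epsilon>0)"
        using p by (intro bexI[OF _ \<Theta>[of p]]) (auto simp: \<phi>_def)
    qed
    ultimately show "\<exists>\<phi>\<in>Map_set (X_space f) (X_action f) \<rho> F \<delta> d s. \<forall>p\<in>{1..d} - B. \<exists>\<theta>'\<in>annihilator f.
        \<phi> p = descend f \<theta>' \<and> (\<forall>a\<in>K0. cmod (circle_exp (\<theta> p a) - circle_exp (\<theta>' a)) < \<epsilon>0)" by blast
  qed
qed

text \<open>Chebyshev's inequality with a union over \<open>I\<close>: each \<open>x \<in> X\<close>
  meets a value of size at least \<epsilon> at some \<open>h i x\<close>, and injectivity of
  \<open>h i\<close> means that a value is met at most once for each \<open>i\<close>.\<close>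

lemma card_exceedance_le:
  fixes u :: "'m::finite \<Rightarrow> 'p \<Rightarrow> real"
  assumes "finite A" "finite I" "finite D" "0 < \<epsilon>"
    and h: "\<And>i. i \<in> I \<Longrightarrow> inj_on (h i) A" "\<And>i. i \<in> I \<Longrightarrow> h i ` A \<subseteq> D"
    and X: "X \<subseteq> A" "\<And>x. x \<in> X \<Longrightarrow> \<exists>m. \<exists>i\<in>I. \<epsilon> \<le> \<bar>u m (h i x)\<bar>"
  shows "\<epsilon>\<^sup>2 * real (card X) \<le> real (card I) * (\<Sum>m\<in>UNIV. \<Sum>p\<in>D. (u m p)\<^sup>2)"
proof -
  have fX: "finite X" using X(1) assms(1) by (rule finite_subset)
  have "\<epsilon>\<^sup>2 * real (card X) = (\<Sum>x\<in>X. \<epsilon>\<^sup>2)" by simp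
  also have "\<dots> \<le> (\<Sum>x\<in>X. \<Sum>i\<in>I. \<Sum>m\<in>UNIV. (u m (h i x))\<^sup>2)"
  proof (rule sum_mono)
    fix x assume "x \<in> X"
    then obtain m i where mi: "i \<in> I" "\<epsilon> \<le> \<bar>u m (h i x)\<bar>" using X(2) by blast
    have "\<epsilon>\<^sup>2 \<le> (u m (h i x))\<^sup>2" using mi(2) assms(4) by (simp add: abs_le_square_iff[symmetric])
    also have "\<dots> \<le> (\<Sum>m\<in>UNIV. (u m (h i x))\<^sup>2)" by (rule member_le_sum) auto
    also have "\<dots> \<le> (\<Sum>i\<in>I. \<Sum>m\<in>UNIV. (u m (h i x))\<^sup>2)"
      using mi(1) assms(2) by (intro member_le_sum[where f = "\<lambda>i. \<Sum>m\<in>UNIV. (u m (h i x))\<^sup>2"]) (auto intro: sum_nonneg)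
    finally show "\<epsilon>\<^sup>2 \<le> (\<Sum>i\<in>I. \<Sum>m\<in>UNIV. (u m (h i x))\<^sup>2)" .
  qed
  also have "\<dots> = (\<Sum>i\<in>I. \<Sum>m\<in>UNIV. \<Sum>x\<in>X. (u m (h i x))\<^sup>2)"
    by (subst sum.swap) (intro sum.cong refl sum.swap)
  also have "\<dots> \<le> (\<Sum>i\<in>I. \<Sum>m\<in>UNIV. \<Sum>p\<in>D. (u m p)\<^sup>2)"
  proof (intro sum_mono)
    fix i m assume i: "i \<in> I"
    have "(\<Sum>x\<in>X. (u m (h i x))\<^sup>2) = (\<Sum>p\<in>h i ` X. (u m p)\<^sup>2)"
      using inj_on_subset[OF h(1)[OF i] X(1)] by (simp add: sum.reindex)
    also have "\<dots> \<le> (\<Sum>p\<in>D. (u m p)\<^sup>2)" using assms(3) h(2)[OF i] X(1) by (intro sum_mono2) auto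
    finally show "(\<Sum>x\<in>X. (u m (h i x))\<^sup>2) \<le> (\<Sum>p\<in>D. (u m p)\<^sup>2)" .
  qed
  finally show ?thesis by simp
qed

text \<open>Two points conflict if some of their translates by \<open>L\<close> coincide. A point in
  conflict with \<open>x\<close> is determined by \<open>x\<close> and the pair
  \<open>(\<gamma>, \<gamma>')\<close>, so the conflict graph has degree at most
  \<open>card L * card L\<close>, and at least half of all points satisfy \<open>P\<close>.\<close>

lemma separated_good_points:
  assumes s: "\<And>g. s g permutes {1..d}" and L: "finite L"
    and bad: "real (card {j\<in>{1..d}. \<not> P j}) \<le> 1 / 2 * real d"
  obtains J where "J \<subseteq> {j\<in>{1..d}. P j}"
    "\<And>x y \<gamma> \<gamma>'. x \<in> J \<Longrightarrow> y \<in> J \<Longrightarrow> x \<noteq> y \<Longrightarrow> \<gamma> \<in> L \<Longrightarrow> \<gamma>' \<in> L \<Longrightarrow> s \<gamma> x \<noteq> s \<gamma>' y"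
    "1 / (2 * (real (card L * card L) + 1)) * real d \<le> real (card J)"
proof -
  define G where "G = {j\<in>{1..d}. P j}"
  define C where "C x y \<longleftrightarrow> (\<exists>\<gamma>\<in>L. \<exists>\<gamma>'\<in>L. s \<gamma> x = s \<gamma>' y)" for x y
  have "card {y\<in>G. C x y} \<le> card L * card L" for x
  proof -
    have "{y\<in>G. C x y} \<subseteq> (\<lambda>(\<gamma>, \<gamma>'). inv_into UNIV (s \<gamma>') (s \<gamma> x)) ` (L \<times> L)"
    proof
      fix y assume "y \<in> {y\<in>G. C x y}"
      then obtain \<gamma> \<gamma>' where "\<gamma> \<in> L" "\<gamma>' \<in> L" "s \<gamma> x = s \<gamma>' y" by (auto simp: C_def)
      then show "y \<in> (\<lambda>(\<gamma>, \<gamma>'). inv_into UNIV (s \<gamma>') (s \<gamma> x)) ` (L \<times> L)"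
        using inv_f_f[OF permutes_inj[OF s]] by (intro image_eqI[of _ _ "(\<gamma>, \<gamma>')"]) auto
    qed
    then have "card {y\<in>G. C x y} \<le> card (L \<times> L)" using L by (intro surj_card_le) auto
    then show ?thesis by (simp add: card_cartesian_product)
  qed
  moreover have "C x y \<Longrightarrow> C y x" for x y unfolding C_def by metis
  moreover have "finite G" by (simp add: G_def)
  ultimately obtain J where J: "J \<subseteq> G" "\<And>x y. x \<in> J \<Longrightarrow> y \<in> J \<Longrightarrow> x \<noteq> y \<Longrightarrow> \<not> C x y"
    "card G \<le> (card L * card L + 1) * card J"
    using large_independent_subset[of G C "card L * card L"] by metis
  have "G \<union> {j\<in>{1..d}. \<not> P j} = {1..d}" by (auto simp: G_def)
  then have "card G + card {j\<in>{1..d}. \<not> P j} = d"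
    using card_Un_disjoint[of G "{j\<in>{1..d}. \<not> P j}"] by (force simp: G_def)
  then have "real (card G) + real (card {j\<in>{1..d}. \<not> P j}) = real d" by (simp flip: of_nat_add)
  then have "real d / 2 \<le> real (card G)" using bad by linarith
  also have "\<dots> \<le> (real (card L * card L) + 1) * real (card J)"
    using of_nat_mono[OF J(3), where 'a = real] by (simp add: algebra_simps)
  finally have "real d / 2 \<le> (real (card L * card L) + 1) * real (card J)" .
  moreover have "0 < real (card L * card L) + 1" by (simp add: add_nonneg_pos)
  ultimately have "1 / (2 * (real (card L * card L) + 1)) * real d \<le> real (card J)"
    by (simp add: field_simps)
  moreover have "J \<subseteq> {j\<in>{1..d}. P j}" using J(1) by (simp add: G_def)
  moreover have "s \<gamma> x \<noteq> s \<gamma>' y" if "x \<in> J" "y \<in> J" "x \<noteq> y" "\<gamma> \<in> L" "\<gamma>' \<in> L" for x y \<gamma> \<gamma>'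
    using J(2)[OF that(1-3)] that(4,5) by (auto simp: C_def)
  ultimately show ?thesis by (intro that[of J])
qed

text \<open>\<open>\<psi>\<close> is a lift to \<open>\<real>\<close> of an approximate solution over the sofic model \<open>s\<close>: the character
  \<open>a \<mapsto> pairing a (\<lambda>m h. \<psi> m (s (- h) p))\<close> modulo \<open>\<int>\<close> almost kills the relations indexed by \<open>R\<close> and
  is equivariant on \<open>K\<close> under \<open>F\<close>, for all \<open>p\<close> outside the exceptional set \<open>B\<close>.\<close>

definition almost_solution ::
    "('g::group_add \<Rightarrow> nat \<Rightarrow> nat) \<Rightarrow> nat \<Rightarrow> ('g \<Rightarrow>\<^sub>0 int)^'n^'n \<Rightarrow> (('g \<Rightarrow>\<^sub>0 int)^'n) set \<Rightarrow> ('n \<times> 'g) set \<Rightarrow>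
      'g set \<Rightarrow> real \<Rightarrow> nat set \<Rightarrow> ('n \<Rightarrow> nat \<Rightarrow> real) \<Rightarrow> bool" where
  "almost_solution s d f K R F \<epsilon> B \<psi> \<longleftrightarrow>
    (\<forall>p\<in>{1..d} - B. \<forall>(l, g)\<in>R. \<exists>z\<in>\<int>.
      \<bar>pairing (right_mult f (axis l (frag_of g))) (\<lambda>m h. \<psi> m (s (- h) p)) - z\<bar> < \<epsilon>) \<and>
    (\<forall>p\<in>{1..d} - B. \<forall>g\<in>F. \<forall>a\<in>K. pairing (left_mult (- g) a) (\<lambda>m h. \<psi> m (s (- h) p))
      = pairing a (\<lambda>m h. \<psi> m (s (- h) (s g p))))"

text \<open>\<open>B\<close> may depend on \<open>c\<close> but has to avoid \<open>J\<close>, since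
  a microstate obtained from \<psi> is controlled only outside \<open>B\<close>.\<close>

definition realises_patterns ::
    "('g::group_add \<Rightarrow> nat \<Rightarrow> nat) \<Rightarrow> nat \<Rightarrow> ('g \<Rightarrow>\<^sub>0 int)^'n^'n \<Rightarrow> (('g \<Rightarrow>\<^sub>0 int)^'n) set \<Rightarrow> ('n \<times> 'g) set \<Rightarrow>
      'g set \<Rightarrow> real \<Rightarrow> real \<Rightarrow> 's set \<Rightarrow> ('s \<Rightarrow> 'n \<Rightarrow> 'g \<Rightarrow> real) \<Rightarrow> 'g set \<Rightarrow> real \<Rightarrow> nat set \<Rightarrow> bool" where
  "realises_patterns s d f K R F \<epsilon> \<tau> S \<Xi> Kg \<epsilon>1 J \<longleftrightarrow>
    (\<forall>c\<in>J \<rightarrow> S. \<exists>\<psi> B. B \<subseteq> {1..d} \<and> real (card B) \<le> \<tau> * real d \<and> B \<inter> J = {} \<and>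
      almost_solution s d f K R F \<epsilon> B \<psi> \<and>
      (\<forall>j\<in>J. \<forall>m. \<forall>\<kappa>\<in>Kg. \<bar>\<psi> m (s \<kappa> j) - \<Xi> (c j) m \<kappa>\<bar> < \<epsilon>1))"

section \<open>Random choice of patterns over a sofic model\<close>

lemma sofic_patterns:
  fixes f :: "('g::group_add \<Rightarrow>\<^sub>0 int)^'n^'n" and \<Xi> :: "'s \<Rightarrow> 'n \<Rightarrow> 'g \<Rightarrow> real"
  assumes sof: "sofic_approximation d \<sigma>" and S: "finite S" "S \<noteq> {}"
    and int: "\<And>s l \<gamma>. conv f (\<Xi> s) l \<gamma> \<in> \<int>"
    and centred: "\<And>m \<gamma>. (\<Sum>s\<in>S. \<Xi> s m \<gamma>) = 0"
    and summ: "\<And>s m. (\<lambda>\<gamma>. (\<Xi> s m \<gamma>)\<^sup>2) summable_on UNIV"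
    and Kg: "finite Kg" and \<epsilon>1: "0 < \<epsilon>1"
  obtains r :: real where "0 < r"
    "\<And>K R F \<epsilon> \<tau>. finite K \<Longrightarrow> finite R \<Longrightarrow> finite F \<Longrightarrow> 0 < \<epsilon> \<Longrightarrow> 0 < \<tau> \<Longrightarrow>
      eventually (\<lambda>i. \<exists>J\<subseteq>{1..d i}. r * real (d i) \<le> real (card J) \<and>
        realises_patterns (\<sigma> i) (d i) f K R F \<epsilon> \<tau> S \<Xi> Kg \<epsilon>1 J) sequentially"
proof (rule shattering_off_exceptional_sets[OF S, where 'a = nat])
  fix \<beta> q :: real
  assume \<beta>: "0 < \<beta>" and q: "0 < q" "q < 1"
    and shatter: "\<And>(J :: nat set) \<G> B. finite J \<Longrightarrow> J \<noteq> {} \<Longrightarrow> \<G> \<subseteq> (J \<rightarrow>\<^sub>E S) \<Longrightarrow>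
       (\<And>c. c \<in> \<G> \<Longrightarrow> B c \<subseteq> J \<and> real (card (B c)) \<le> \<beta> * real (card J)) \<Longrightarrow>
       q * real (card S) ^ card J < real (card \<G>) \<Longrightarrow>
       \<exists>J'\<subseteq>J. \<beta> * real (card J) \<le> real (card J') \<and>
         (\<forall>c \<in> J' \<rightarrow> S. \<exists>c'\<in>\<G>. (\<forall>j\<in>J'. c' j = c j) \<and> B c' \<inter> J' = {})"
  define n where "n = real CARD('n)"
  have n: "0 < n" by (simp add: n_def)
  \<comment> \<open>If the interference has square sum below \<open>t1 * card J\<close>, Chebyshev
    leaves at most \<open>\<beta> / 2 * card J\<close> spoiled points. With tails below
    \<open>\<eta>1\<close>, Markov bounds the proportion of \<open>c\<close> that fail this by
    \<open>(1 - q) / 4\<close>.\<close>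
  define t1 where "t1 = \<beta> * \<epsilon>1\<^sup>2 / (2 * (real (card Kg) + 1))"
  have t1: "0 < t1" using \<beta> \<epsilon>1 by (simp add: t1_def add_nonneg_pos)
  define \<eta>1 where "\<eta>1 = t1 * (1 - q) / (4 * n)"
  have \<eta>1: "0 < \<eta>1" using t1 q n by (simp add: \<eta>1_def)
  obtain L0 where L0: "finite L0"
    and tail0: "\<And>i T. i \<in> S \<times> UNIV \<Longrightarrow> finite T \<Longrightarrow> T \<inter> L0 = {} \<Longrightarrow> (\<Sum>\<gamma>\<in>T. (\<Xi> (fst i) (snd i) \<gamma>)\<^sup>2) \<le> \<eta>1"
    using summable_square_tail[of "S \<times> (UNIV :: 'n set)" "\<lambda>i. \<Xi> (fst i) (snd i)" \<eta>1] S(1) summ \<eta>1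
    by (metis finite_SigmaI finite)
  define L where "L = L0 \<union> Kg"
  have L: "finite L" "Kg \<subseteq> L" "L0 \<subseteq> L" using L0 Kg by (auto simp: L_def)
  have tail1: "(\<Sum>\<gamma>\<in>T. (\<Xi> s m \<gamma>)\<^sup>2) \<le> \<eta>1" if "s \<in> S" "finite T" "T \<inter> L = {}" for s m T
    using tail0[of "(s, m)" T] that L(3) by auto
  define rJ where "rJ = 1 / (2 * (real (card L * card L) + 1))"
  have rJ: "0 < rJ" by (simp add: rJ_def add_nonneg_pos)
  obtain Cf where Cf: "0 < Cf"
    "\<And>u \<eta> l T. finite T \<Longrightarrow> (\<And>m T'. finite T' \<Longrightarrow> (\<Sum>\<gamma>\<in>T'. (u m \<gamma>)\<^sup>2) \<le> \<eta>) \<Longrightarrow>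
      (\<Sum>\<gamma>\<in>T. (conv f u l \<gamma>)\<^sup>2) \<le> Cf * \<eta>"
    using conv_square_sum_le[of f] by metis
  show ?thesis
  proof (rule that[of "\<beta> * rJ"])
    show "0 < \<beta> * rJ" using \<beta> rJ by simp
    fix K :: "(('g \<Rightarrow>\<^sub>0 int)^'n) set" and R :: "('n \<times> 'g) set" and F :: "'g set" and \<epsilon> \<tau>0 :: real
    assume K: "finite K" and R: "finite R" and F: "finite F" and \<epsilon>: "0 < \<epsilon>" and \<tau>0: "0 < \<tau>0"
    \<comment> \<open>The second bound makes \<open>\<tau> * d i\<close> at most
      \<open>\<beta> / 2 * card J\<close>, as \<open>J\<close> will have at least
      \<open>rJ * d i\<close> points; so a set that is small in the model also takes little from
      \<open>J\<close>.\<close>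
    define \<tau> where "\<tau> = min \<tau>0 (\<beta> / 2 * rJ)"
    have \<tau>: "0 < \<tau>" "\<tau> \<le> \<tau>0" "\<tau> \<le> \<beta> / 2 * rJ" using \<tau>0 \<beta> rJ by (auto simp: \<tau>_def)
    \<comment> \<open>Half of \<tau> is reserved for points where a relation fails, the other half
      for points that are not good. The choice of \<open>\<eta>2\<close> costs a further proportion
      \<open>(1 - q) / 4\<close> of the \<open>c\<close>, so \<open>(1 + q) / 2 > q\<close>
      remains.\<close>
    define t2 where "t2 = \<tau> * \<epsilon>\<^sup>2 / (2 * (real (card R) + 1))"
    have t2: "0 < t2" using \<tau> \<epsilon> by (simp add: t2_def add_nonneg_pos)
    define \<eta>2 where "\<eta>2 = t2 * (1 - q) / (4 * n)"
    have \<eta>2: "0 < \<eta>2" using t2 q n by (simp add: \<eta>2_def)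
    have "0 < \<eta>2 / Cf" using \<eta>2 Cf by simp
    then obtain T0 where T0: "finite T0"
      and tailT0: "\<And>i T. i \<in> S \<times> UNIV \<Longrightarrow> finite T \<Longrightarrow> T \<inter> T0 = {} \<Longrightarrow> (\<Sum>\<gamma>\<in>T. (\<Xi> (fst i) (snd i) \<gamma>)\<^sup>2) \<le> \<eta>2 / Cf"
      using summable_square_tail[of "S \<times> (UNIV :: 'n set)" "\<lambda>i. \<Xi> (fst i) (snd i)" "\<eta>2 / Cf"] S(1) summ
      by (metis finite_SigmaI finite)
    define T where "T = T0 \<union> L"
    have T: "finite T" "L \<subseteq> T" "T0 \<subseteq> T" using T0 L by (auto simp: T_def)
    have tailT: "(\<Sum>\<gamma>\<in>T - L. (\<Xi> s m \<gamma>)\<^sup>2) \<le> \<eta>1" if "s \<in> S" for s m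
      using T(1) by (intro tail1[OF that]) auto
    define H where "H = (\<Union>l. \<Union>m. supp (f $ l $ m))"
    have H: "finite H" by (simp add: H_def)
    define T' where "T' = T \<union> (\<lambda>(h, \<gamma>). h + \<gamma>) ` (H \<times> T)"
    have T': "finite T'" "T \<subseteq> T'" using T H by (auto simp: T'_def)
    define v where "v s m \<gamma> = (if \<gamma> \<in> T then \<Xi> s m \<gamma> else 0)" for s m \<gamma>
    \<comment> \<open>The defect of a truncated copy: \<open>conv f (\<Xi> s)\<close> is integral,
      so \<open>f\<close> maps the copy to \<open>e\<close> modulo integers.\<close>
    define e where "e s l \<gamma> = conv f (v s) l \<gamma> - conv f (\<Xi> s) l \<gamma>" for s l \<gamma>
    have e_small: "(\<Sum>\<gamma>\<in>T'. (e s l \<gamma>)\<^sup>2) \<le> \<eta>2" if s: "s \<in> S" for s l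
    proof -
      define u where "u m \<gamma> = (if \<gamma> \<in> T then 0 else \<Xi> s m \<gamma>)" for m \<gamma>
      have "conv f (\<lambda>m \<gamma>. v s m \<gamma> + u m \<gamma>) l \<gamma> = conv f (v s) l \<gamma> + conv f u l \<gamma>" for \<gamma> by (rule conv_add)
      moreover have "(\<lambda>m \<gamma>. v s m \<gamma> + u m \<gamma>) = \<Xi> s" by (auto simp: v_def u_def fun_eq_iff)
      ultimately have "e s l \<gamma> = - conv f u l \<gamma>" for \<gamma> by (simp add: e_def)
      then have "(\<Sum>\<gamma>\<in>T'. (e s l \<gamma>)\<^sup>2) = (\<Sum>\<gamma>\<in>T'. (conv f u l \<gamma>)\<^sup>2)" by simp
      also have "\<dots> \<le> Cf * (\<eta>2 / Cf)"
      proof (rule Cf(2)[OF T'(1)])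
        fix m and T'' :: "'g set" assume T'': "finite T''"
        have "(\<Sum>\<gamma>\<in>T''. (u m \<gamma>)\<^sup>2) = (\<Sum>\<gamma>\<in>T'' - T. (\<Xi> s m \<gamma>)\<^sup>2)"
          using T'' by (intro sum.mono_neutral_cong_right) (auto simp: u_def)
        also have "\<dots> \<le> \<eta>2 / Cf" using tailT0[of "(s, m)" "T'' - T"] s T'' T by auto
        finally show "(\<Sum>\<gamma>\<in>T''. (u m \<gamma>)\<^sup>2) \<le> \<eta>2 / Cf" .
      qed
      finally show ?thesis using Cf(1) by simp
    qed
    \<comment> \<open>Centring of \<Xi> over \<open>S\<close>, the purpose of the extra symbol,
      survives truncation and passes through the linear \<open>conv f\<close>.\<close>
    have e_centred: "(\<Sum>s\<in>S. e s l \<gamma>) = 0" for l \<gamma>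
    proof -
      have "(\<Sum>s\<in>S. v s m \<gamma>) = 0" for m \<gamma>
        using centred by (cases "\<gamma> \<in> T") (simp_all add: v_def)
      then have "(\<lambda>m \<gamma>. \<Sum>s\<in>S. v s m \<gamma>) = (\<lambda>m \<gamma>. 0)" by (simp add: fun_eq_iff)
      then have "(\<Sum>s\<in>S. conv f (v s) l \<gamma>) = 0" unfolding conv_sum[symmetric] by (simp add: conv_def)
      moreover have "(\<Sum>s\<in>S. conv f (\<Xi> s) l \<gamma>) = 0" unfolding conv_sum[symmetric] by (simp add: centred conv_def)
      ultimately show ?thesis by (simp add: e_def sum_subtractf)
    qed
    \<comment> \<open>All group elements at which the model is evaluated. \<open>Q\<close> consists
      of sums of two of them or their inverses; this covers the nested product
      \<open>h + (- h + - g)\<close> in \<open>pairing_scatter\<close> and the differences needed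
      for injectivity.\<close>
    define E where "E = {0} \<union> T' \<union> H \<union> snd ` R \<union> F \<union> (\<Union>a\<in>K. \<Union>m. supp (a $ m))"
    define E' where "E' = E \<union> uminus ` E"
    define Q where "Q = (\<lambda>(x, y). x + y) ` (E' \<times> E')"
    have E: "finite E" using T' H R F K by (simp add: E_def)
    have fQ: "finite Q" using E by (simp add: Q_def E'_def)
    have Q_add: "x + y \<in> Q" if "x \<in> E'" "y \<in> E'" for x y using that by (force simp: Q_def)
    have E0: "0 \<in> E'" by (simp add: E'_def E_def)
    have E'Q: "x \<in> Q" if "x \<in> E'" for x using Q_add[OF that E0] by simp
    have EE': "x \<in> E'" "- x \<in> E'" if "x \<in> E" for x using that by (auto simp: E'_def)
    \<comment> \<open>The bound 1/2 is for \<open>separated_good_points\<close>, the bound by half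
      of \<tau> for the points of \<open>B2\<close> that are not good.\<close>
    define \<kappa> where "\<kappa> = min (1 / 2) (\<tau> / 2)"
    have \<kappa>: "0 < \<kappa>" "\<kappa> \<le> 1 / 2" "\<kappa> \<le> \<tau> / 2" using \<tau> by (auto simp: \<kappa>_def)
    show "eventually (\<lambda>i. \<exists>J\<subseteq>{1..d i}. \<beta> * rJ * real (d i) \<le> real (card J) \<and>
        realises_patterns (\<sigma> i) (d i) f K R F \<epsilon> \<tau>0 S \<Xi> Kg \<epsilon>1 J) sequentially"
      using eventually_card_sofic_bad_le[OF sof fQ \<kappa>(1)]
    proof (rule eventually_mono)
      fix i assume bad: "real (card {j\<in>{1..d i}. \<not> sofic_good (\<sigma> i) Q j}) \<le> \<kappa> * real (d i)"
      define s where "s = \<sigma> i"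
      define D where "D = {1..d i}"
      define loc where "loc = (\<lambda>j \<gamma>. s \<gamma> j)"
      have d: "0 < d i" and perm: "\<And>g. s g permutes D"
        using sof by (auto simp: sofic_approximation_def s_def D_def)
      have inj: "inj (s g)" for g by (rule permutes_inj[OF perm])
      have sD: "s g p \<in> D" if "p \<in> D" for g p using permutes_in_image[OF perm] that by blast
      have fD: "finite D" by (simp add: D_def)
      have cD: "card D = d i" by (simp add: D_def)
      have "\<kappa> * real (d i) \<le> 1 / 2 * real (d i)" using \<kappa>(2) by (rule mult_right_mono) simp
      then have few: "real (card {j\<in>{1..d i}. \<not> sofic_good s Q j}) \<le> 1 / 2 * real (d i)"
        using bad unfolding s_def by linarith
      \<comment> \<open>Separation is required for \<open>L\<close> only; separating the windows
        \<open>T\<close> would make the density depend on \<open>R\<close>, \<epsilon> and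
        \<open>\<tau>0\<close>.\<close>
      obtain J where J: "J \<subseteq> {j\<in>D. sofic_good s Q j}"
        and sep: "\<And>x y \<gamma> \<gamma>'. x \<in> J \<Longrightarrow> y \<in> J \<Longrightarrow> x \<noteq> y \<Longrightarrow> \<gamma> \<in> L \<Longrightarrow> \<gamma>' \<in> L \<Longrightarrow> s \<gamma> x \<noteq> s \<gamma>' y"
        and cJ: "rJ * real (d i) \<le> real (card J)"
      proof (rule separated_good_points[OF perm[unfolded D_def] L(1) few])
        fix J assume J: "J \<subseteq> {j\<in>{1..d i}. sofic_good s Q j}"
          "1 / (2 * (real (card L * card L) + 1)) * real (d i) \<le> real (card J)"
          and sep: "\<And>x y \<gamma> \<gamma>'. x \<in> J \<Longrightarrow> y \<in> J \<Longrightarrow> x \<noteq> y \<Longrightarrow> \<gamma> \<in> L \<Longrightarrow> \<gamma>' \<in> L \<Longrightarrow> s \<gamma> x \<noteq> s \<gamma>' y"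
        show thesis by (rule that[OF J(1)[folded D_def] sep J(2)[folded rJ_def]])
      qed
      have fJ: "finite J" using J fD by (auto intro: finite_subset)
      have JD: "J \<subseteq> D" using J by auto
      have goodJ: "sofic_good s Q j" if "j \<in> J" for j using J that by auto
      have "0 < rJ * real (d i)" using rJ d by simp
      then have cJ0: "0 < real (card J)" using cJ by linarith
      then have J0: "J \<noteq> {}" by auto
      have cJd: "real (card J) \<le> real (d i)" using card_mono[OF fD JD] cD by simp
      have E_T': "T' \<subseteq> E" by (auto simp: E_def)
      have injE: "inj_on (loc j) E" if "j \<in> J" for j
        unfolding loc_def using goodJ[OF that] inj E'Q Q_add E0 EE'
        by (intro sofic_good_inj_on[of s Q]) auto
      have injT': "inj_on (loc j) T'" if "j \<in> J" for j using injE[OF that] E_T' by (rule inj_on_subset)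
      have injT: "inj_on (loc j) (T - L)" "inj_on (loc j) L" if "j \<in> J" for j
        using injT'[OF that] T'(2) T(2) by (auto intro: inj_on_subset)
      have locD: "loc j ` A \<subseteq> D" if "j \<in> J" for j A using sD JD that by (auto simp: loc_def)
      define \<Omega> where "\<Omega> = (J \<rightarrow>\<^sub>E S)"
      have f\<Omega>: "finite \<Omega>" using fJ S by (auto simp: \<Omega>_def intro: finite_PiE)
      have c\<Omega>: "card \<Omega> = card S ^ card J" using fJ by (simp add: \<Omega>_def card_PiE)
      have c\<Omega>0: "0 < card \<Omega>" using S by (simp add: c\<Omega> card_gt_0_iff)
      \<comment> \<open>\<open>X\<close> is the interference of the outer parts of the copies,
        \<open>Y\<close> the deviation of the relations from integers. Both are superpositions of
        centred pieces with small square sums.\<close>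
      define X where "X m c p = scatter loc (T - L) J (\<lambda>s \<gamma>. \<Xi> s m \<gamma>) c p" for m c p
      define Y where "Y l c p = scatter loc T' J (\<lambda>s \<gamma>. e s l \<gamma>) c p" for l c p
      define Z1 where "Z1 c = (\<Sum>m\<in>UNIV. \<Sum>p\<in>D. (X m c p)\<^sup>2)" for c
      define Z2 where "Z2 c = (\<Sum>l\<in>UNIV. \<Sum>p\<in>D. (Y l c p)\<^sup>2)" for c
      have Z1: "(\<Sum>c\<in>\<Omega>. Z1 c) \<le> real (card \<Omega>) * (n * (real (card J) * \<eta>1))"
      proof -
        have "(\<Sum>c\<in>\<Omega>. Z1 c) = (\<Sum>m\<in>UNIV. \<Sum>c\<in>\<Omega>. \<Sum>p\<in>D. (X m c p)\<^sup>2)"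
          unfolding Z1_def by (rule sum.swap)
        also have "\<dots> \<le> (\<Sum>m\<in>(UNIV :: 'n set). real (card \<Omega>) * (real (card J) * \<eta>1))"
          unfolding X_def \<Omega>_def
          by (intro sum_mono scatter_second_moment) (use fJ S T fD injT locD centred tailT in auto)
        finally show ?thesis by (simp add: n_def mult_ac)
      qed
      have Z2: "(\<Sum>c\<in>\<Omega>. Z2 c) \<le> real (card \<Omega>) * (n * (real (card J) * \<eta>2))"
      proof -
        have "(\<Sum>c\<in>\<Omega>. Z2 c) = (\<Sum>m\<in>UNIV. \<Sum>c\<in>\<Omega>. \<Sum>p\<in>D. (Y m c p)\<^sup>2)"
          unfolding Z2_def by (rule sum.swap)
        also have "\<dots> \<le> (\<Sum>m\<in>(UNIV :: 'n set). real (card \<Omega>) * (real (card J) * \<eta>2))"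
          unfolding Y_def \<Omega>_def
          by (intro sum_mono scatter_second_moment) (use fJ S T' fD injT' locD e_centred e_small in auto)
        finally show ?thesis by (simp add: n_def mult_ac)
      qed
      have Zpos: "0 \<le> Z1 c" "0 \<le> Z2 c" for c by (simp_all add: Z1_def Z2_def sum_nonneg)
      define \<G> where "\<G> = {c\<in>\<Omega>. Z1 c < t1 * real (card J) \<and> Z2 c < t2 * real (card J)}"
      have \<G>: "\<G> \<subseteq> (J \<rightarrow>\<^sub>E S)" by (auto simp: \<G>_def \<Omega>_def)
      have big: "q * real (card S) ^ card J < real (card \<G>)"
      proof -
        have quot: "n * (real (card J) * \<eta>1) / (t1 * real (card J)) = (1 - q) / 4"
          "n * (real (card J) * \<eta>2) / (t2 * real (card J)) = (1 - q) / 4"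
          using cJ0 t1 t2 n by (simp_all add: \<eta>1_def \<eta>2_def)
        have A1: "real (card {c\<in>\<Omega>. t1 * real (card J) \<le> Z1 c}) \<le> real (card \<Omega>) * ((1 - q) / 4)"
          unfolding quot(1)[symmetric] by (rule card_markov[OF f\<Omega> Zpos(1) Z1]) (use t1 cJ0 in simp)
        have A2: "real (card {c\<in>\<Omega>. t2 * real (card J) \<le> Z2 c}) \<le> real (card \<Omega>) * ((1 - q) / 4)"
          unfolding quot(2)[symmetric] by (rule card_markov[OF f\<Omega> Zpos(2) Z2]) (use t2 cJ0 in simp)
        have "\<Omega> \<subseteq> \<G> \<union> ({c\<in>\<Omega>. t1 * real (card J) \<le> Z1 c} \<union> {c\<in>\<Omega>. t2 * real (card J) \<le> Z2 c})"
          by (auto simp: \<G>_def)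
        then have "card \<Omega> \<le> card (\<G> \<union> ({c\<in>\<Omega>. t1 * real (card J) \<le> Z1 c} \<union> {c\<in>\<Omega>. t2 * real (card J) \<le> Z2 c}))"
          using f\<Omega> by (intro card_mono) (auto simp: \<G>_def)
        also have "\<dots> \<le> card \<G> + card ({c\<in>\<Omega>. t1 * real (card J) \<le> Z1 c} \<union> {c\<in>\<Omega>. t2 * real (card J) \<le> Z2 c})"
          by (rule card_Un_le)
        also have "\<dots> \<le> card \<G> + (card {c\<in>\<Omega>. t1 * real (card J) \<le> Z1 c} + card {c\<in>\<Omega>. t2 * real (card J) \<le> Z2 c})"
          by (intro add_left_mono card_Un_le)
        finally have "real (card \<Omega>) \<le> real (card \<G>) + (real (card \<Omega>) * ((1 - q) / 4) + real (card \<Omega>) * ((1 - q) / 4))"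
          using A1 A2 by linarith
        then have "real (card \<Omega>) * ((1 + q) / 2) \<le> real (card \<G>)" by (simp add: field_simps)
        moreover have "real (card \<Omega>) * q < real (card \<Omega>) * ((1 + q) / 2)"
          using c\<Omega>0 q by (intro mult_strict_left_mono) auto
        ultimately show ?thesis by (simp add: c\<Omega> mult.commute)
      qed
      \<comment> \<open>\<open>B1\<close> collects the prescriptions spoiled by interference and is
        measured against \<open>card J\<close>; \<open>B2\<close> collects the points where the
        equations may fail and is measured against \<open>d i\<close>.\<close>
      define B1 where "B1 c = {j\<in>J. \<exists>m. \<exists>\<kappa>\<in>Kg. \<epsilon>1 \<le> \<bar>X m c (s \<kappa> j)\<bar>}" for c
      define B2 where "B2 c = {p\<in>D. \<not> sofic_good s Q p \<or> (\<exists>(l, g)\<in>R. \<epsilon> \<le> \<bar>Y l c (s (- g) p)\<bar>)}" for c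
      have cB1: "real (card (B1 c)) \<le> \<beta> / 2 * real (card J)" if c: "c \<in> \<G>" for c
      proof -
        have "\<epsilon>1\<^sup>2 * real (card (B1 c)) \<le> real (card Kg) * Z1 c"
          unfolding Z1_def
          by (rule card_exceedance_le[where A = J and h = s])
            (use fJ Kg fD \<epsilon>1 inj JD sD in \<open>auto simp: B1_def intro: inj_on_subset\<close>)
        also have "\<dots> \<le> (real (card Kg) + 1) * (t1 * real (card J))"
          using c Zpos[of c] by (intro mult_mono) (auto simp: \<G>_def)
        also have "\<dots> = \<epsilon>1\<^sup>2 * (\<beta> / 2 * real (card J))"
          by (simp add: t1_def field_simps)
        finally show ?thesis using \<epsilon>1 by simp
      qed
      have cB2: "real (card (B2 c)) \<le> \<tau> * real (d i)" if c: "c \<in> \<G>" for c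
      proof -
        define B3 where "B3 = {p\<in>D. \<exists>l. \<exists>z\<in>R. \<epsilon> \<le> \<bar>Y l c (s (- snd z) p)\<bar>}"
        have "\<epsilon>\<^sup>2 * real (card B3) \<le> real (card R) * Z2 c"
          unfolding Z2_def
          by (rule card_exceedance_le[where A = D and h = "\<lambda>z. s (- snd z)"])
            (use R fD \<epsilon> inj sD in \<open>auto simp: B3_def intro: inj_on_subset\<close>)
        also have "\<dots> \<le> (real (card R) + 1) * (t2 * real (d i))"
        proof (intro mult_mono)
          have "t2 * real (card J) \<le> t2 * real (d i)" using cJd t2 by simp
          then show "Z2 c \<le> t2 * real (d i)" using c by (simp add: \<G>_def)
        qed (use Zpos[of c] in auto)
        also have "\<dots> = \<epsilon>\<^sup>2 * (\<tau> / 2 * real (d i))" by (simp add: t2_def field_simps)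
        finally have "real (card B3) \<le> \<tau> / 2 * real (d i)" using \<epsilon> by simp
        moreover have "\<kappa> * real (d i) \<le> \<tau> / 2 * real (d i)" using \<kappa>(3) by (rule mult_right_mono) simp
        moreover have "B2 c \<subseteq> {j\<in>{1..d i}. \<not> sofic_good (\<sigma> i) Q j} \<union> B3"
          by (force simp: B2_def B3_def s_def D_def)
        then have "card (B2 c) \<le> card ({j\<in>{1..d i}. \<not> sofic_good (\<sigma> i) Q j} \<union> B3)"
          using fD by (intro card_mono) (auto simp: B3_def)
        then have "card (B2 c) \<le> card {j\<in>{1..d i}. \<not> sofic_good (\<sigma> i) Q j} + card B3"
          using card_Un_le le_trans by blast
        ultimately show ?thesis using bad by linarith
      qed
      have "\<exists>J'\<subseteq>J. \<beta> * real (card J) \<le> real (card J') \<and>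
         (\<forall>c \<in> J' \<rightarrow> S. \<exists>c'\<in>\<G>. (\<forall>j\<in>J'. c' j = c j) \<and> (B1 c' \<union> B2 c' \<inter> J) \<inter> J' = {})"
      proof (rule shatter[OF fJ J0 \<G> _ big])
        fix c assume c: "c \<in> \<G>"
        have "card (B2 c \<inter> J) \<le> card (B2 c)" using fD by (intro card_mono) (auto simp: B2_def)
        then have "real (card (B2 c \<inter> J)) \<le> \<tau> * real (d i)" using cB2[OF c] by linarith
        also have "\<dots> \<le> \<beta> / 2 * rJ * real (d i)" using \<tau>(3) by (rule mult_right_mono) simp
        also have "\<dots> = \<beta> / 2 * (rJ * real (d i))" by simp
        also have "\<dots> \<le> \<beta> / 2 * real (card J)" using cJ \<beta> by (intro mult_left_mono) auto
        finally have "real (card (B2 c \<inter> J)) \<le> \<beta> / 2 * real (card J)" .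
        moreover have "card (B1 c \<union> B2 c \<inter> J) \<le> card (B1 c) + card (B2 c \<inter> J)" by (rule card_Un_le)
        moreover have "\<beta> * real (card J) = \<beta> / 2 * real (card J) + \<beta> / 2 * real (card J)" by simp
        ultimately have "real (card (B1 c \<union> B2 c \<inter> J)) \<le> \<beta> * real (card J)"
          using cB1[OF c] by linarith
        then show "B1 c \<union> B2 c \<inter> J \<subseteq> J \<and> real (card (B1 c \<union> B2 c \<inter> J)) \<le> \<beta> * real (card J)"
          by (auto simp: B1_def)
      qed
      then obtain J' where J': "J' \<subseteq> J" "\<beta> * real (card J) \<le> real (card J')"
        and sh: "\<And>c. c \<in> J' \<rightarrow> S \<Longrightarrow> \<exists>c'\<in>\<G>. (\<forall>j\<in>J'. c' j = c j) \<and> (B1 c' \<union> B2 c' \<inter> J) \<inter> J' = {}"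
        by blast
      have good_use: "s (g + h) p = s g (s h p)" if "sofic_good s Q p" "g \<in> Q" "h \<in> Q" for g h p
        using that by (simp add: sofic_good_def)
      show "\<exists>J\<subseteq>{1..d i}. \<beta> * rJ * real (d i) \<le> real (card J) \<and>
        realises_patterns (\<sigma> i) (d i) f K R F \<epsilon> \<tau>0 S \<Xi> Kg \<epsilon>1 J"
        unfolding realises_patterns_def s_def[symmetric] D_def[symmetric]
      proof (intro exI[of _ J'] conjI ballI)
        show "J' \<subseteq> D" using J' JD by blast
        have "\<beta> * rJ * real (d i) = \<beta> * (rJ * real (d i))" by simp
        also have "\<dots> \<le> \<beta> * real (card J)" using cJ \<beta> by (intro mult_left_mono) auto
        finally show "\<beta> * rJ * real (d i) \<le> real (card J')" using J'(2) by linarith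
        fix c assume "c \<in> J' \<rightarrow> S"
        from sh[OF this] obtain c' where c': "c' \<in> \<G>" "\<And>j. j \<in> J' \<Longrightarrow> c' j = c j"
          and B: "(B1 c' \<union> B2 c' \<inter> J) \<inter> J' = {}" by blast
        \<comment> \<open>The superposition uses the good map \<open>c'\<close> on all of
          \<open>J\<close>: it agrees with \<open>c\<close> on \<open>J'\<close>, and nothing is
          prescribed on the rest of \<open>J\<close>.\<close>
        define \<psi> where "\<psi> m p = scatter loc T J (\<lambda>s \<gamma>. \<Xi> s m \<gamma>) c' p" for m p
        have cB: "real (card (B2 c')) \<le> \<tau>0 * real (d i)"
          using cB2[OF c'(1)] mult_right_mono[OF \<tau>(2), of "real (d i)"] by linarith
        have rel: "\<exists>z\<in>\<int>. \<bar>pairing (right_mult f (axis l (frag_of g))) (\<lambda>m h. \<psi> m (s (- h) p)) - z\<bar> < \<epsilon>"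
          if p: "p \<in> D - B2 c'" and lg: "(l, g) \<in> R" for p l g
        proof -
          have good: "sofic_good s Q p" and small: "\<bar>Y l c' (s (- g) p)\<bar> < \<epsilon>"
            using p lg by (auto simp: B2_def not_le)
          have inE: "h \<in> E" if "h \<in> supp (f $ l $ m)" for m h using that by (auto simp: E_def H_def)
          have gE: "g \<in> E" using lg by (force simp: E_def)
          have "pairing (right_mult f (axis l (frag_of g))) (\<lambda>m h. \<psi> m (s (- h) p))
            = pairing (right_mult f (axis l (frag_of g)))
              (\<lambda>m h. scatter (\<lambda>j \<gamma>. s \<gamma> j) T J (\<lambda>c \<gamma>. v c m \<gamma>) c' (s (- h) p))"
            unfolding \<psi>_def loc_def by (intro pairing_cong scatter_cong) (simp add: v_def)
          also have "\<dots> = scatter (\<lambda>j \<gamma>. s \<gamma> j) T' J (\<lambda>c \<gamma>. conv f (v c) l \<gamma>) c' (s (- g) p)"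
          proof (rule pairing_scatter[OF inj T(1) T'(1)])
            show "h + \<gamma> \<in> T'" if "h \<in> supp (f $ l $ m)" "\<gamma> \<in> T" for m h \<gamma>
              using that by (force simp: T'_def H_def)
            show "v c m \<gamma> = 0" if "\<gamma> \<notin> T" for c m \<gamma> using that by (simp add: v_def)
            show "s (h + \<gamma>) j = s h (s \<gamma> j)" if "j \<in> J" "h \<in> supp (f $ l $ m)" "\<gamma> \<in> T" for j m h \<gamma>
              using goodJ[OF that(1)] inE[OF that(2)] that(3) T'(2) E_T'
              by (intro good_use E'Q EE') auto
            show "s (h + (- h + - g)) p = s h (s (- h + - g) p)" if "h \<in> supp (f $ l $ m)" for m h
              using inE[OF that] gE by (intro good_use[OF good] E'Q EE' Q_add)
          qed
          also have "\<dots> = scatter loc T' J (\<lambda>s \<gamma>. conv f (\<Xi> s) l \<gamma> + e s l \<gamma>) c' (s (- g) p)"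
            unfolding loc_def by (simp add: e_def)
          \<comment> \<open>The first summand superposes integers and is the required
            \<open>z\<close>; the second is small outside \<open>B2 c'\<close>.\<close>
          also have "\<dots> = scatter loc T' J (\<lambda>s \<gamma>. conv f (\<Xi> s) l \<gamma>) c' (s (- g) p) + Y l c' (s (- g) p)"
            unfolding Y_def by (rule scatter_add)
          finally show ?thesis using small scatter_Ints[of T' "\<lambda>s \<gamma>. conv f (\<Xi> s) l \<gamma>" loc J c' "s (- g) p"] int
            by (intro bexI[of _ "scatter loc T' J (\<lambda>s \<gamma>. conv f (\<Xi> s) l \<gamma>) c' (s (- g) p)"]) auto
        qed
        have equiv: "pairing (left_mult (- g) a) (\<lambda>m h. \<psi> m (s (- h) p)) = pairing a (\<lambda>m h. \<psi> m (s (- h) (s g p)))"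
          if p: "p \<in> D - B2 c'" and g: "g \<in> F" and a: "a \<in> K" for p g a
        proof (rule pairing_left_mult_sofic_good)
          show "sofic_good s Q p" using p by (auto simp: B2_def)
          show "g \<in> Q" using g by (intro E'Q EE') (simp add: E_def)
          show "- h \<in> Q" if "h \<in> supp (a $ m)" for m h
            using that a by (intro E'Q EE') (auto simp: E_def)
        qed
        note cB
        moreover have "\<bar>\<psi> m (s \<kappa> j) - \<Xi> (c j) m \<kappa>\<bar> < \<epsilon>1" if j: "j \<in> J'" and \<kappa>: "\<kappa> \<in> Kg" for j m \<kappa>
        proof -
          have jJ: "j \<in> J" using j J' by blast
          have \<kappa>L: "\<kappa> \<in> L" using \<kappa> L by blast
          \<comment> \<open>By separation, the windows \<open>L\<close> contribute at
            \<open>s \<kappa> j\<close> only the copy attached to \<open>j\<close>; everything else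
            there is interference.\<close>
          have "\<psi> m (s \<kappa> j) = scatter loc L J (\<lambda>s \<gamma>. \<Xi> s m \<gamma>) c' (loc j \<kappa>) + X m c' (s \<kappa> j)"
            unfolding \<psi>_def X_def scatter_split[OF T(1,2)] by (simp add: loc_def)
          also have "scatter loc L J (\<lambda>s \<gamma>. \<Xi> s m \<gamma>) c' (loc j \<kappa>) = \<Xi> (c' j) m \<kappa>"
            by (rule scatter_at_separated_point[where loc = loc, OF fJ jJ L(1) \<kappa>L injT(2)[OF jJ]])
              (use sep jJ \<kappa>L in \<open>auto simp: loc_def\<close>)
          finally have "\<psi> m (s \<kappa> j) - \<Xi> (c j) m \<kappa> = X m c' (s \<kappa> j)" using c'(2)[OF j] by simp
          moreover have "j \<notin> B1 c'" using B j by blast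
          ultimately show ?thesis using jJ \<kappa> by (auto simp: B1_def not_le)
        qed
        moreover have "B2 c' \<inter> J' = {}" using B J'(1) by blast
        moreover have "B2 c' \<subseteq> D" by (auto simp: B2_def)
        moreover have "almost_solution s (d i) f K R F \<epsilon> (B2 c') \<psi>"
          unfolding almost_solution_def D_def[symmetric] using rel equiv by blast
        ultimately show "\<exists>\<psi> B. B \<subseteq> D \<and> real (card B) \<le> \<tau>0 * real (d i) \<and> B \<inter> J' = {} \<and>
          almost_solution s (d i) f K R F \<epsilon> B \<psi> \<and>
          (\<forall>j\<in>J'. \<forall>m. \<forall>\<kappa>\<in>Kg. \<bar>\<psi> m (s \<kappa> j) - \<Xi> (c j) m \<kappa>\<bar> < \<epsilon>1)"
          by (intro exI[of _ \<psi>] exI[of _ "B2 c'"]) auto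
      qed
    qed
  qed
qed

section \<open>Prescribing points of X_f through homoclinic approximations\<close>

theorem theorem1p2:
  fixes d :: "nat \<Rightarrow> nat"
    and \<sigma> :: "nat \<Rightarrow> 'g::{group_add, countable} \<Rightarrow> nat \<Rightarrow> nat"
    and f :: "('g \<Rightarrow>\<^sub>0 int)^'n^'n"
    and \<rho> :: "((('g \<Rightarrow>\<^sub>0 int)^'n) set \<Rightarrow> circle) \<Rightarrow> ((('g \<Rightarrow>\<^sub>0 int)^'n) set \<Rightarrow> circle) \<Rightarrow> real"
    and k :: nat
    and x :: "nat \<Rightarrow> (('g \<Rightarrow>\<^sub>0 int)^'n) set \<Rightarrow> circle"
  assumes "sofic_approximation d \<sigma>"
    and "op_matrix_of f \<in> vN_GL"
    and "continuous_pseudometric (X_space f) \<rho>"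
    and "dynamically_generating (X_space f) (X_action f) \<rho>"
    and "\<And>l. l \<in> {1..k} \<Longrightarrow> x l \<in> topspace (X_space f)"
  shows "IE_tuple (X_space f) (X_action f) \<rho> d \<sigma> k x"
proof -
  obtain \<Xi> :: "('g \<Rightarrow>\<^sub>0 int)^'n \<Rightarrow> 'n \<Rightarrow> 'g \<Rightarrow> real" where
    \<Xi>_add: "\<And>v w m \<gamma>. \<Xi> (v + w) m \<gamma> = \<Xi> v m \<gamma> + \<Xi> w m \<gamma>"
    and \<Xi>_conv: "\<And>w l \<gamma>. conv f (\<Xi> w) l \<gamma> = of_int (coef (w $ l) \<gamma>)"
    and \<Xi>_summ: "\<And>w m. (\<lambda>\<gamma>. (\<Xi> w m \<gamma>)\<^sup>2) summable_on UNIV"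
    and \<Xi>_sep: "\<And>a. (\<And>w. pairing a (\<lambda>m g. \<Xi> w m (- g)) \<in> \<int>) \<Longrightarrow> \<exists>b. a = right_mult f b"
    using homoclinic_points[OF assms(2)] by metis
  have \<Xi>_0: "\<Xi> 0 m \<gamma> = 0" for m \<gamma> using \<Xi>_add[of 0 0 m \<gamma>] by simp
  have \<Xi>_sum: "\<Xi> (\<Sum>s\<in>A. w s) m \<gamma> = (\<Sum>s\<in>A. \<Xi> (w s) m \<gamma>)" if "finite A" for A :: "nat set" and w m \<gamma>
    using that by (induction A rule: finite_induct) (simp_all add: \<Xi>_0 \<Xi>_add)
  obtain \<theta> where \<theta>: "\<And>l. l \<in> {1..k} \<Longrightarrow> \<theta> l \<in> annihilator f" "\<And>l. l \<in> {1..k} \<Longrightarrow> x l = descend f (\<theta> l)"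
  proof -
    have "\<exists>t\<in>annihilator f. x l = descend f t" if "l \<in> {1..k}" for l
      by (rule X_space_descend[OF assms(5)[OF that]]) blast
    then show thesis using that by metis
  qed
  have "\<exists>r>0. \<forall>F \<delta>. finite F \<and> \<delta> > 0 \<longrightarrow>
        (\<exists>\<^sub>\<infinity>i. \<exists>J. independence_set (X_space f) (X_action f) \<rho> F \<delta> (d i) (\<sigma> i) k U J \<and>
                 real (card J) \<ge> r * real (d i))"
    if U: "\<forall>l\<in>{1..k}. U l \<subseteq> topspace (X_space f) \<and> (\<exists>V. openin (X_space f) V \<and> x l \<in> V \<and> V \<subseteq> U l)" for U
  proof -
    have "\<exists>K \<epsilon>. finite K \<and> 0 < \<epsilon> \<and> (\<forall>\<theta>'\<in>annihilator f.
        (\<forall>a\<in>K. cmod (circle_exp (\<theta>' a) - circle_exp (\<theta> l a)) < \<epsilon>) \<longrightarrow> descend f \<theta>' \<in> U l)"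
      if l: "l \<in> {1..k}" for l
    proof -
      obtain V where V: "openin (X_space f) V" "descend f (\<theta> l) \<in> V" "V \<subseteq> U l"
        using bspec[OF U l] unfolding \<theta>(2)[OF l] by blast
      show ?thesis
      proof (rule X_space_neighbourhood[OF V(1,2) \<theta>(1)[OF l]])
        fix K and \<epsilon> :: real assume fin: "finite K" "0 < \<epsilon>"
          and b: "\<And>\<theta>'. \<theta>' \<in> annihilator f \<Longrightarrow>
            (\<And>a. a \<in> K \<Longrightarrow> cmod (circle_exp (\<theta>' a) - circle_exp (\<theta> l a)) < \<epsilon>) \<Longrightarrow> descend f \<theta>' \<in> V"
        have "descend f \<theta>' \<in> U l"
          if "\<theta>' \<in> annihilator f" "\<forall>a\<in>K. cmod (circle_exp (\<theta>' a) - circle_exp (\<theta> l a)) < \<epsilon>" for \<theta>'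
        proof (rule subsetD[OF V(3)], rule b[OF that(1)])
          show "cmod (circle_exp (\<theta>' a) - circle_exp (\<theta> l a)) < \<epsilon>" if "a \<in> K" for a
            using bspec[OF \<open>\<forall>a\<in>K. _\<close> that] .
        qed
        with fin show ?thesis by (intro exI[of _ K] exI[of _ \<epsilon>]) simp
      qed
    qed
    then obtain K \<epsilon> where K: "\<And>l. l \<in> {1..k} \<Longrightarrow> finite (K l)" and \<epsilon>: "\<And>l. l \<in> {1..k} \<Longrightarrow> 0 < (\<epsilon> l :: real)"
      and nbh: "\<And>l \<theta>'. l \<in> {1..k} \<Longrightarrow> \<theta>' \<in> annihilator f \<Longrightarrow>
        \<forall>a\<in>K l. cmod (circle_exp (\<theta>' a) - circle_exp (\<theta> l a)) < \<epsilon> l \<Longrightarrow> descend f \<theta>' \<in> U l"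
      by metis
    define K0 where "K0 = (\<Union>l\<in>{1..k}. K l)"
    \<comment> \<open>A third, because three approximations are chained: from the microstate to the
      lift \<psi>, from there to the homoclinic point, and from there to \<open>\<theta> l\<close>.
      The inserted 1 provides for \<open>k = 0\<close>.\<close>
    define \<epsilon>0 where "\<epsilon>0 = Min (insert 1 (\<epsilon> ` {1..k})) / 3"
    have K0: "finite K0" using K by (simp add: K0_def)
    have \<epsilon>0: "0 < \<epsilon>0" using \<epsilon> by (simp add: \<epsilon>0_def)
    have \<epsilon>0_le: "3 * \<epsilon>0 \<le> \<epsilon> l" if "l \<in> {1..k}" for l
    proof -
      have "Min (insert 1 (\<epsilon> ` {1..k})) \<le> \<epsilon> l" using that by (intro Min_le) auto
      then show ?thesis unfolding \<epsilon>0_def by linarith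
    qed
    have "\<exists>w. \<forall>a\<in>K0. cmod (circle_exp (abs_circle (pairing a (\<lambda>m g. \<Xi> w m (- g)))) - circle_exp (\<theta> l a)) < \<epsilon>0"
      if "l \<in> {1..k}" for l
      by (rule homoclinic_points_dense[OF \<Xi>_add \<Xi>_sep \<theta>(1)[OF that] K0 \<epsilon>0])
    then obtain w0 where w0: "\<And>l a. l \<in> {1..k} \<Longrightarrow> a \<in> K0 \<Longrightarrow>
        cmod (circle_exp (abs_circle (pairing a (\<lambda>m g. \<Xi> (w0 l) m (- g)))) - circle_exp (\<theta> l a)) < \<epsilon>0"
      by metis
    \<comment> \<open>Index 0 receives the vector that makes the sum over \<open>{0..k}\<close>
      vanish, which centres the symbols.\<close>
    define w where "w s = (if s \<in> {1..k} then w0 s else - (\<Sum>l=1..k. w0 l))" for s :: nat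
    have w_sum: "(\<Sum>s\<in>{0..k}. w s) = 0"
    proof -
      have "(\<Sum>s\<in>{0..k}. w s) = w 0 + (\<Sum>s=1..k. w s)" by (simp add: sum.atLeast_Suc_atMost)
      also have "(\<Sum>s=1..k. w s) = (\<Sum>s=1..k. w0 s)" by (intro sum.cong) (auto simp: w_def)
      finally show ?thesis by (simp add: w_def)
    qed
    \<comment> \<open>Inverses, because the character at \<open>j\<close> is read off from the
      values of \<psi> at \<open>\<sigma> i (- h) j\<close>.\<close>
    define Kg where "Kg = (\<Union>a\<in>K0. \<Union>m. uminus ` supp (a $ m))"
    have Kg: "finite Kg" using K0 by (simp add: Kg_def)
    \<comment> \<open>As a function of a real lift, \<open>circle_exp\<close> is Lipschitz with
      constant \<open>2 * pi\<close>.\<close>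
    have "0 < \<epsilon>0 / (2 * pi)" using \<epsilon>0 by simp
    from pairing_close[OF K0 this]
    obtain \<epsilon>1 where \<epsilon>1: "0 < \<epsilon>1"
      and close: "\<And>a \<Psi> \<Phi>. a \<in> K0 \<Longrightarrow> (\<And>m h. h \<in> supp (a $ m) \<Longrightarrow> \<bar>\<Psi> m h - \<Phi> m h\<bar> < \<epsilon>1) \<Longrightarrow>
        \<bar>pairing a \<Psi> - pairing a \<Phi>\<bar> < \<epsilon>0 / (2 * pi)"
      by metis
    show ?thesis
    proof (rule sofic_patterns[OF assms(1), where S = "{0..k}" and \<Xi> = "\<lambda>s. \<Xi> (w s)" and f = f and Kg = Kg and ?\<epsilon>1.0 = \<epsilon>1])
      show "(\<Sum>s\<in>{0..k}. \<Xi> (w s) m \<gamma>) = 0" for m \<gamma>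
        by (simp add: \<Xi>_sum[symmetric] w_sum \<Xi>_0)
      fix r :: real
      assume r: "0 < r" and patterns: "\<And>K R F \<epsilon> \<tau>. finite K \<Longrightarrow> finite R \<Longrightarrow> finite F \<Longrightarrow> 0 < \<epsilon> \<Longrightarrow> 0 < \<tau> \<Longrightarrow>
        eventually (\<lambda>i. \<exists>J\<subseteq>{1..d i}. r * real (d i) \<le> real (card J) \<and>
          realises_patterns (\<sigma> i) (d i) f K R F \<epsilon> \<tau> {0..k} (\<lambda>c. \<Xi> (w c)) Kg \<epsilon>1 J) sequentially"
      show ?thesis
      proof (intro exI[of _ r] conjI allI impI)
        fix F :: "'g set" and \<delta> :: real assume "finite F \<and> \<delta> > 0"
        then have F: "finite F" and \<delta>: "0 < \<delta>" by auto
        show "\<exists>\<^sub>\<infinity>i. \<exists>J. independence_set (X_space f) (X_action f) \<rho> F \<delta> (d i) (\<sigma> i) k U J \<and>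
                 real (card J) \<ge> r * real (d i)"
        proof (rule microstate_of_almost_solution[OF assms(3) F \<delta> K0 \<epsilon>0])
          fix K1 :: "(('g \<Rightarrow>\<^sub>0 int)^'n) set" and R :: "('n \<times> 'g) set" and \<epsilon>2 \<tau> :: real
          assume K1: "finite K1" and R: "finite R" and \<epsilon>2: "0 < \<epsilon>2" and \<tau>: "0 < \<tau>"
            and micro: "\<And>d s \<theta> B. 0 < d \<Longrightarrow> (\<And>g. s g permutes {1..d}) \<Longrightarrow> B \<subseteq> {1..d} \<Longrightarrow>
              real (card B) \<le> \<tau> * real d \<Longrightarrow>
              (\<And>p a b. \<theta> p (a + b) = \<theta> p a + \<theta> p b) \<Longrightarrow>
              (\<And>p l g. p \<in> {1..d} - B \<Longrightarrow> (l, g) \<in> R \<Longrightarrow>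
                cmod (circle_exp (\<theta> p (right_mult f (axis l (frag_of g)))) - 1) < \<epsilon>2) \<Longrightarrow>
              (\<And>p g a. p \<in> {1..d} - B \<Longrightarrow> g \<in> F \<Longrightarrow> a \<in> K1 \<Longrightarrow> \<theta> (s g p) a = \<theta> p (left_mult (- g) a)) \<Longrightarrow>
              \<exists>\<phi>\<in>Map_set (X_space f) (X_action f) \<rho> F \<delta> d s. \<forall>p\<in>{1..d} - B. \<exists>\<theta>'\<in>annihilator f.
                \<phi> p = descend f \<theta>' \<and> (\<forall>a\<in>K0. cmod (circle_exp (\<theta> p a) - circle_exp (\<theta>' a)) < \<epsilon>0)"
          have "0 < \<epsilon>2 / (2 * pi)" using \<epsilon>2 by simp
          from patterns[OF K1 R F this \<tau>]
          have "eventually (\<lambda>i. \<exists>J. independence_set (X_space f) (X_action f) \<rho> F \<delta> (d i) (\<sigma> i) k U J \<and>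
                 real (card J) \<ge> r * real (d i)) sequentially"
          proof (rule eventually_mono)
            fix i
            assume "\<exists>J\<subseteq>{1..d i}. r * real (d i) \<le> real (card J) \<and>
              realises_patterns (\<sigma> i) (d i) f K1 R F (\<epsilon>2 / (2 * pi)) \<tau> {0..k} (\<lambda>c. \<Xi> (w c)) Kg \<epsilon>1 J"
            then obtain J where J: "J \<subseteq> {1..d i}" "r * real (d i) \<le> real (card J)"
              and pat: "realises_patterns (\<sigma> i) (d i) f K1 R F (\<epsilon>2 / (2 * pi)) \<tau> {0..k} (\<lambda>c. \<Xi> (w c)) Kg \<epsilon>1 J"
              by blast
            have "\<exists>\<phi>\<in>Map_set (X_space f) (X_action f) \<rho> F \<delta> (d i) (\<sigma> i). \<forall>j\<in>J. \<phi> j \<in> U (c j)"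
              if c: "c \<in> J \<rightarrow> {1..k}" for c
            proof -
              \<comment> \<open>The auxiliary symbol 0 takes part in the random choice but is never
                prescribed.\<close>
              have "c \<in> J \<rightarrow> {0..k}" using c by auto
              from bspec[OF pat[unfolded realises_patterns_def] this] obtain \<psi> B where B: "B \<subseteq> {1..d i}" "real (card B) \<le> \<tau> * real (d i)" "B \<inter> J = {}"
                and sol: "almost_solution (\<sigma> i) (d i) f K1 R F (\<epsilon>2 / (2 * pi)) B \<psi>"
                and loc: "\<forall>j\<in>J. \<forall>m. \<forall>\<kappa>\<in>Kg. \<bar>\<psi> m (\<sigma> i \<kappa> j) - \<Xi> (w (c j)) m \<kappa>\<bar> < \<epsilon>1"
                by blast
              define \<theta>\<psi> where "\<theta>\<psi> p a = abs_circle (pairing a (\<lambda>m h. \<psi> m (\<sigma> i (- h) p)))" for p a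
              have "\<exists>\<phi>\<in>Map_set (X_space f) (X_action f) \<rho> F \<delta> (d i) (\<sigma> i). \<forall>p\<in>{1..d i} - B. \<exists>\<theta>'\<in>annihilator f.
                \<phi> p = descend f \<theta>' \<and> (\<forall>a\<in>K0. cmod (circle_exp (\<theta>\<psi> p a) - circle_exp (\<theta>' a)) < \<epsilon>0)"
              proof (rule micro)
                show "0 < d i" "\<sigma> i g permutes {1..d i}" for g
                  using assms(1) by (auto simp: sofic_approximation_def)
                show "\<theta>\<psi> p (a + b) = \<theta>\<psi> p a + \<theta>\<psi> p b" for p a b
                  by (simp add: \<theta>\<psi>_def pairing_add abs_circle_add)
                show "\<theta>\<psi> (\<sigma> i g p) a = \<theta>\<psi> p (left_mult (- g) a)" if "p \<in> {1..d i} - B" "g \<in> F" "a \<in> K1" for p g a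
                  using sol that by (simp add: \<theta>\<psi>_def almost_solution_def)
                fix p l g assume p: "p \<in> {1..d i} - B" and lg: "(l, g) \<in> R"
                obtain z where z: "z \<in> \<int>" "\<bar>pairing (right_mult f (axis l (frag_of g)))
                    (\<lambda>m h. \<psi> m (\<sigma> i (- h) p)) - z\<bar> < \<epsilon>2 / (2 * pi)"
                  using sol p lg unfolding almost_solution_def by blast
                have "circle_exp (abs_circle z) = 1" using z(1) by (simp add: circle_exp_abs_eq_1_iff)
                then have "cmod (circle_exp (\<theta>\<psi> p (right_mult f (axis l (frag_of g)))) - 1)
                    \<le> 2 * pi * \<bar>pairing (right_mult f (axis l (frag_of g))) (\<lambda>m h. \<psi> m (\<sigma> i (- h) p)) - z\<bar>"
                  using norm_circle_exp_abs_diff_le[of _ z] unfolding \<theta>\<psi>_def by metis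
                also have "\<dots> < \<epsilon>2" using z(2) by (simp add: field_simps)
                finally show "cmod (circle_exp (\<theta>\<psi> p (right_mult f (axis l (frag_of g)))) - 1) < \<epsilon>2" .
              qed (use B in auto)
              then obtain \<phi> where \<phi>: "\<phi> \<in> Map_set (X_space f) (X_action f) \<rho> F \<delta> (d i) (\<sigma> i)"
                and near: "\<And>p. p \<in> {1..d i} - B \<Longrightarrow> \<exists>\<theta>'\<in>annihilator f.
                  \<phi> p = descend f \<theta>' \<and> (\<forall>a\<in>K0. cmod (circle_exp (\<theta>\<psi> p a) - circle_exp (\<theta>' a)) < \<epsilon>0)"
                by blast
              have "\<phi> j \<in> U (c j)" if j: "j \<in> J" for j
              proof -
                have cj: "c j \<in> {1..k}" using c j by auto
                have "j \<in> {1..d i} - B" using j J B by blast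
                from near[OF this] obtain \<theta>' where \<theta>': "\<theta>' \<in> annihilator f" "\<phi> j = descend f \<theta>'"
                  and cl: "\<And>a. a \<in> K0 \<Longrightarrow> cmod (circle_exp (\<theta>\<psi> j a) - circle_exp (\<theta>' a)) < \<epsilon>0" by blast
                have "cmod (circle_exp (\<theta>' a) - circle_exp (\<theta> (c j) a)) < \<epsilon> (c j)" if a: "a \<in> K (c j)" for a
                proof -
                  have aK: "a \<in> K0" using a cj by (auto simp: K0_def)
                  let ?t = "abs_circle (pairing a (\<lambda>m g. \<Xi> (w (c j)) m (- g)))"
                  have "\<bar>pairing a (\<lambda>m h. \<psi> m (\<sigma> i (- h) j)) - pairing a (\<lambda>m g. \<Xi> (w (c j)) m (- g))\<bar> < \<epsilon>0 / (2 * pi)"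
                    using aK j loc by (intro close) (auto simp: Kg_def)
                  then have "2 * pi * \<bar>pairing a (\<lambda>m h. \<psi> m (\<sigma> i (- h) j)) - pairing a (\<lambda>m g. \<Xi> (w (c j)) m (- g))\<bar> < \<epsilon>0"
                    by (simp add: field_simps)
                  then have 1: "cmod (circle_exp (\<theta>\<psi> j a) - circle_exp ?t) < \<epsilon>0"
                    unfolding \<theta>\<psi>_def by (rule le_less_trans[OF norm_circle_exp_abs_diff_le])
                  have 2: "cmod (circle_exp ?t - circle_exp (\<theta> (c j) a)) < \<epsilon>0"
                    using w0[OF cj aK] cj by (simp add: w_def)
                  have "circle_exp (\<theta>' a) - circle_exp (\<theta> (c j) a)
                      = (circle_exp (\<theta>' a) - circle_exp (\<theta>\<psi> j a)) + (circle_exp (\<theta>\<psi> j a) - circle_exp ?t)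
                        + (circle_exp ?t - circle_exp (\<theta> (c j) a))" by simp
                  also have "cmod \<dots> \<le> cmod (circle_exp (\<theta>' a) - circle_exp (\<theta>\<psi> j a))
                      + cmod (circle_exp (\<theta>\<psi> j a) - circle_exp ?t) + cmod (circle_exp ?t - circle_exp (\<theta> (c j) a))"
                    by (intro norm_triangle_mono order_refl)
                  also have "\<dots> < 3 * \<epsilon>0"
                    using cl[OF aK] 1 2 norm_minus_commute[of "circle_exp (\<theta>' a)" "circle_exp (\<theta>\<psi> j a)"] by linarith
                  finally show ?thesis using \<epsilon>0_le[OF cj] by linarith
                qed
                then show ?thesis unfolding \<theta>'(2) by (intro nbh[OF cj \<theta>'(1)] ballI)
              qed
              then show ?thesis using \<phi> by blast
            qed
            then show "\<exists>J. independence_set (X_space f) (X_action f) \<rho> F \<delta> (d i) (\<sigma> i) k U J \<and>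
                 real (card J) \<ge> r * real (d i)"
              using J unfolding independence_set_def by blast
          qed
          then show ?thesis
            unfolding cofinite_eq_sequentially by (intro eventually_frequently) auto
        qed
      qed (rule r)
    qed (use \<Xi>_conv \<Xi>_summ Kg \<epsilon>1 in auto)
  qed
  then show ?thesis unfolding IE_tuple_def by (intro conjI ballI allI impI assms(5))
qed

end
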